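(* Let $k \in \mathbb{N}$ and $n := 3^k$. Then $$f_{\max}(\mathbb{Z}_3^k) = \left( \frac{(n-3)(n-1)}{3} + o(1) \right) 3^{n/9},$$ where $o(1)$ denotes a quantity tending to $0$ as $k \to \infty$ (equivalently, as $n\to\infty$).
   Context: $\mathbb{Z}_3^k = \mathbb{Z}_3 \times \cdots \times \mathbb{Z}_3$ ($k$ factors), as an additive group. For a finite abelian group $G$, a Schur triple is a triple $x,y,z \in G$ (not necessarily distinct) with $x+y=z$. A subset $A \subseteq G$ is sum-free if $A$ contains no Schur triples, i.e. there are no $x,y,z\in A$ with $x+y=z$. A maximal sum-free subset of $G$ is a sum-free set $A \subseteq G$ that is not properly contained in another sum-free subset of $G$. $f_{\max}(G)$ denotes the number of maximal sum-free subsets of $G$. *)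

theory Defs
  imports Complex_Main "HOL-Algebra.Elementary_Groups" "HOL-Algebra.Product_Groups"
begin

text \<open>The group operation is written multiplicatively in HOL-Algebra: a Schur triple
  \<open>x + y = z\<close> reads \<open>x \<otimes>\<^bsub>G\<^esub> y = z\<close>. The elements \<open>x\<close>, \<open>y\<close>, \<open>z\<close> need not be distinct.\<close>

definition schur_triple :: "('a, 'b) monoid_scheme \<Rightarrow> 'a \<Rightarrow> 'a \<Rightarrow> 'a \<Rightarrow> bool" where
  "schur_triple G x y z \<longleftrightarrow>
     x \<in> carrier G \<and> y \<in> carrier G \<and> z \<in> carrier G \<and> x \<otimes>\<^bsub>G\<^esub> y = z"

definition sum_free :: "('a, 'b) monoid_scheme \<Rightarrow> 'a set \<Rightarrow> bool" where
  "sum_free G A \<longleftrightarrow>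
     A \<subseteq> carrier G \<and> \<not> (\<exists>x\<in>A. \<exists>y\<in>A. \<exists>z\<in>A. schur_triple G x y z)"

definition maximal_sum_free :: "('a, 'b) monoid_scheme \<Rightarrow> 'a set \<Rightarrow> bool" where
  "maximal_sum_free G A \<longleftrightarrow> sum_free G A \<and> \<not> (\<exists>B. sum_free G B \<and> A \<subset> B)"

definition f_max :: "('a, 'b) monoid_scheme \<Rightarrow> nat" where
  "f_max G = card {A. maximal_sum_free G A}"

definition Z3_pow :: "nat \<Rightarrow> (nat \<Rightarrow> int) monoid" where
  "Z3_pow k = product_group {..<k} (\<lambda>_. integer_mod_group 3)"

lemma comm_group_Z3_pow: "comm_group (Z3_pow k)"
  unfolding Z3_pow_def by (rule group.group_comm_groupI) (simp_all add: add.commute)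

lemma order_Z3_pow: "order (Z3_pow k) = 3 ^ k"
  by (simp add: order_def Z3_pow_def card_PiE carrier_integer_mod_group)

lemma finite_carrier_Z3_pow: "finite (carrier (Z3_pow k))"
  by (simp add: Z3_pow_def carrier_integer_mod_group finite_PiE)

lemma finite_maximal_sum_free_Z3_pow: "finite {A. maximal_sum_free (Z3_pow k) A}"
  by (rule finite_subset[of _ "Pow (carrier (Z3_pow k))"])
     (auto simp: maximal_sum_free_def sum_free_def finite_carrier_Z3_pow)

end

theory Submission
  imports Defs "HOL-Library.FuncSet" "HOL-Library.Numeral_Type" "HOL-Library.Function_Algebras"
    "HOL-Computational_Algebra.Primes" "HOL-Analysis.Convex"
begin

text \<open>
  If a maximal sum-free set \<open>A\<close> meets a sum-free set \<open>F\<close> and \<open>T = A - F\<close>, then \<open>A \<inter> F\<close> is a maximal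
  independent set of the link graph of \<open>T\<close> on \<open>F\<close>, in which \<open>x\<close> and \<open>y\<close> are adjacent when they form a
  Schur triple with an element of \<open>T\<close>. A graph on \<open>m\<close> vertices has at most \<open>3 powr (m / 3)\<close> maximal
  independent sets, and exponentially fewer unless almost all vertices lie in disjoint induced
  triangles.

  A regularity argument (energy increment over subspaces of bounded codimension) places all but
  \<open>\<epsilon> n\<close> elements of a sum-free set in a sum-free union of cosets, chosen from polynomially many
  candidates. If that union has at most \<open>(1 / 3 - c) n\<close> elements, the graph bound makes the
  contribution negligible. Otherwise it is close to an affine hyperplane \<open>H = {x. \<xi> \<bullet> x = 1}\<close>: a
  Fourier coefficient shows that it almost misses \<open>ker \<xi>\<close>, and its two remaining slices have doubling
  close to 1, so they are nearly cosets of subgroups, which excludes a balanced split.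

  For \<open>F = H\<close>, the link graph of \<open>T = A - H\<close> consists of \<open>n / 9\<close> disjoint triangles if \<open>T = {s}\<close> with
  \<open>s \<in> ker \<xi> - {0}\<close>; every other \<open>T\<close> makes a positive fraction of the vertices lie outside
  triangles. There are \<open>n - 1\<close> choices of \<open>H\<close> and \<open>(n - 3) / 3\<close> choices of \<open>s\<close>. Conversely almost
  every one of the \<open>3 powr (n / 9)\<close> transversals of the triangles gives a maximal sum-free set, and
  few sets arise from two pairs \<open>(H, s)\<close>.
\<close>

section \<open>Maximal independent sets\<close>

text \<open>The main term leaves no slack: the sets \<open>T = {s}\<close> have to be counted with
  the exact bound \<open>3 powr (n / 9)\<close>, and every other contribution has to be smaller by a
  factor exponential in \<open>n\<close>, because the possible \<open>T\<close> are themselves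
  exponentially many. So the independent-set bound carries an explicit gain per vertex outside
  triangles, and parameters are chosen backwards from it: the gain dictates how small
  \<open>T\<close> must be for its choices to cost less, which fixes the stability threshold
  \<open>\<tau>\<close>, then the regularity parameter \<open>\<delta>\<close>, then the number of
  refinements. That number may lead to tower-type bounds, since it does not depend on
  \<open>k\<close>; the candidates for unions of cosets stay polynomially many. Candidates must be
  exactly sum-free, as a Schur triple inside one would be a hyperedge on three vertices instead of
  an edge. The argument runs in an abstract finite space of exponent 3 with a nondegenerate form,
  whose elements serve both as points and as frequencies; \<open>Z3_pow k\<close> enters only at the
  end.\<close>

definition mis :: "('a \<Rightarrow> 'a \<Rightarrow> bool) \<Rightarrow> 'a set \<Rightarrow> 'a set set" where
  "mis E U = {I. I \<subseteq> U \<and> (\<forall>x\<in>I. \<forall>y\<in>I. \<not> E x y) \<and> (\<forall>v\<in>U - I. \<exists>u\<in>I. E v u)}"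

definition nbrs :: "('a \<Rightarrow> 'a \<Rightarrow> bool) \<Rightarrow> 'a set \<Rightarrow> 'a \<Rightarrow> 'a set" where
  "nbrs E U v = {u \<in> U. E v u}"

text \<open>For symmetric irreflexive \<open>E\<close> this says that the graph induced on
  \<open>R\<close> is a disjoint union of triangles. The local form avoids carrying a partition of
  \<open>R\<close>.\<close>

definition triangles :: "('a \<Rightarrow> 'a \<Rightarrow> bool) \<Rightarrow> 'a set \<Rightarrow> bool" where
  "triangles E R \<longleftrightarrow> (\<forall>v\<in>R. \<exists>u w. u \<noteq> w \<and> nbrs E R v = {u, w} \<and> E u w)"

lemma finite_nbrs: "finite U \<Longrightarrow> finite (nbrs E U v)"
  by (simp add: nbrs_def)

lemma finite_mis: "finite U \<Longrightarrow> finite (mis E U)"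
  by (rule finite_subset[of _ "Pow U"]) (auto simp: mis_def)

lemma finite_mis_Collect: "finite U \<Longrightarrow> finite {I \<in> mis E U. P I}"
  by (simp add: finite_mis)

lemma mis_delete:
  assumes "I \<in> mis E U" "v \<notin> I"
  shows "I \<in> mis E (U - {v})"
  using assms by (auto simp: mis_def)

lemma mis_take:
  assumes "symp E" "I \<in> mis E U" "v \<in> I"
  shows "I - {v} \<in> mis E (U - insert v (nbrs E U v))"
proof -
  have "\<exists>x\<in>I - {v}. E u x" if "u \<in> U - I" "\<not> E v u" for u
  proof -
    obtain x where "x \<in> I" "E u x"
      using \<open>u \<in> U - I\<close> assms(2) unfolding mis_def by blast
    then show ?thesis
      using \<open>\<not> E v u\<close> sympD[OF assms(1)] by blast
  qed
  then show ?thesis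
    using assms unfolding mis_def nbrs_def by blast
qed

lemma mis_meets:
  assumes "I \<in> mis E U" "v \<in> U"
  shows "\<exists>x\<in>insert v (nbrs E U v). x \<in> I"
proof (cases "v \<in> I")
  case False
  then obtain u where "u \<in> I" "E v u"
    using assms unfolding mis_def by blast
  then show ?thesis
    using assms unfolding mis_def nbrs_def by blast
qed blast

lemma card_mis_take:
  assumes "symp E" "finite U"
  shows "card {I \<in> mis E U. v \<in> I} \<le> card (mis E (U - insert v (nbrs E U v)))"
proof (rule card_inj_on_le)
  show "inj_on (\<lambda>I. I - {v}) {I \<in> mis E U. v \<in> I}"
    by (auto simp: inj_on_def)
  show "(\<lambda>I. I - {v}) ` {I \<in> mis E U. v \<in> I} \<subseteq> mis E (U - insert v (nbrs E U v))"
    using mis_take[OF assms(1)] by auto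
qed (use assms finite_mis in auto)

text \<open>By maximality every set in \<open>mis E U\<close> contains \<open>v\<close> or one of
  its neighbours; a union bound over that member suffices, overlaps being counted
  repeatedly.\<close>

lemma card_mis_closed_nbrs:
  assumes "symp E" "finite U" "v \<in> U"
  shows "card (mis E U) \<le> (\<Sum>x\<in>insert v (nbrs E U v). card (mis E (U - insert x (nbrs E U x))))"
proof -
  have fin: "finite (insert v (nbrs E U v))"
    using assms by (simp add: finite_nbrs)
  have "mis E U \<subseteq> (\<Union>x\<in>insert v (nbrs E U v). {I \<in> mis E U. x \<in> I})"
    using mis_meets[OF _ assms(3)] by fastforce
  then have "card (mis E U) \<le> card (\<Union>x\<in>insert v (nbrs E U v). {I \<in> mis E U. x \<in> I})"
    by (intro card_mono) (use assms fin in \<open>auto intro!: finite_mis_Collect simp: finite_nbrs\<close>)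
  also have "\<dots> \<le> (\<Sum>x\<in>insert v (nbrs E U v). card {I \<in> mis E U. x \<in> I})"
    by (rule card_UN_le[OF fin])
  also have "\<dots> \<le> (\<Sum>x\<in>insert v (nbrs E U v). card (mis E (U - insert x (nbrs E U x))))"
    by (intro sum_mono card_mis_take assms)
  finally show ?thesis .
qed

lemma card_mis_branch:
  assumes "symp E" "finite U"
  shows "card (mis E U) \<le> card (mis E (U - {v})) + card (mis E (U - insert v (nbrs E U v)))"
proof -
  have "mis E U = {I \<in> mis E U. v \<notin> I} \<union> {I \<in> mis E U. v \<in> I}"
    by auto
  then have "card (mis E U) \<le> card {I \<in> mis E U. v \<notin> I} + card {I \<in> mis E U. v \<in> I}"
    using card_Un_le[of "{I \<in> mis E U. v \<notin> I}" "{I \<in> mis E U. v \<in> I}"] by simp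
  moreover have "card {I \<in> mis E U. v \<notin> I} \<le> card (mis E (U - {v}))"
    by (rule card_mono) (use assms finite_mis mis_delete in auto)
  ultimately show ?thesis
    using card_mis_take[OF assms, of v] by linarith
qed

text \<open>The third branch assumes that \<open>u\<close> is absent and \<open>w\<close> present,
  so \<open>u\<close> is deleted together with the closed neighbourhood of \<open>w\<close>. As
  \<open>u\<close> and \<open>w\<close> are not adjacent, this removes one vertex more than the
  plain bound over closed neighbourhoods would.\<close>

lemma card_mis_path:
  assumes E: "symp E" "finite U" and v: "v \<in> U" "nbrs E U v = {u, w}" and uw: "\<not> E w u" "w \<noteq> u"
  shows "card (mis E U) \<le> card (mis E (U - insert v (nbrs E U v)))
    + card (mis E (U - insert u (nbrs E U u))) + card (mis E (U - insert u (insert w (nbrs E U w))))"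
proof -
  have "mis E U \<subseteq> {I \<in> mis E U. v \<in> I} \<union> {I \<in> mis E U. u \<in> I} \<union> {I \<in> mis E (U - {u}). w \<in> I}"
  proof
    fix I assume "I \<in> mis E U"
    moreover from mis_meets[OF this v(1)] have "v \<in> I \<or> u \<in> I \<or> w \<in> I"
      by (simp add: v(2))
    ultimately show "I \<in> {I \<in> mis E U. v \<in> I} \<union> {I \<in> mis E U. u \<in> I} \<union> {I \<in> mis E (U - {u}). w \<in> I}"
      using mis_delete[of I E U u] by blast
  qed
  then have "card (mis E U) \<le> card ({I \<in> mis E U. v \<in> I} \<union> {I \<in> mis E U. u \<in> I} \<union> {I \<in> mis E (U - {u}). w \<in> I})"
    by (intro card_mono) (use E in \<open>auto intro!: finite_mis_Collect\<close>)
  also have "\<dots> \<le> card {I \<in> mis E U. v \<in> I} + card {I \<in> mis E U. u \<in> I} + card {I \<in> mis E (U - {u}). w \<in> I}"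
    by (meson add_le_mono card_Un_le le_refl order_trans)
  finally have "card (mis E U) \<le> card {I \<in> mis E U. v \<in> I} + card {I \<in> mis E U. u \<in> I} + card {I \<in> mis E (U - {u}). w \<in> I}" .
  moreover have "(U - {u}) - insert w (nbrs E (U - {u}) w) = U - insert u (insert w (nbrs E U w))"
    using uw by (auto simp: nbrs_def)
  ultimately show ?thesis
    using card_mis_take[OF E, of v] card_mis_take[OF E, of u] card_mis_take[of E "U - {u}" w] E
    by simp
qed

text \<open>Any value of \<open>mis_base\<close> between \<open>sqrt 2\<close> and \<open>root 3 3\<close> would do.\<close>

definition mis_base :: real where "mis_base = 71 / 50"
text \<open>Normalised so that the three vertices of a triangle together account for a factor of
  exactly 3.\<close>

definition mis_gain :: real where "mis_gain = root 3 3 / mis_base"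

lemma mis_base_gain: "(mis_base * mis_gain) ^ 3 = 3"
  by (simp add: mis_base_def mis_gain_def)

lemma mis_gain_gt_1: "mis_gain > 1"
proof -
  have "mis_base ^ 3 < 3"
    by (simp add: mis_base_def power3_eq_cube)
  then have "mis_base < root 3 3"
    by (metis mis_base_def real_root_less_iff real_root_power_cancel zero_le_divide_iff zero_le_numeral zero_less_numeral)
  then show ?thesis
    by (simp add: mis_gain_def mis_base_def)
qed

text \<open>The bound \<open>3 powr (card U / 3)\<close> for maximal independent sets is attained by disjoint triangles
  only; every vertex outside a largest induced union of triangles gains a factor \<open>mis_gain\<close>.\<close>

lemma card_mis_le:
  assumes "symp E" "irreflp E" "finite U"
    and "\<And>R. R \<subseteq> U \<Longrightarrow> triangles E R \<Longrightarrow> card R \<le> r"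
  shows "real (card (mis E U)) \<le> mis_base ^ card U * mis_gain ^ r"
  using assms(3,4)
proof (induction "card U" arbitrary: U r rule: less_induct)
  case less
  note fin = \<open>finite U\<close>
  let ?f = "\<lambda>U. real (card (mis E U))"
  let ?N = "\<lambda>x. insert x (nbrs E U x)"
  have pos: "mis_base > 1" "mis_gain > 1" using mis_gain_gt_1 by (auto simp: mis_base_def)
  have gr: "mis_gain ^ r > 0" using pos by simp
  have IH: "?f (U - X) \<le> mis_base ^ (card U - j) * mis_gain ^ r"
    if "X \<subseteq> U" "card X \<ge> j" "j > 0" for X j
  proof -
    have cX: "card (U - X) = card U - card X" "card X \<le> card U"
      using that fin by (auto simp: card_Diff_subset card_mono finite_subset)
    have "?f (U - X) \<le> mis_base ^ card (U - X) * mis_gain ^ r"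
      using that cX less.prems by (intro less.hyps) auto
    also have "\<dots> \<le> mis_base ^ (card U - j) * mis_gain ^ r"
      using that cX pos by (intro mult_right_mono power_increasing) auto
    finally show ?thesis .
  qed
  have nb: "?N x \<subseteq> U" "card (?N x) = Suc (card (nbrs E U x))" if "x \<in> U" for x
    using that fin \<open>irreflp E\<close> by (auto simp: nbrs_def irreflp_def)
  have eq4: "card U - 3 = Suc (card U - 4)" if "4 \<le> card U"
    using that by simp
  have pw: "mis_base ^ card U = mis_base ^ j * mis_base ^ (card U - j)" if "j \<le> card U" for j
    using that by (simp flip: power_add)
  \<comment> \<open>A vertex of degree other than two gives a branching that the powers of
    \<open>mis_base\<close> absorb with \<open>r\<close> unchanged. What remains is a 2-regular
    graph, that is, a union of cycles.\<close>
  consider "U = {}" | v where "v \<in> U" "card (nbrs E U v) = 0" | v where "v \<in> U" "card (nbrs E U v) = 1"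
    | v where "v \<in> U" "card (nbrs E U v) \<ge> 3" | "U \<noteq> {}" "\<And>v. v \<in> U \<Longrightarrow> card (nbrs E U v) = 2"
    by (metis One_nat_def Suc_1 Suc_leI less_Suc0 linorder_neqE_nat numeral_3_eq_3 not_less_eq less_2_cases_iff)
  then show ?case
  proof cases
    case 1
    then have "mis E U = {{}}" by (auto simp: mis_def)
    then show ?thesis using 1 pos by (simp add: less_imp_le)
  next
    case (2 v)
    then have n: "nbrs E U v = {}" using fin by (simp add: finite_nbrs)
    have "card (mis E U) \<le> card (mis E (U - {v}))"
      using card_mis_closed_nbrs[OF \<open>symp E\<close> fin 2(1)] n by simp
    moreover have "?f (U - {v}) \<le> mis_base ^ (card U - 1) * mis_gain ^ r"
      using IH[of "{v}" 1] 2 by simp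
    moreover have "mis_base ^ (card U - 1) * mis_gain ^ r \<le> mis_base ^ card U * mis_gain ^ r"
      using pos by (intro mult_right_mono power_increasing) auto
    ultimately show ?thesis by linarith
  next
    case (3 v)
    then obtain u where u: "nbrs E U v = {u}" by (auto simp: card_1_singleton_iff)
    then have uU: "u \<in> U" "u \<noteq> v" "v \<in> nbrs E U u"
      using \<open>irreflp E\<close> \<open>symp E\<close> 3(1) by (auto simp: nbrs_def irreflp_def dest: sympD)
    then have "card (nbrs E U u) \<ge> 1"
      using fin by (metis One_nat_def Suc_leI card_gt_0_iff empty_iff finite_nbrs)
    then have cu: "card (?N u) \<ge> 2" using nb uU by auto
    have cv: "card (?N v) \<ge> 2" using nb 3 by auto
    have "card U \<ge> 2" using cv nb(1)[OF 3(1)] fin by (meson card_mono le_trans)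
    have "card (mis E U) \<le> card (mis E (U - ?N v)) + card (mis E (U - ?N u))"
      using card_mis_closed_nbrs[OF \<open>symp E\<close> fin 3(1)] u uU by simp
    moreover have "?f (U - ?N v) \<le> mis_base ^ (card U - 2) * mis_gain ^ r"
      using IH[OF nb(1)[OF 3(1)] cv] by simp
    moreover have "?f (U - ?N u) \<le> mis_base ^ (card U - 2) * mis_gain ^ r"
      using IH[OF nb(1)[OF uU(1)] cu] by simp
    ultimately have "?f U \<le> 2 * (mis_base ^ (card U - 2) * mis_gain ^ r)" by linarith
    \<comment> \<open>Pendant vertices give the constraint \<open>2 \<le> mis_base ^ 2\<close>, the
      strictest lower bound on \<open>mis_base\<close> in this proof.\<close>
    also have "\<dots> \<le> mis_base ^ 2 * (mis_base ^ (card U - 2) * mis_gain ^ r)"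
      using pos by (intro mult_right_mono) (auto simp: mis_base_def power2_eq_square)
    finally show ?thesis using pw[OF \<open>card U \<ge> 2\<close>] by simp
  next
    case (4 v)
    have cv: "card (?N v) \<ge> 4" using nb 4 by auto
    have "card U \<ge> 4" using cv nb(1)[OF 4(1)] fin by (meson card_mono le_trans)
    have "card (mis E U) \<le> card (mis E (U - {v})) + card (mis E (U - ?N v))"
      using card_mis_branch[OF \<open>symp E\<close> fin] .
    moreover have "?f (U - ?N v) \<le> mis_base ^ (card U - 4) * mis_gain ^ r"
      using IH[OF nb(1)[OF 4(1)] cv] by simp
    moreover have "?f (U - {v}) \<le> mis_base ^ (card U - 1) * mis_gain ^ r"
      using IH[of "{v}" 1] 4 by simp
    moreover have "mis_base ^ (card U - 1) = mis_base ^ 3 * mis_base ^ (card U - 4)"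
      using \<open>card U \<ge> 4\<close> by (simp flip: power_add)
    ultimately have "?f U \<le> (mis_base ^ 3 + 1) * (mis_base ^ (card U - 4) * mis_gain ^ r)"
      by (simp add: algebra_simps)
    also have "\<dots> \<le> mis_base ^ 4 * (mis_base ^ (card U - 4) * mis_gain ^ r)"
      using pos by (intro mult_right_mono) (auto simp: mis_base_def eval_nat_numeral)
    finally show ?thesis using pw[OF \<open>card U \<ge> 4\<close>] by simp
  next
    case 5
    then obtain v where v: "v \<in> U" by blast
    obtain u w where uw: "nbrs E U v = {u, w}" "u \<noteq> w"
      using 5(2)[OF v] by (auto simp: card_2_iff)
    have mem: "u \<in> U" "w \<in> U" "u \<noteq> v" "w \<noteq> v" "E v u" "E v w" "E u v" "E w v"
      using uw \<open>irreflp E\<close> \<open>symp E\<close> by (auto simp: nbrs_def irreflp_def dest: sympD)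
    have cN: "card (?N x) = 3" if "x \<in> U" for x using nb(2)[OF that] 5(2)[OF that] by simp
    have "card U \<ge> 3" using cN[OF v] nb(1)[OF v] fin by (metis card_mono)
    have IH3: "?f (U - ?N x) \<le> mis_base ^ (card U - 3) * mis_gain ^ r" if "x \<in> U" for x
      using IH[OF nb(1)[OF that], of 3] cN[OF that] by simp
    show ?thesis
    proof (cases "E u w")
      case True
      let ?T = "{v, u, w}"
      have "E w u" using True \<open>symp E\<close> by (auto dest: sympD)
      have Nu: "nbrs E U u = {v, w}"
        using 5(2)[OF mem(1)] fin v mem True
        by (intro card_seteq[symmetric] finite_nbrs) (auto simp: nbrs_def card_insert_if)
      have Nw: "nbrs E U w = {v, u}"
        using 5(2)[OF mem(2)] fin v mem \<open>E w u\<close>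
        by (intro card_seteq[symmetric] finite_nbrs) (auto simp: nbrs_def card_insert_if)
      have N: "?N u = ?T" "?N v = ?T" "?N w = ?T" using Nu Nw uw by auto
      have "card (mis E U) \<le> 3 * card (mis E (U - ?T))"
        using card_mis_closed_nbrs[OF \<open>symp E\<close> fin v] uw mem by (simp add: Nu Nw insert_commute)
      \<comment> \<open>By 2-regularity \<open>{v, u, w}\<close> is a component, so any union of
        triangles in the rest can be enlarged by it. The rest therefore has budget
        \<open>r - 3\<close>, and the factor 3 is paid by
        \<open>(mis_base * mis_gain) ^ 3\<close>.\<close>
      have tri: "card R + 3 \<le> r" if R: "R \<subseteq> U - ?T" "triangles E R" for R
      proof -
        have fR: "finite R" using R fin finite_subset by blast
        have 1: "nbrs E (R \<union> ?T) x = nbrs E R x" if "x \<in> R" for x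
        proof -
          have "x \<in> U" "x \<notin> ?T" using that R by auto
          then have "x \<notin> nbrs E U v" "x \<notin> nbrs E U u" "x \<notin> nbrs E U w"
            unfolding uw(1) Nu Nw by blast+
          then have "\<not> E x v" "\<not> E x u" "\<not> E x w"
            using \<open>x \<in> U\<close> sympD[OF \<open>symp E\<close>] unfolding nbrs_def by blast+
          then show ?thesis by (auto simp: nbrs_def)
        qed
        have 2: "nbrs E (R \<union> ?T) v = {u, w}" "nbrs E (R \<union> ?T) u = {v, w}" "nbrs E (R \<union> ?T) w = {v, u}"
          using R uw(1) Nu Nw mem unfolding nbrs_def by blast+
        have "triangles E (R \<union> ?T)"
          unfolding triangles_def
        proof
          fix x assume "x \<in> R \<union> ?T"
          then have "x \<in> R \<or> x = v \<or> x = u \<or> x = w" by blast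
          moreover have "\<exists>a b. a \<noteq> b \<and> nbrs E (R \<union> ?T) x = {a, b} \<and> E a b" if "x \<in> R"
            using R(2) 1[OF that] that unfolding triangles_def by simp
          moreover have "\<exists>a b. a \<noteq> b \<and> nbrs E (R \<union> ?T) x = {a, b} \<and> E a b" if "x = v"
            using 2(1) that uw(2) True by (intro exI[of _ u] exI[of _ w]) simp
          moreover have "\<exists>a b. a \<noteq> b \<and> nbrs E (R \<union> ?T) x = {a, b} \<and> E a b" if "x = u"
            using 2(2) that mem by (intro exI[of _ v] exI[of _ w]) simp
          moreover have "\<exists>a b. a \<noteq> b \<and> nbrs E (R \<union> ?T) x = {a, b} \<and> E a b" if "x = w"
            using 2(3) that mem by (intro exI[of _ v] exI[of _ u]) simp
          ultimately show "\<exists>a b. a \<noteq> b \<and> nbrs E (R \<union> ?T) x = {a, b} \<and> E a b" by blast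
        qed
        then have "card (R \<union> ?T) \<le> r" using R(1) v mem(1,2) by (intro less.prems(2)) auto
        moreover have "card (R \<union> ?T) = card R + card ?T"
          using R fR by (intro card_Un_disjoint) auto
        ultimately show ?thesis using mem uw by simp
      qed
      have "r \<ge> 3" using tri[of "{}"] by (simp add: triangles_def)
      have "?f (U - ?T) \<le> mis_base ^ card (U - ?T) * mis_gain ^ (r - 3)"
        using tri fin v by (intro less.hyps) (auto intro!: psubset_card_mono simp: le_diff_conv2 \<open>r \<ge> 3\<close>)
      moreover have "card (U - ?T) = card U - 3"
        using cN[OF v] nb(1)[OF v] fin by (metis N(2) card_Diff_subset finite_subset)
      ultimately have "?f U \<le> (mis_base * mis_gain) ^ 3 * (mis_base ^ (card U - 3) * mis_gain ^ (r - 3))"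
        using \<open>card (mis E U) \<le> 3 * card (mis E (U - ?T))\<close> by (simp add: mis_base_gain)
      also have "\<dots> = (mis_base ^ 3 * mis_base ^ (card U - 3)) * (mis_gain ^ 3 * mis_gain ^ (r - 3))"
        by (simp add: power_mult_distrib)
      also have "\<dots> = mis_base ^ card U * mis_gain ^ r"
        using \<open>card U \<ge> 3\<close> \<open>r \<ge> 3\<close> by (simp flip: power_add)
      finally show ?thesis .
    next
      case False
      then have "\<not> E w u" using \<open>symp E\<close> by (auto dest: sympD)
      let ?X = "insert u (?N w)"
      have "u \<notin> ?N w" using \<open>\<not> E w u\<close> uw by (auto simp: nbrs_def)
      then have cX: "card ?X = 4" using cN[OF mem(2)] fin by (simp add: finite_nbrs)
      have XU: "?X \<subseteq> U" using nb(1)[OF mem(2)] mem by blast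
      have "card U \<ge> 4" using cX XU fin by (metis card_mono)
      have "card (mis E U) \<le> card (mis E (U - ?N v)) + card (mis E (U - ?N u)) + card (mis E (U - ?X))"
        using card_mis_path[OF \<open>symp E\<close> fin v uw(1) \<open>\<not> E w u\<close>] uw by simp
      moreover have "?f (U - ?X) \<le> mis_base ^ (card U - 4) * mis_gain ^ r"
        using IH[OF XU, of 4] cX by simp
      moreover have "mis_base ^ (card U - 3) = mis_base * mis_base ^ (card U - 4)"
        using eq4[OF \<open>card U \<ge> 4\<close>] by simp
      ultimately have "?f U \<le> (2 * mis_base + 1) * (mis_base ^ (card U - 4) * mis_gain ^ r)"
        using IH3[OF v] IH3[OF mem(1)] by (simp add: algebra_simps)
      also have "\<dots> \<le> mis_base ^ 4 * (mis_base ^ (card U - 4) * mis_gain ^ r)"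
        using pos by (intro mult_right_mono) (auto simp: mis_base_def eval_nat_numeral)
      finally show ?thesis using pw[OF \<open>card U \<ge> 4\<close>] by simp
    qed
  qed
qed

text \<open>The Moon-Moser bound: with the trivial choice \<open>r = card U\<close> each vertex
  contributes \<open>mis_base * mis_gain\<close>, the cube root of 3.\<close>

lemma card_mis_le_cube_root:
  assumes "symp E" "irreflp E" "finite U"
  shows "real (card (mis E U)) \<le> 3 powr (card U / 3)"
proof -
  have pos: "mis_base > 0" "mis_gain > 0" using mis_gain_gt_1 by (auto simp: mis_base_def)
  have "real (card (mis E U)) \<le> mis_base ^ card U * mis_gain ^ card U"
    using assms by (intro card_mis_le) (auto intro: card_mono)
  also have "\<dots> = (root 3 3) ^ card U"
    using pos by (simp add: mis_gain_def flip: power_mult_distrib)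
  also have "\<dots> = 3 powr (card U / 3)"
    by (simp add: root_powr_inverse powr_powr flip: powr_realpow)
  finally show ?thesis .
qed

section \<open>Characters and subspaces of a ternary space\<close>

lemma three_cases: "(x :: 3) = 0 \<or> x = 1 \<or> x = 2"
proof (cases x)
  case (of_int z)
  then have "z = 0 \<or> z = 1 \<or> z = 2" by auto
  then show ?thesis using of_int by auto
qed

text \<open>The nontrivial additive character of the field with three elements, in coordinates, so
  that its algebraic identities reduce to a check of finitely many cases.\<close>

definition chi :: "3 \<Rightarrow> complex" where
  "chi a = (if a = 0 then 1 else if a = 1 then Complex (- 1 / 2) (sqrt 3 / 2) else Complex (- 1 / 2) (- sqrt 3 / 2))"

lemma chi_0 [simp]: "chi 0 = 1"
  by (simp add: chi_def)

lemma chi_add: "chi (a + b) = chi a * chi b"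
  using three_cases[of a] three_cases[of b]
  by (auto simp: chi_def complex_eq_iff field_simps)

lemma chi_minus: "chi (- a) = cnj (chi a)"
  using three_cases[of a] by (auto simp: chi_def complex_eq_iff)

lemma norm_chi [simp]: "norm (chi a) = 1"
  by (auto simp: chi_def cmod_def power_divide)

lemma Re_chi: "Re (chi a) = (if a = 0 then 1 else - 1 / 2)"
  by (simp add: chi_def)

lemma chi_eq_1_iff: "chi a = 1 \<longleftrightarrow> a = 0"
  by (auto simp: chi_def complex_eq_iff)

definition sumfree :: "'a::plus set \<Rightarrow> bool" where
  "sumfree A \<longleftrightarrow> (\<forall>x\<in>A. \<forall>y\<in>A. x + y \<notin> A)"

text \<open>\<open>V\<close> is a set inside a type because \<open>k\<close> varies while the type
  stays fixed. The form identifies \<open>V\<close> with its dual, so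
  \<open>chi (dot \<xi> x)\<close> for \<open>\<xi>\<close> in \<open>V\<close> runs through all
  characters of \<open>V\<close>.\<close>

locale ternary_space =
  fixes V :: "'v::ab_group_add set" and dot :: "'v \<Rightarrow> 'v \<Rightarrow> 3" and k :: nat
  assumes finite_V: "finite V"
    and zero_V: "0 \<in> V"
    and add_V: "x \<in> V \<Longrightarrow> y \<in> V \<Longrightarrow> x + y \<in> V"
    and add_thrice: "x + x + x = (0 :: 'v)"
    and dot_add: "dot x (y + z) = dot x y + dot x z"
    and dot_sym: "dot x y = dot y x"
    and dot_nondegenerate: "x \<in> V \<Longrightarrow> x \<noteq> 0 \<Longrightarrow> \<exists>y\<in>V. dot x y \<noteq> 0"
    and card_V: "card V = 3 ^ k"
begin

lemma neg_eq: "- (x :: 'v) = x + x"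
  using add_thrice[of x] minus_unique[of x "x + x"] by (simp add: add.assoc)

lemma double_eq: "x + x = - (x :: 'v)"
  using neg_eq by simp

lemma dot_add_left: "dot (y + z) x = dot y x + dot z x"
  using dot_add dot_sym by metis

lemma dot_0 [simp]: "dot x 0 = 0" "dot 0 x = 0"
  using dot_add[of x 0 0] dot_add_left[of 0 0 x] by simp_all

lemma dot_neg: "dot x (- y) = - dot x y" "dot (- y) x = - dot y x"
  using dot_add[of x y "- y"] dot_add_left[of y "- y" x] by (simp_all add: add_eq_0_iff)

lemma dot_diff: "dot x (y - z) = dot x y - dot x z" "dot (y - z) x = dot y x - dot z x"
  using dot_add[of x y "- z"] dot_add_left[of y "- z" x] by (simp_all add: dot_neg)

lemma neg_V: "x \<in> V \<Longrightarrow> - x \<in> V"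
  by (simp add: neg_eq add_V)

lemma diff_V: "x \<in> V \<Longrightarrow> y \<in> V \<Longrightarrow> x - y \<in> V"
  using add_V[of x "- y"] neg_V by simp

text \<open>Closure under addition is enough for a linear subspace over the field with three
  elements, since \<open>- x = x + x\<close>.\<close>

definition subspace :: "'v set \<Rightarrow> bool" where
  "subspace W \<longleftrightarrow> W \<subseteq> V \<and> 0 \<in> W \<and> (\<forall>x\<in>W. \<forall>y\<in>W. x + y \<in> W)"

lemma subspace_V: "subspace V"
  by (simp add: subspace_def zero_V add_V)

lemma subspace_neg: "subspace W \<Longrightarrow> x \<in> W \<Longrightarrow> - x \<in> W"
  by (simp add: neg_eq subspace_def)

lemma subspace_add: "subspace W \<Longrightarrow> x \<in> W \<Longrightarrow> y \<in> W \<Longrightarrow> x + y \<in> W"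
  by (simp add: subspace_def)

lemma subspace_diff: "subspace W \<Longrightarrow> x \<in> W \<Longrightarrow> y \<in> W \<Longrightarrow> x - y \<in> W"
  using subspace_add[of W x "- y"] subspace_neg by simp

lemma subspace_subset: "subspace W \<Longrightarrow> W \<subseteq> V"
  by (simp add: subspace_def)

lemma finite_subspace: "subspace W \<Longrightarrow> finite W"
  using subspace_subset finite_V finite_subset by blast

lemma card_subspace_pos: "subspace W \<Longrightarrow> card W > 0"
  using finite_subspace by (auto simp: card_gt_0_iff subspace_def)

lemma sum_chi_subspace:
  assumes "subspace W"
  shows "(\<Sum>w\<in>W. chi (dot \<xi> w)) = (if \<forall>w\<in>W. dot \<xi> w = 0 then of_nat (card W) else 0)"
proof (cases "\<forall>w\<in>W. dot \<xi> w = 0")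
  case False
  then obtain u where u: "u \<in> W" "dot \<xi> u \<noteq> 0" by blast
  have "(\<Sum>w\<in>W. chi (dot \<xi> w)) = (\<Sum>w\<in>W. chi (dot \<xi> (u + w)))"
    by (rule sum.reindex_bij_witness[of _ "\<lambda>w. u + w" "\<lambda>w. w - u"])
       (use u subspace_add[OF assms] subspace_diff[OF assms] in auto)
  also have "\<dots> = chi (dot \<xi> u) * (\<Sum>w\<in>W. chi (dot \<xi> w))"
    by (simp add: dot_add chi_add sum_distrib_left)
  finally show ?thesis
    using u False by (auto simp: chi_eq_1_iff)
qed auto

lemma sum_chi_V:
  assumes "u \<in> V"
  shows "(\<Sum>\<xi>\<in>V. chi (dot \<xi> u)) = (if u = 0 then of_nat (card V) else 0)"
proof -
  have "(\<forall>w\<in>V. dot u w = 0) \<longleftrightarrow> u = 0"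
    using dot_nondegenerate[OF assms] dot_0(2) by metis
  then show ?thesis
    using sum_chi_subspace[OF subspace_V, of u] by (simp add: dot_sym[of _ u])
qed

definition hat :: "'v set \<Rightarrow> 'v \<Rightarrow> complex" where
  "hat A \<xi> = (\<Sum>x\<in>A. chi (dot \<xi> x))"

lemma parseval:
  assumes "A \<subseteq> V"
  shows "(\<Sum>\<xi>\<in>V. (norm (hat A \<xi>))\<^sup>2) = card V * card A"
proof -
  have fin: "finite A" using assms finite_V finite_subset by blast
  have "complex_of_real ((norm (hat A \<xi>))\<^sup>2) = (\<Sum>x\<in>A. \<Sum>y\<in>A. chi (dot \<xi> (x - y)))" for \<xi>
  proof -
    have "complex_of_real ((norm (hat A \<xi>))\<^sup>2) = hat A \<xi> * cnj (hat A \<xi>)"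
      by (metis complex_norm_square)
    also have "\<dots> = (\<Sum>x\<in>A. \<Sum>y\<in>A. chi (dot \<xi> x) * cnj (chi (dot \<xi> y)))"
      by (simp add: hat_def sum_product)
    also have "\<dots> = (\<Sum>x\<in>A. \<Sum>y\<in>A. chi (dot \<xi> (x - y)))"
      by (simp add: dot_diff flip: chi_minus chi_add)
    finally show ?thesis .
  qed
  then have "complex_of_real (\<Sum>\<xi>\<in>V. (norm (hat A \<xi>))\<^sup>2) = (\<Sum>\<xi>\<in>V. \<Sum>x\<in>A. \<Sum>y\<in>A. chi (dot \<xi> (x - y)))"
    by simp
  also have "\<dots> = (\<Sum>x\<in>A. \<Sum>\<xi>\<in>V. \<Sum>y\<in>A. chi (dot \<xi> (x - y)))"
    by (rule sum.swap)
  also have "\<dots> = (\<Sum>x\<in>A. \<Sum>y\<in>A. \<Sum>\<xi>\<in>V. chi (dot \<xi> (x - y)))"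
    by (intro sum.cong refl sum.swap)
  also have "\<dots> = (\<Sum>x\<in>A. \<Sum>y\<in>A. if x = y then of_nat (card V) else 0)"
    using assms diff_V by (intro sum.cong refl, subst sum_chi_V) auto
  also have "\<dots> = complex_of_real (card V * card A)"
    using fin by simp
  finally show ?thesis
    using of_real_eq_iff by blast
qed

text \<open>Orthogonality of characters turns the sum into \<open>card V\<close> times the number of
  solutions of \<open>x + y = z\<close> in \<open>A\<close>, \<open>B\<close>, \<open>C\<close>, and
  there are none.\<close>

lemma sum_hat_triple:
  assumes "A \<subseteq> V" "B \<subseteq> V" "C \<subseteq> V" "\<And>x y. x \<in> A \<Longrightarrow> y \<in> B \<Longrightarrow> x + y \<notin> C"
  shows "(\<Sum>\<xi>\<in>V. hat A \<xi> * hat B \<xi> * cnj (hat C \<xi>)) = 0"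
proof -
  have "(\<Sum>\<xi>\<in>V. hat A \<xi> * hat B \<xi> * cnj (hat C \<xi>)) = (\<Sum>\<xi>\<in>V. \<Sum>x\<in>A. \<Sum>y\<in>B. \<Sum>z\<in>C. chi (dot \<xi> (x + y - z)))"
  proof (rule sum.cong[OF refl])
    fix \<xi>
    have "hat A \<xi> * hat B \<xi> * cnj (hat C \<xi>)
      = (\<Sum>x\<in>A. \<Sum>y\<in>B. chi (dot \<xi> x) * chi (dot \<xi> y) * cnj (hat C \<xi>))"
      unfolding hat_def[of A] hat_def[of B] sum_product by (simp only: sum_distrib_right)
    also have "\<dots> = (\<Sum>x\<in>A. \<Sum>y\<in>B. \<Sum>z\<in>C. chi (dot \<xi> x) * chi (dot \<xi> y) * cnj (chi (dot \<xi> z)))"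
      by (simp add: hat_def sum_distrib_left)
    also have "\<dots> = (\<Sum>x\<in>A. \<Sum>y\<in>B. \<Sum>z\<in>C. chi (dot \<xi> (x + y - z)))"
      by (simp add: dot_diff dot_add flip: chi_minus chi_add)
    finally show "hat A \<xi> * hat B \<xi> * cnj (hat C \<xi>) = (\<Sum>x\<in>A. \<Sum>y\<in>B. \<Sum>z\<in>C. chi (dot \<xi> (x + y - z)))" .
  qed
  also have "\<dots> = (\<Sum>x\<in>A. \<Sum>\<xi>\<in>V. \<Sum>y\<in>B. \<Sum>z\<in>C. chi (dot \<xi> (x + y - z)))"
    by (rule sum.swap)
  also have "\<dots> = (\<Sum>x\<in>A. \<Sum>y\<in>B. \<Sum>\<xi>\<in>V. \<Sum>z\<in>C. chi (dot \<xi> (x + y - z)))"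
    by (intro sum.cong refl sum.swap)
  also have "\<dots> = (\<Sum>x\<in>A. \<Sum>y\<in>B. \<Sum>z\<in>C. \<Sum>\<xi>\<in>V. chi (dot \<xi> (x + y - z)))"
    by (intro sum.cong refl sum.swap)
  also have "\<dots> = 0"
  proof -
    have "(\<Sum>\<xi>\<in>V. chi (dot \<xi> (x + y - z))) = 0" if "x \<in> A" "y \<in> B" "z \<in> C" for x y z
    proof -
      have "x + y \<noteq> z" using that assms(4) by blast
      then show ?thesis
        using that assms by (subst sum_chi_V) (auto intro!: diff_V add_V)
    qed
    then show ?thesis by simp
  qed
  finally show ?thesis .
qed

section \<open>Annihilators and cosets\<close>

definition ann :: "'v set \<Rightarrow> 'v set" where
  "ann X = {y \<in> V. \<forall>x\<in>X. dot x y = 0}"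

lemma subspace_ann: "subspace (ann X)"
  by (auto simp: subspace_def ann_def zero_V add_V dot_add)

text \<open>Double counting of the sum of \<open>chi (dot \<xi> w)\<close> over \<open>W\<close> and
  \<open>V\<close>: summing over \<open>\<xi>\<close> first leaves only \<open>w = 0\<close>,
  summing over \<open>w\<close> first leaves only \<open>\<xi>\<close> in
  \<open>ann W\<close>.\<close>

lemma card_ann:
  assumes "subspace W"
  shows "card W * card (ann W) = card V"
proof -
  have "(\<Sum>w\<in>W. \<Sum>\<xi>\<in>V. chi (dot \<xi> w)) = (\<Sum>w\<in>W. if w = 0 then of_nat (card V) else 0)"
    using subspace_subset[OF assms] by (intro sum.cong refl sum_chi_V) auto
  also have "\<dots> = of_nat (card V)"
    using assms finite_subspace[OF assms] by (simp add: subspace_def)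
  also have "(\<Sum>w\<in>W. \<Sum>\<xi>\<in>V. chi (dot \<xi> w)) = (\<Sum>\<xi>\<in>V. \<Sum>w\<in>W. chi (dot \<xi> w))"
    by (rule sum.swap)
  also have "\<dots> = (\<Sum>\<xi>\<in>V. if \<xi> \<in> ann W then of_nat (card W) else 0)"
    by (intro sum.cong refl) (auto simp: sum_chi_subspace[OF assms] ann_def dot_sym)
  also have "\<dots> = of_nat (card W * card (ann W))"
    using finite_V by (simp add: sum.If_cases ann_def Int_def conj_ac)
  finally show ?thesis
    by (metis of_nat_eq_iff)
qed

definition coset :: "'v set \<Rightarrow> 'v \<Rightarrow> 'v set" where
  "coset W x = (\<lambda>w. x + w) ` W"

lemma mem_coset: "y \<in> coset W x \<longleftrightarrow> y - x \<in> W"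
  unfolding coset_def by (auto simp: image_iff intro: bexI[of _ "y - x"])

lemma card_coset [simp]: "card (coset W x) = card W"
  unfolding coset_def by (rule card_image) simp

lemma coset_subset: "subspace W \<Longrightarrow> x \<in> V \<Longrightarrow> coset W x \<subseteq> V"
  using subspace_subset add_V by (fastforce simp: coset_def)

lemma mem_coset_sym:
  assumes "subspace W" "y \<in> coset W x"
  shows "x \<in> coset W y"
  using subspace_neg[OF assms(1), of "y - x"] assms(2) by (simp add: mem_coset)

lemma coset_eq:
  assumes "subspace W" "y \<in> coset W x"
  shows "coset W y = coset W x"
proof -
  have "y - x \<in> W" using assms by (simp add: mem_coset)
  then have "z - y \<in> W \<longleftrightarrow> z - x \<in> W" for z
    using subspace_add[OF assms(1), of "z - y" "y - x"] subspace_diff[OF assms(1), of "z - x" "y - x"]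
    by auto
  then show ?thesis by (auto simp: mem_coset)
qed

lemma self_mem_coset: "subspace W \<Longrightarrow> x \<in> coset W x"
  by (simp add: mem_coset subspace_def)

text \<open>Quantities attached to cosets are summed over points throughout, so that no coset
  representatives are needed. In such a sum each \<open>f y\<close> occurs once for every
  \<open>x\<close> in the coset of \<open>y\<close>, which explains the factor
  \<open>card W\<close>.\<close>

lemma sum_sum_coset:
  assumes "subspace W" "X \<subseteq> V" "\<And>x y. x \<in> X \<Longrightarrow> y \<in> coset W x \<Longrightarrow> y \<in> X"
  shows "(\<Sum>x\<in>X. \<Sum>y\<in>coset W x. f y) = of_nat (card W) * (\<Sum>x\<in>X. f x :: 'b::comm_semiring_1)"
proof -
  have X: "x + w \<in> X \<longleftrightarrow> x \<in> X" if "w \<in> W" for x w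
  proof -
    have "x + w \<in> coset W x" using that by (simp add: mem_coset)
    then show ?thesis
      using assms(3)[of x "x + w"] assms(3)[of "x + w" x] mem_coset_sym[OF assms(1)] by blast
  qed
  have "(\<Sum>x\<in>X. \<Sum>y\<in>coset W x. f y) = (\<Sum>x\<in>X. \<Sum>w\<in>W. f (x + w))"
    by (simp add: coset_def sum.reindex)
  also have "\<dots> = (\<Sum>w\<in>W. \<Sum>x\<in>X. f (x + w))"
    by (rule sum.swap)
  also have "\<dots> = (\<Sum>w\<in>W. \<Sum>x\<in>X. f x)"
  proof (rule sum.cong[OF refl])
    fix w assume w: "w \<in> W"
    then have w': "- w \<in> W" using subspace_neg[OF assms(1)] by blast
    show "(\<Sum>x\<in>X. f (x + w)) = (\<Sum>x\<in>X. f x)"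
      by (rule sum.reindex_bij_witness[of _ "\<lambda>x. x - w" "\<lambda>x. x + w"])
         (use X[OF w] X[OF w'] in auto)
  qed
  finally show ?thesis by simp
qed

lemma hat_coset_trivial:
  assumes "\<xi> \<in> ann W" "A \<subseteq> coset W x" "W \<subseteq> V"
  shows "hat A \<xi> = chi (dot \<xi> x) * of_nat (card A)"
proof -
  have "dot \<xi> y = dot \<xi> x" if "y \<in> A" for y
  proof -
    have "y - x \<in> W" using that assms by (auto simp: mem_coset)
    then have "dot (y - x) \<xi> = 0" using assms by (auto simp: ann_def)
    then show ?thesis by (simp add: dot_diff dot_sym)
  qed
  then have "hat A \<xi> = (\<Sum>y\<in>A. chi (dot \<xi> x))"
    unfolding hat_def by (intro sum.cong) auto
  then show ?thesis by (simp add: mult.commute)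
qed

end

section \<open>Regularity\<close>

text \<open>Bessel's inequality for the orthogonal functions 1 and \<open>e\<close>. Subtracting the
  mean of \<open>h\<close> does not change its coefficient at \<open>e\<close>, and Cauchy-Schwarz
  then bounds that coefficient by the variance.\<close>

lemma bessel_two_characters:
  fixes h :: "'a \<Rightarrow> real" and e :: "'a \<Rightarrow> complex"
  assumes "finite C" "C \<noteq> {}" "(\<Sum>y\<in>C. e y) = 0" "\<And>y. y \<in> C \<Longrightarrow> norm (e y) = 1"
  shows "(\<Sum>y\<in>C. h y)\<^sup>2 + (norm (\<Sum>y\<in>C. of_real (h y) * e y))\<^sup>2 \<le> card C * (\<Sum>y\<in>C. (h y)\<^sup>2)"
proof -
  define m where "m = (\<Sum>y\<in>C. h y) / card C"
  have c: "real (card C) > 0" using assms by (simp add: card_gt_0_iff)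
  have "(\<Sum>y\<in>C. of_real (h y) * e y) = (\<Sum>y\<in>C. of_real (h y - m) * e y)"
    using assms(3) by (simp add: algebra_simps sum_subtractf flip: sum_distrib_left)
  also have "norm \<dots> \<le> (\<Sum>y\<in>C. 1 * \<bar>h y - m\<bar>)"
    by (rule sum_norm_le) (simp add: norm_mult assms(4) flip: of_real_diff)
  finally have "(norm (\<Sum>y\<in>C. of_real (h y) * e y))\<^sup>2 \<le> (\<Sum>y\<in>C. 1 * \<bar>h y - m\<bar>)\<^sup>2"
    by (intro power_mono) auto
  also have "\<dots> \<le> (\<Sum>y\<in>C. 1\<^sup>2) * (\<Sum>y\<in>C. \<bar>h y - m\<bar>\<^sup>2)"
    by (rule Cauchy_Schwarz_ineq_sum)
  also have "(\<Sum>y\<in>C. \<bar>h y - m\<bar>\<^sup>2) = (\<Sum>y\<in>C. (h y)\<^sup>2) + card C * m\<^sup>2 - 2 * m * (\<Sum>y\<in>C. h y)"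
    by (simp add: power2_diff sum.distrib sum_subtractf mult_ac flip: sum_distrib_left sum_distrib_right)
  also have "(\<Sum>y\<in>C. 1\<^sup>2) * ((\<Sum>y\<in>C. (h y)\<^sup>2) + card C * m\<^sup>2 - 2 * m * (\<Sum>y\<in>C. h y))
      = card C * ((\<Sum>y\<in>C. (h y)\<^sup>2) + card C * m\<^sup>2 - 2 * m * (\<Sum>y\<in>C. h y))"
    by simp
  also have "\<dots> = card C * (\<Sum>y\<in>C. (h y)\<^sup>2) - (\<Sum>y\<in>C. h y)\<^sup>2"
    using c by (simp add: m_def power2_eq_square field_simps)
  finally show ?thesis by simp
qed

text \<open>Bounds the number of frequencies after \<open>j\<close> refinements: a refinement adds
  at most one frequency per coset, and \<open>d\<close> frequencies cut \<open>V\<close> into at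
  most \<open>3 ^ d\<close> cosets.\<close>

fun tower :: "nat \<Rightarrow> nat" where
  "tower 0 = 0"
| "tower (Suc j) = tower j + 3 ^ tower j"

context ternary_space
begin

section \<open>Density, energy and bias relative to a subspace\<close>

definition dens :: "'v set \<Rightarrow> 'v set \<Rightarrow> 'v \<Rightarrow> real" where
  "dens A W x = card (A \<inter> coset W x) / card W"

definition energy :: "'v set \<Rightarrow> 'v set \<Rightarrow> real" where
  "energy A W = (\<Sum>x\<in>V. (dens A W x)\<^sup>2)"

text \<open>Only frequencies outside \<open>ann W\<close> count, namely those that are not constant
  on the cosets of \<open>W\<close>. The threshold is relative to the part of \<open>A\<close> in
  the coset, not to the size of the coset.\<close>

definition biased :: "real \<Rightarrow> 'v set \<Rightarrow> 'v set \<Rightarrow> 'v \<Rightarrow> bool" where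
  "biased \<delta> A W x \<longleftrightarrow> (\<exists>\<xi>\<in>V - ann W. norm (hat (A \<inter> coset W x) \<xi>) \<ge> \<delta> * card (A \<inter> coset W x))"

lemma card_V_pos: "card V > 0"
  using finite_V zero_V by (auto simp: card_gt_0_iff)

lemma finite_coset: "subspace W \<Longrightarrow> finite (coset W x)"
  by (simp add: coset_def finite_subspace)

lemma dens_nonneg: "dens A W x \<ge> 0"
  by (simp add: dens_def)

lemma dens_le_1:
  assumes "subspace W"
  shows "dens A W x \<le> 1"
proof -
  have "card (A \<inter> coset W x) \<le> card W"
    using card_mono[of "coset W x" "A \<inter> coset W x"] assms finite_coset by simp
  then show ?thesis
    using card_subspace_pos[OF assms] by (simp add: dens_def)
qed

lemma energy_le: "subspace W \<Longrightarrow> energy A W \<le> card V"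
proof -
  assume "subspace W"
  then have "energy A W \<le> (\<Sum>x\<in>V. 1)"
    unfolding energy_def by (intro sum_mono) (simp add: dens_le_1 dens_nonneg power_le_one)
  then show ?thesis by simp
qed

lemma dens_cong:
  assumes "subspace W" "y \<in> coset W x"
  shows "dens A W y = dens A W x"
  by (simp add: dens_def coset_eq[OF assms])

lemma biased_cong:
  fixes \<delta> :: real
  assumes "subspace W" "y \<in> coset W x"
  shows "biased \<delta> A W y = biased \<delta> A W x"
  by (simp add: biased_def coset_eq[OF assms])

lemma sum_norm_hat_mult_sq_le:
  assumes "A \<subseteq> V" "B \<subseteq> V"
  shows "(\<Sum>\<xi>\<in>V. norm (hat A \<xi>) * norm (hat B \<xi>))\<^sup>2 \<le> (card V)\<^sup>2 * (card A * card B)"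
proof -
  have "(\<Sum>\<xi>\<in>V. norm (hat A \<xi>) * norm (hat B \<xi>))\<^sup>2
      \<le> (\<Sum>\<xi>\<in>V. (norm (hat A \<xi>))\<^sup>2) * (\<Sum>\<xi>\<in>V. (norm (hat B \<xi>))\<^sup>2)"
    by (rule Cauchy_Schwarz_ineq_sum)
  then show ?thesis
    using assms by (simp add: parseval) (simp add: power2_eq_square mult_ac)
qed

text \<open>Of the frequencies in \<open>ann W\<close> each contributes \<open>|X| |Y| |Z|\<close> to the count of Schur triples
  \<open>x + y = z\<close> in \<open>X \<times> Y \<times> Z\<close>, so a vanishing count needs a large coefficient elsewhere.\<close>

lemma biased_if_schur_triple:
  fixes \<delta> :: real
  assumes A: "A \<subseteq> V" "sumfree A" and W: "subspace W" and xy: "x \<in> V" "y \<in> V"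
    and \<delta>: "\<delta> > 0" "dens A W x > \<delta>" "dens A W y > \<delta>" "dens A W (x + y) > \<delta>"
  shows "biased \<delta> A W x"
proof (rule ccontr)
  assume nb: "\<not> biased \<delta> A W x"
  define X where "X = A \<inter> coset W x"
  define Y where "Y = A \<inter> coset W y"
  define Z where "Z = A \<inter> coset W (x + y)"
  define n N w a b c where "n = real (card V)" "N = real (card (ann W))" "w = real (card W)"
    "a = real (card X)" "b = real (card Y)" "c = real (card Z)"
  note defs = this
  have XV: "X \<subseteq> V" "Y \<subseteq> V" "Z \<subseteq> V" using A by (auto simp: X_def Y_def Z_def)
  have wpos: "w > 0" using card_subspace_pos[OF W] by (simp add: defs)
  have wN: "w * N = n" using card_ann[OF W] by (simp add: defs flip: of_nat_mult)
  have "n > 0" using card_V_pos by (simp add: defs)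
  have "N > 0" using \<open>n > 0\<close> wN wpos zero_less_mult_pos[of w N] by simp
  have abc: "a > \<delta> * w" "b > \<delta> * w" "c > \<delta> * w"
    using \<delta> wpos by (simp_all add: dens_def defs X_def Y_def Z_def pos_less_divide_eq)
  have dw: "\<delta> * w > 0" using \<delta>(1) wpos by simp
  have small: "norm (hat X \<xi>) \<le> \<delta> * a" if "\<xi> \<in> V - ann W" for \<xi>
    using nb that unfolding biased_def by (auto simp: X_def defs not_le less_imp_le)
  have triv: "hat X \<xi> * hat Y \<xi> * cnj (hat Z \<xi>) = of_real (a * b * c)" if "\<xi> \<in> ann W" for \<xi>
  proof -
    have "hat X \<xi> = chi (dot \<xi> x) * of_nat (card X)" "hat Y \<xi> = chi (dot \<xi> y) * of_nat (card Y)"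
      "hat Z \<xi> = chi (dot \<xi> (x + y)) * of_nat (card Z)"
      using that subspace_subset[OF W] by (auto simp: X_def Y_def Z_def intro!: hat_coset_trivial)
    moreover have "chi (dot \<xi> x) * chi (dot \<xi> y) * cnj (chi (dot \<xi> (x + y))) = 1"
      by (simp add: dot_add flip: chi_minus chi_add)
    ultimately show ?thesis
      by (simp add: defs mult_ac)
  qed
  have "ann W \<subseteq> V" by (auto simp: ann_def)
  have "(\<Sum>\<xi>\<in>V. hat X \<xi> * hat Y \<xi> * cnj (hat Z \<xi>)) = 0"
    using A XV by (intro sum_hat_triple) (auto simp: sumfree_def X_def Y_def Z_def)
  then have "(\<Sum>\<xi>\<in>V - ann W. hat X \<xi> * hat Y \<xi> * cnj (hat Z \<xi>)) + of_real (N * (a * b * c)) = 0"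
    using sum.subset_diff[OF \<open>ann W \<subseteq> V\<close> finite_V, of "\<lambda>\<xi>. hat X \<xi> * hat Y \<xi> * cnj (hat Z \<xi>)"] triv
    by (simp add: defs)
  then have "N * (a * b * c) = norm (\<Sum>\<xi>\<in>V - ann W. hat X \<xi> * hat Y \<xi> * cnj (hat Z \<xi>))"
  proof -
    assume "(\<Sum>\<xi>\<in>V - ann W. hat X \<xi> * hat Y \<xi> * cnj (hat Z \<xi>)) + of_real (N * (a * b * c)) = 0"
    then have "(\<Sum>\<xi>\<in>V - ann W. hat X \<xi> * hat Y \<xi> * cnj (hat Z \<xi>)) = of_real (- (N * (a * b * c)))" by (simp add: add_eq_0_iff2)
    then have "norm (\<Sum>\<xi>\<in>V - ann W. hat X \<xi> * hat Y \<xi> * cnj (hat Z \<xi>)) = \<bar>- (N * (a * b * c))\<bar>" by (simp only: norm_of_real)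
    then show ?thesis using \<open>N > 0\<close> abc dw by simp
  qed
  also have "\<dots> \<le> (\<Sum>\<xi>\<in>V - ann W. \<delta> * a * (norm (hat Y \<xi>) * norm (hat Z \<xi>)))"
  proof (rule sum_norm_le)
    fix \<xi> assume "\<xi> \<in> V - ann W"
    from mult_right_mono[OF small[OF this], of "norm (hat Y \<xi>) * norm (hat Z \<xi>)"]
    show "norm (hat X \<xi> * hat Y \<xi> * cnj (hat Z \<xi>)) \<le> \<delta> * a * (norm (hat Y \<xi>) * norm (hat Z \<xi>))"
      by (simp add: norm_mult mult.assoc)
  qed
  also have "\<dots> \<le> (\<Sum>\<xi>\<in>V. \<delta> * a * (norm (hat Y \<xi>) * norm (hat Z \<xi>)))"
    using finite_V \<delta>(1) by (intro sum_mono2) (auto simp: defs)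
  also have "\<dots> = \<delta> * a * (\<Sum>\<xi>\<in>V. norm (hat Y \<xi>) * norm (hat Z \<xi>))"
    by (simp add: sum_distrib_left)
  finally have "N * (b * c) \<le> \<delta> * (\<Sum>\<xi>\<in>V. norm (hat Y \<xi>) * norm (hat Z \<xi>))"
    using abc dw by (simp add: mult.assoc mult.left_commute[of _ a] mult_le_cancel_left)
  \<comment> \<open>Squared to avoid roots: the bounds amount to
    \<open>N * sqrt (b * c) \<le> \<delta> * n\<close>, and
    \<open>\<delta> * n = \<delta> * w * N\<close> contradicts that \<open>b\<close> and
    \<open>c\<close> both exceed \<open>\<delta> * w\<close>.\<close>
  then have "(N * (b * c))\<^sup>2 \<le> \<delta>\<^sup>2 * (\<Sum>\<xi>\<in>V. norm (hat Y \<xi>) * norm (hat Z \<xi>))\<^sup>2"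
    unfolding power_mult_distrib[of \<delta>, symmetric]
    using \<open>N > 0\<close> abc dw by (intro power_mono) (auto intro!: mult_nonneg_nonneg)
  also have "\<dots> \<le> \<delta>\<^sup>2 * (n\<^sup>2 * (b * c))"
    using sum_norm_hat_mult_sq_le[OF XV(2,3)] by (intro mult_left_mono) (auto simp: defs)
  finally have "(N\<^sup>2 * (b * c)) * (b * c) \<le> (\<delta>\<^sup>2 * n\<^sup>2) * (b * c)"
    by (simp add: power2_eq_square mult_ac)
  moreover have "b * c > (\<delta> * w) * (\<delta> * w)"
    using abc dw by (intro mult_strict_mono) auto
  ultimately have "N\<^sup>2 * (b * c) \<le> \<delta>\<^sup>2 * n\<^sup>2"
    using less_trans[OF mult_pos_pos[OF dw dw]] by (metis mult_right_le_imp_le)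
  also have "\<dots> = N\<^sup>2 * ((\<delta> * w) * (\<delta> * w))"
    by (simp add: power2_eq_square mult_ac flip: wN)
  finally show False
    using \<open>b * c > _\<close> \<open>N > 0\<close> by (simp add: mult_le_cancel_left)
qed

definition core :: "real \<Rightarrow> 'v set \<Rightarrow> 'v set \<Rightarrow> 'v set" where
  "core \<delta> A W = {x \<in> V. dens A W x > \<delta> \<and> \<not> biased \<delta> A W x}"

definition irregular :: "real \<Rightarrow> 'v set \<Rightarrow> 'v set \<Rightarrow> 'v set" where
  "irregular \<delta> A W = {x \<in> V. dens A W x > \<delta> \<and> biased \<delta> A W x}"

lemma sumfree_core:
  fixes \<delta> :: real
  assumes "A \<subseteq> V" "sumfree A" "subspace W" "\<delta> > 0"
  shows "sumfree (core \<delta> A W)"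
  using biased_if_schur_triple[OF assms(1-3) _ _ assms(4)] by (auto simp: sumfree_def core_def)

text \<open>A point of \<open>A\<close> outside the core lies in a coset of density at most
  \<open>\<delta>\<close> or in an irregular one. Summing the density over the points of sparse
  cosets recovers the number of elements of \<open>A\<close> there, so they number at most
  \<open>\<delta> * card V\<close>.\<close>

lemma card_diff_core:
  fixes \<delta> :: real
  assumes A: "A \<subseteq> V" and W: "subspace W" and \<delta>: "\<delta> > 0"
  shows "card (A - core \<delta> A W) \<le> \<delta> * card V + card (irregular \<delta> A W)"
proof -
  define S where "S = {x \<in> V. dens A W x \<le> \<delta>}"
  have finS: "finite S" using finite_V by (simp add: S_def)
  have "(\<Sum>x\<in>S. \<Sum>y\<in>coset W x. (if y \<in> A then 1 else 0 :: real)) = of_nat (card W) * (\<Sum>x\<in>S. if x \<in> A then 1 else 0)"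
    using coset_subset[OF W] dens_cong[OF W, of _ _ A] by (intro sum_sum_coset[OF W]) (auto simp: S_def)
  moreover have "(\<Sum>y\<in>coset W x. (if y \<in> A then 1 else 0 :: real)) = card W * dens A W x" for x
    using card_subspace_pos[OF W] finite_coset[OF W]
    by (simp add: sum.If_cases dens_def Int_commute)
  ultimately have "card W * (\<Sum>x\<in>S. dens A W x) = card W * real (card (A \<inter> S))"
    using finS by (simp add: sum.If_cases sum_distrib_left Int_commute)
  then have "card (A \<inter> S) = (\<Sum>x\<in>S. dens A W x)"
    using card_subspace_pos[OF W] by simp
  also have "\<dots> \<le> real (card S) * \<delta>" by (rule sum_bounded_above) (simp add: S_def)
  also have "\<dots> \<le> \<delta> * card V"
    using \<delta> finite_V by (simp add: mult.commute[of \<delta>] mult_right_mono card_mono S_def)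
  finally have 1: "card (A \<inter> S) \<le> \<delta> * card V" .
  have "A - core \<delta> A W \<subseteq> (A \<inter> S) \<union> irregular \<delta> A W"
    using A by (auto simp: S_def core_def irregular_def)
  then have "card (A - core \<delta> A W) \<le> card ((A \<inter> S) \<union> irregular \<delta> A W)"
    using finS finite_V by (intro card_mono) (auto simp: irregular_def)
  also have "\<dots> \<le> card (A \<inter> S) + card (irregular \<delta> A W)"
    by (rule card_Un_le)
  finally show ?thesis using 1 by linarith
qed

text \<open>A frequency in \<open>ann W'\<close> is constant on cosets of \<open>W'\<close>, so it
  does not distinguish the indicator of \<open>A\<close> from its averages over these cosets. The
  frequency 0 gives the plain count.\<close>

lemma sum_dens_coset:
  assumes W: "subspace W" "subspace W'" "W' \<subseteq> W" and x: "x \<in> V" and \<xi>: "\<xi> \<in> ann W'"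
  shows "(\<Sum>y\<in>coset W x. of_real (dens A W' y) * chi (dot \<xi> y)) = hat (A \<inter> coset W x) \<xi>"
proof -
  have fin: "finite (coset W x)" "finite (coset W' y)" for y
    using W finite_coset by auto
  have sub: "coset W' y \<subseteq> coset W x" if "y \<in> coset W x" for y
    using coset_eq[OF W(1) that] W(3) unfolding coset_def by blast
  have inner: "(\<Sum>z\<in>coset W' y. if z \<in> A then chi (dot \<xi> z) else 0) = of_nat (card W') * (of_real (dens A W' y) * chi (dot \<xi> y))" for y
  proof -
    have "(\<Sum>z\<in>coset W' y. if z \<in> A then chi (dot \<xi> z) else 0) = hat (A \<inter> coset W' y) \<xi>"
      using fin by (simp add: sum.If_cases hat_def Int_commute)
    also have "\<dots> = chi (dot \<xi> y) * of_nat (card (A \<inter> coset W' y))"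
      using \<xi> subspace_subset[OF W(2)] by (intro hat_coset_trivial) auto
    finally show ?thesis
      using card_subspace_pos[OF W(2)] by (simp add: dens_def mult_ac)
  qed
  have "of_nat (card W') * (\<Sum>y\<in>coset W x. of_real (dens A W' y) * chi (dot \<xi> y))
      = (\<Sum>y\<in>coset W x. \<Sum>z\<in>coset W' y. if z \<in> A then chi (dot \<xi> z) else 0)"
    by (simp add: inner sum_distrib_left)
  also have "\<dots> = of_nat (card W') * (\<Sum>y\<in>coset W x. if y \<in> A then chi (dot \<xi> y) else 0)"
    using sub coset_subset[OF W(1) x] by (intro sum_sum_coset[OF W(2)]) auto
  also have "(\<Sum>y\<in>coset W x. if y \<in> A then chi (dot \<xi> y) else 0) = hat (A \<inter> coset W x) \<xi>"
    using fin by (simp add: sum.If_cases hat_def Int_commute)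
  finally show ?thesis
    using card_subspace_pos[OF W(2)] by simp
qed

lemma sum_dens_sq_coset:
  assumes W: "subspace W" "subspace W'" "W' \<subseteq> W" and x: "x \<in> V"
    and \<xi>: "\<xi> \<in> ann W'" "\<xi> \<in> V - ann W"
  shows "(dens A W x)\<^sup>2 * card W + (norm (hat (A \<inter> coset W x) \<xi>))\<^sup>2 / card W \<le> (\<Sum>y\<in>coset W x. (dens A W' y)\<^sup>2)"
proof -
  have c: "real (card W) > 0" using card_subspace_pos[OF W(1)] by simp
  have "0 \<in> ann W'" by (simp add: ann_def zero_V)
  from sum_dens_coset[OF W x this, of A]
  have "of_real (\<Sum>y\<in>coset W x. dens A W' y) = complex_of_real (card (A \<inter> coset W x))"
    by (simp add: hat_def)
  then have s: "(\<Sum>y\<in>coset W x. dens A W' y) = card (A \<inter> coset W x)"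
    using of_real_eq_iff by blast
  have "(\<Sum>y\<in>coset W x. chi (dot \<xi> y)) = chi (dot \<xi> x) * (\<Sum>w\<in>W. chi (dot \<xi> w))"
    by (simp add: coset_def sum.reindex dot_add chi_add sum_distrib_left)
  also have "\<dots> = 0"
    using \<xi>(2) unfolding sum_chi_subspace[OF W(1)] by (auto simp: ann_def dot_sym)
  finally have "(\<Sum>y\<in>coset W x. chi (dot \<xi> y)) = 0" .
  from bessel_two_characters[OF finite_coset[OF W(1)] _ this, of "dens A W'"]
  have "(card (A \<inter> coset W x))\<^sup>2 + (norm (hat (A \<inter> coset W x) \<xi>))\<^sup>2 \<le> card W * (\<Sum>y\<in>coset W x. (dens A W' y)\<^sup>2)"
    using self_mem_coset[OF W(1), of x] by (auto simp: s sum_dens_coset[OF W x \<xi>(1)])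
  then show ?thesis
    using c by (simp add: dens_def power2_eq_square field_simps)
qed

text \<open>At an irregular \<open>x\<close> the coefficient is at least
  \<open>\<delta> * card (A \<inter> coset W x)\<close>, hence at least
  \<open>\<delta>\<^sup>2 * card W\<close>; its normalised square, the gain supplied by Bessel's
  inequality, is at least \<open>\<delta> ^ 4\<close>. At all other points Cauchy-Schwarz shows that
  averaging over the smaller cosets loses no energy.\<close>

lemma energy_increment:
  fixes \<delta> :: real
  assumes W: "subspace W" "subspace W'" "W' \<subseteq> W" and \<delta>: "\<delta> > 0"
    and \<xi>: "\<And>x. x \<in> irregular \<delta> A W \<Longrightarrow>
      \<exists>\<xi>\<in>ann W' - ann W. norm (hat (A \<inter> coset W x) \<xi>) \<ge> \<delta> * card (A \<inter> coset W x)"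
  shows "energy A W' \<ge> energy A W + \<delta> ^ 4 * card (irregular \<delta> A W)"
proof -
  let ?Q = "irregular \<delta> A W"
  have c: "real (card W) > 0" using card_subspace_pos[OF W(1)] by simp
  have QV: "?Q \<subseteq> V" by (auto simp: irregular_def)
  have 1: "card W * ((dens A W x)\<^sup>2 + (if x \<in> ?Q then \<delta> ^ 4 else 0)) \<le> (\<Sum>y\<in>coset W x. (dens A W' y)\<^sup>2)"
    if x: "x \<in> V" for x
  proof (cases "x \<in> ?Q")
    case True
    then obtain \<xi> where \<xi>: "\<xi> \<in> ann W' - ann W" "norm (hat (A \<inter> coset W x) \<xi>) \<ge> \<delta> * card (A \<inter> coset W x)"
      using assms(5) by blast
    have "\<delta> * card W \<le> card (A \<inter> coset W x)"
      using True c by (simp add: irregular_def dens_def field_simps)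
    then have "\<delta> * (\<delta> * card W) \<le> norm (hat (A \<inter> coset W x) \<xi>)"
      using \<xi>(2) \<delta> by (meson less_imp_le mult_left_mono order_trans)
    then have "(\<delta> * (\<delta> * card W))\<^sup>2 \<le> (norm (hat (A \<inter> coset W x) \<xi>))\<^sup>2"
      using \<delta> by (intro power_mono) auto
    then have "\<delta> ^ 4 * card W \<le> (norm (hat (A \<inter> coset W x) \<xi>))\<^sup>2 / card W"
      using c by (simp add: field_simps eval_nat_numeral)
    moreover have "\<xi> \<in> V - ann W" using \<xi>(1) by (auto simp: ann_def)
    ultimately show ?thesis
      using sum_dens_sq_coset[OF W x, of \<xi> A] \<xi>(1) True by (simp add: algebra_simps)
  next
    case False
    have "0 \<in> ann W'" by (simp add: ann_def zero_V)
    from sum_dens_coset[OF W x this, of A]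
    have "of_real (\<Sum>y\<in>coset W x. dens A W' y) = complex_of_real (card (A \<inter> coset W x))"
      by (simp add: hat_def)
    then have s: "(\<Sum>y\<in>coset W x. dens A W' y) = card (A \<inter> coset W x)"
      using of_real_eq_iff by blast
    have "(card (A \<inter> coset W x))\<^sup>2 \<le> card W * (\<Sum>y\<in>coset W x. (dens A W' y)\<^sup>2)"
      using Cauchy_Schwarz_ineq_sum[of "\<lambda>_. 1" "dens A W'" "coset W x"] by (simp add: s)
    then show ?thesis
      using False c by (simp add: dens_def power2_eq_square field_simps)
  qed
  have "card W * (energy A W + \<delta> ^ 4 * card ?Q) = (\<Sum>x\<in>V. card W * ((dens A W x)\<^sup>2 + (if x \<in> ?Q then \<delta> ^ 4 else 0)))"
  proof -
    have "(\<Sum>x\<in>V. if x \<in> ?Q then \<delta> ^ 4 else 0) = \<delta> ^ 4 * card ?Q"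
      using finite_V QV by (simp add: sum.If_cases Int_absorb1)
    then show ?thesis
      by (simp only: energy_def sum.distrib flip: sum_distrib_left)
  qed
  also have "\<dots> \<le> (\<Sum>x\<in>V. \<Sum>y\<in>coset W x. (dens A W' y)\<^sup>2)"
    by (intro sum_mono 1)
  also have "\<dots> = card W * energy A W'"
    unfolding energy_def using coset_subset[OF W(1)] by (intro sum_sum_coset[OF W(1)]) auto
  finally show ?thesis
    using c by simp
qed

section \<open>Refinement of the subspace and the regularity theorem\<close>

lemma coset_ann:
  assumes "X \<subseteq> V" "x \<in> V"
  shows "coset (ann X) x = {y \<in> V. \<forall>\<xi>\<in>X. dot \<xi> y = dot \<xi> x}"
proof -
  have "y - x \<in> V \<longleftrightarrow> y \<in> V" for y
    using assms(2) diff_V[of y x] add_V[of "y - x" x] by auto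
  then show ?thesis
    by (intro Set.set_eqI) (simp add: mem_coset ann_def dot_diff)
qed

lemma card_cosets_ann:
  assumes "X \<subseteq> V"
  shows "card (coset (ann X) ` V) \<le> 3 ^ card X"
proof -
  have finX: "finite X" using assms finite_V finite_subset by blast
  have "coset (ann X) ` V \<subseteq> (\<lambda>f. {y \<in> V. \<forall>\<xi>\<in>X. dot \<xi> y = f \<xi>}) ` (X \<rightarrow>\<^sub>E UNIV)"
  proof
    fix C assume "C \<in> coset (ann X) ` V"
    then obtain x where x: "x \<in> V" "C = coset (ann X) x" by blast
    show "C \<in> (\<lambda>f. {y \<in> V. \<forall>\<xi>\<in>X. dot \<xi> y = f \<xi>}) ` (X \<rightarrow>\<^sub>E UNIV)"
      by (rule image_eqI[of _ _ "restrict (\<lambda>\<xi>. dot \<xi> x) X"]) (use x coset_ann[OF assms x(1)] in auto)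
  qed
  then have "card (coset (ann X) ` V) \<le> card ((\<lambda>f. {y \<in> V. \<forall>\<xi>\<in>X. dot \<xi> y = f \<xi>}) ` (X \<rightarrow>\<^sub>E (UNIV :: 3 set)))"
    using finX by (intro card_mono) (auto intro!: finite_PiE)
  also have "\<dots> \<le> card (X \<rightarrow>\<^sub>E (UNIV :: 3 set))"
    using finX by (intro card_image_le) (auto intro!: finite_PiE)
  also have "\<dots> = 3 ^ card X"
    using finX by (simp add: card_funcsetE)
  finally show ?thesis .
qed

lemma refinement:
  fixes \<delta> :: real
  assumes X: "X \<subseteq> V" and \<delta>: "\<delta> > 0"
  obtains X' where "X' \<subseteq> V" "card X' \<le> card X + 3 ^ card X"
    "energy A (ann X') \<ge> energy A (ann X) + \<delta> ^ 4 * card (irregular \<delta> A (ann X))"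
proof -
  let ?W = "ann X" and ?Q = "irregular \<delta> A (ann X)"
  have QV: "?Q \<subseteq> V" by (auto simp: irregular_def)
  \<comment> \<open>The witness is chosen as a function of the coset, not of the point, so that the
    number of new frequencies is bounded by the number of cosets.\<close>
  define F where "F C = (SOME \<xi>. \<xi> \<in> V - ann ?W \<and> norm (hat (A \<inter> C) \<xi>) \<ge> \<delta> * card (A \<inter> C))" for C
  have F: "F (coset ?W x) \<in> V - ann ?W"
    "norm (hat (A \<inter> coset ?W x) (F (coset ?W x))) \<ge> \<delta> * card (A \<inter> coset ?W x)" if "x \<in> ?Q" for x
  proof -
    have "\<exists>\<xi>. \<xi> \<in> V - ann ?W \<and> norm (hat (A \<inter> coset ?W x) \<xi>) \<ge> \<delta> * card (A \<inter> coset ?W x)"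
      using that by (auto simp: irregular_def biased_def)
    from someI_ex[OF this] show "F (coset ?W x) \<in> V - ann ?W"
      "norm (hat (A \<inter> coset ?W x) (F (coset ?W x))) \<ge> \<delta> * card (A \<inter> coset ?W x)"
      by (simp_all only: F_def)
  qed
  define X' where "X' = X \<union> F ` coset ?W ` ?Q"
  have X'V: "X' \<subseteq> V" using X F(1) by (auto simp: X'_def)
  have "card (F ` coset ?W ` ?Q) \<le> card (coset ?W ` ?Q)"
    using finite_V QV finite_subset by (intro card_image_le) blast
  also have "\<dots> \<le> card (coset ?W ` V)"
    using finite_V QV by (intro card_mono) auto
  also have "\<dots> \<le> 3 ^ card X" by (rule card_cosets_ann[OF X])
  finally have "card X' \<le> card X + 3 ^ card X"
    unfolding X'_def by (meson add_left_mono card_Un_le order_trans)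
  moreover have "energy A (ann X') \<ge> energy A ?W + \<delta> ^ 4 * card ?Q"
  proof (rule energy_increment[OF subspace_ann subspace_ann _ \<delta>])
    show "ann X' \<subseteq> ?W" by (auto simp: ann_def X'_def)
    fix x assume x: "x \<in> ?Q"
    then have "F (coset ?W x) \<in> ann (ann X')"
    proof -
      have "F (coset ?W x) \<in> X'" using x unfolding X'_def by blast
      then have "dot y (F (coset ?W x)) = 0" if "y \<in> ann X'" for y
        using that unfolding ann_def dot_sym[of y] by blast
      then show ?thesis
        using F(1)[OF x] unfolding ann_def[of "ann X'"] by blast
    qed
    then show "\<exists>\<xi>\<in>ann (ann X') - ann ?W. norm (hat (A \<inter> coset ?W x) \<xi>) \<ge> \<delta> * card (A \<inter> coset ?W x)"
      using F(1)[OF x] F(2)[OF x] by (intro bexI[of _ "F (coset ?W x)"]) simp_all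
  qed
  ultimately show thesis by (rule that[OF X'V])
qed

text \<open>As long as more than \<open>\<delta> * card V\<close> points are irregular, each
  refinement raises the energy by \<open>\<delta> ^ 5 * card V\<close>. The energy never exceeds
  \<open>card V\<close>, so fewer than \<open>j\<close> such steps are possible.\<close>

lemma regular_ann:
  fixes \<delta> :: real
  assumes \<delta>: "\<delta> > 0" and j: "real j * \<delta> ^ 5 > 1"
  shows "\<exists>X\<subseteq>V. card X \<le> tower j \<and> card (irregular \<delta> A (ann X)) \<le> \<delta> * card V"
proof (rule ccontr)
  assume asm: "\<not> ?thesis"
  have *: "card (irregular \<delta> A (ann X)) > \<delta> * card V" if "X \<subseteq> V" "card X \<le> tower j" for X
    using that asm by (meson not_le)
  have "\<exists>X\<subseteq>V. card X \<le> tower i \<and> energy A (ann X) \<ge> i * \<delta> ^ 5 * card V" if "i \<le> j" for i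
    using that
  proof (induction i)
    case 0
    then show ?case by (intro exI[of _ "{}"]) (auto simp: energy_def intro!: sum_nonneg)
  next
    case (Suc i)
    then obtain X where X: "X \<subseteq> V" "card X \<le> tower i" "energy A (ann X) \<ge> i * \<delta> ^ 5 * card V"
      by auto
    have "tower i \<le> tower j"
      by (rule lift_Suc_mono_le) (use Suc.prems in simp_all)
    then have Q: "card (irregular \<delta> A (ann X)) \<ge> \<delta> * card V"
      using *[OF X(1)] X(2) by simp
    obtain X' where X': "X' \<subseteq> V" "card X' \<le> card X + 3 ^ card X"
      "energy A (ann X') \<ge> energy A (ann X) + \<delta> ^ 4 * card (irregular \<delta> A (ann X))"
      using refinement[OF X(1) \<delta>] .
    have "card X' \<le> tower (Suc i)"
    proof -
      have "(3::nat) ^ card X \<le> 3 ^ tower i" using X(2) by (intro power_increasing) auto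
      then show ?thesis using X'(2) X(2) unfolding tower.simps by linarith
    qed
    moreover have "energy A (ann X') \<ge> Suc i * \<delta> ^ 5 * card V"
    proof -
      have "\<delta> ^ 4 * (\<delta> * card V) \<le> \<delta> ^ 4 * card (irregular \<delta> A (ann X))"
        using Q \<delta> by (intro mult_left_mono) auto
      then show ?thesis
        using X'(3) X(3) by (simp add: algebra_simps eval_nat_numeral)
    qed
    ultimately show ?case using X'(1) by blast
  qed
  then obtain X where "energy A (ann X) \<ge> j * \<delta> ^ 5 * card V" by blast
  moreover have "j * \<delta> ^ 5 * card V > 1 * real (card V)"
    using j card_V_pos by (intro mult_strict_right_mono) auto
  ultimately show False
    using energy_le[OF subspace_ann, of A X] by linarith
qed

text \<open>Unions of cosets of a subspace of codimension at most \<open>d\<close>; the subspace may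
  vary from one union to another.\<close>

definition invariant_sets :: "nat \<Rightarrow> 'v set set" where
  "invariant_sets d = {F. F \<subseteq> V \<and> (\<exists>X\<subseteq>V. card X \<le> d \<and> (\<forall>x\<in>F. coset (ann X) x \<subseteq> F))}"

theorem regularity:
  fixes \<delta> :: real
  assumes "A \<subseteq> V" "sumfree A" "\<delta> > 0" "real j * \<delta> ^ 5 > 1"
  shows "\<exists>F\<in>invariant_sets (tower j). sumfree F \<and> card (A - F) \<le> 2 * \<delta> * card V"
proof -
  obtain X where X: "X \<subseteq> V" "card X \<le> tower j" "card (irregular \<delta> A (ann X)) \<le> \<delta> * card V"
    using regular_ann[OF assms(3,4)] by blast
  let ?F = "core \<delta> A (ann X)"
  have "coset (ann X) x \<subseteq> ?F" if "x \<in> ?F" for x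
    using that coset_subset[OF subspace_ann, of x X] dens_cong[OF subspace_ann, of _ X x A]
      biased_cong[OF subspace_ann, of _ X x \<delta> A]
    by (auto simp: core_def)
  then have "?F \<in> invariant_sets (tower j)"
    using X by (auto simp: invariant_sets_def core_def)
  moreover have "card (A - ?F) \<le> 2 * \<delta> * card V"
    using card_diff_core[OF assms(1) subspace_ann assms(3), of X] X(3) by simp
  ultimately show ?thesis
    using sumfree_core[OF assms(1,2) subspace_ann assms(3)] by blast
qed

text \<open>Such a set is determined by \<open>d\<close> frequencies and by the collection of
  patterns in the \<open>d\<close> values of \<open>dot\<close> that its points realise. For fixed
  \<open>d\<close> the bound is polynomial in \<open>card V\<close>.\<close>

lemma card_invariant_sets: "card (invariant_sets d) \<le> card V ^ d * 2 ^ (3 ^ d)"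
proof -
  let ?P = "({..<d} \<rightarrow>\<^sub>E V) \<times> Pow ({..<d} \<rightarrow>\<^sub>E (UNIV :: 3 set))"
  let ?g = "\<lambda>(g, B). {x \<in> V. restrict (\<lambda>i. dot (g i) x) {..<d} \<in> B}"
  have finP: "finite ?P"
    using finite_V by (auto intro!: finite_PiE)
  have "invariant_sets d \<subseteq> ?g ` ?P"
  proof
    fix F assume "F \<in> invariant_sets d"
    then obtain X where FX: "F \<subseteq> V" "X \<subseteq> V" "card X \<le> d" "\<And>x. x \<in> F \<Longrightarrow> coset (ann X) x \<subseteq> F"
      by (auto simp: invariant_sets_def)
    have "finite X" using FX(2) finite_V finite_subset by blast
    then obtain h where h: "bij_betw h {0..<card X} X"
      using ex_bij_betw_nat_finite by blast
    \<comment> \<open>Padding with the frequency 0 lets all \<open>X\<close> with at most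
      \<open>d\<close> elements be encoded by sequences of length exactly \<open>d\<close>.\<close>
    define g where "g = (\<lambda>i\<in>{..<d}. if i < card X then h i else 0)"
    define B where "B = (\<lambda>x. restrict (\<lambda>i. dot (g i) x) {..<d}) ` F"
    have hX: "h i \<in> X" if "i < card X" for i
      using h that by (auto simp: bij_betw_def)
    have "g \<in> {..<d} \<rightarrow>\<^sub>E V"
      using hX FX(2) zero_V by (auto simp: g_def subset_iff)
    moreover have "B \<in> Pow ({..<d} \<rightarrow>\<^sub>E UNIV)"
      unfolding B_def by (intro PowI image_subsetI) (simp add: restrict_PiE_iff)
    moreover have "F = ?g (g, B)"
    proof
      show "F \<subseteq> ?g (g, B)" using FX(1) by (auto simp: B_def)
      show "?g (g, B) \<subseteq> F"
      proof
        fix x assume "x \<in> ?g (g, B)"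
        then obtain y where y: "x \<in> V" "y \<in> F" "restrict (\<lambda>i. dot (g i) x) {..<d} = restrict (\<lambda>i. dot (g i) y) {..<d}"
          by (auto simp: B_def)
        have "dot \<xi> x = dot \<xi> y" if "\<xi> \<in> X" for \<xi>
        proof -
          obtain i where i: "i < card X" "h i = \<xi>"
            using \<open>\<xi> \<in> X\<close> bij_betw_imp_surj_on[OF h] by force
          then show ?thesis
            using fun_cong[OF y(3), of i] FX(3) by (simp add: g_def)
        qed
        then have "x \<in> coset (ann X) y"
          using coset_ann[OF FX(2), of y] y FX(1) by auto
        then show "x \<in> F" using FX(4)[OF y(2)] by blast
      qed
    qed
    ultimately show "F \<in> ?g ` ?P" by (metis (no_types, lifting) image_eqI mem_Sigma_iff)
  qed
  then have "card (invariant_sets d) \<le> card (?g ` ?P)"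
    using finP by (intro card_mono) auto
  also have "\<dots> \<le> card ?P" by (rule card_image_le[OF finP])
  also have "\<dots> = card V ^ d * 2 ^ (3 ^ d)"
    by (simp add: card_cartesian_product card_Pow card_funcsetE finite_PiE)
  finally show ?thesis .
qed

end

section \<open>Stability of large sum-free sets\<close>

context ternary_space
begin

definition slice :: "'v \<Rightarrow> 3 \<Rightarrow> 'v set" where
  "slice \<xi> i = {x \<in> V. dot \<xi> x = i}"

abbreviation hyp :: "'v \<Rightarrow> 'v set" where
  "hyp \<xi> \<equiv> slice \<xi> 1"

lemma slice_subset: "slice \<xi> i \<subseteq> V"
  by (auto simp: slice_def)

lemma finite_slice: "finite (slice \<xi> i)"
  using finite_V by (simp add: slice_def)

lemma slice_uminus: "slice (- \<xi>) i = slice \<xi> (- i)"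
  by (auto simp: slice_def dot_neg)

lemma neg_one_three: "- (1 :: 3) = 2" "- (2 :: 3) = 1"
  by simp_all

lemma V_eq_slices: "V = slice \<xi> 0 \<union> slice \<xi> 1 \<union> slice \<xi> 2"
  using three_cases by (auto simp: slice_def)

lemma ex_dot_eq_1:
  assumes "\<xi> \<in> V" "\<xi> \<noteq> 0"
  shows "\<exists>u\<in>V. dot \<xi> u = 1"
proof -
  obtain y where y: "y \<in> V" "dot \<xi> y \<noteq> 0" using dot_nondegenerate[OF assms] by blast
  then have "dot \<xi> y = 1 \<or> dot \<xi> (- y) = 1"
    using three_cases[of "dot \<xi> y"] by (auto simp: dot_neg)
  then show ?thesis using y neg_V by blast
qed

lemma card_slice:
  assumes "\<xi> \<in> V" "\<xi> \<noteq> 0"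
  shows "3 * card (slice \<xi> i) = card V"
proof -
  obtain u where u: "u \<in> V" "dot \<xi> u = 1" using ex_dot_eq_1[OF assms] by blast
  have shift: "card (slice \<xi> (j + 1)) = card (slice \<xi> j)" for j
  proof -
    have "bij_betw (\<lambda>x. x + u) (slice \<xi> j) (slice \<xi> (j + 1))"
      by (rule bij_betw_byWitness[of _ "\<lambda>x. x - u"])
         (use u in \<open>auto simp: slice_def dot_add dot_diff add_V diff_V\<close>)
    then show ?thesis using bij_betw_same_card by metis
  qed
  have eq: "card (slice \<xi> 1) = card (slice \<xi> 0)" "card (slice \<xi> 2) = card (slice \<xi> 0)"
    using shift[of 0] shift[of 1] by simp_all
  have "card V = card (slice \<xi> 0 \<union> slice \<xi> 1 \<union> slice \<xi> 2)"
    using V_eq_slices by simp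
  also have "\<dots> = card (slice \<xi> 0 \<union> slice \<xi> 1) + card (slice \<xi> 2)"
    using finite_slice by (intro card_Un_disjoint) (auto simp: slice_def)
  also have "card (slice \<xi> 0 \<union> slice \<xi> 1) = card (slice \<xi> 0) + card (slice \<xi> 1)"
    using finite_slice by (intro card_Un_disjoint) (auto simp: slice_def)
  finally show ?thesis
    using eq three_cases[of i] by auto
qed

lemma sumfree_hyp: "sumfree (hyp \<xi>)"
  by (auto simp: sumfree_def slice_def dot_add)

lemma subspace_slice_0: "subspace (slice \<xi> 0)"
  by (auto simp: subspace_def slice_def zero_V add_V dot_add)

section \<open>A large sum-free set almost misses a kernel\<close>

lemma two_card_sumfree_le:
  assumes "A \<subseteq> V" "sumfree A"
  shows "2 * card A \<le> card V"
proof (cases "A = {}")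
  case False
  then obtain x where x: "x \<in> A" by blast
  have fin: "finite A" using assms finite_V finite_subset by blast
  have "card (A \<union> (\<lambda>y. x + y) ` A) = card A + card A"
    using fin x assms(2) by (subst card_Un_disjoint) (auto simp: card_image sumfree_def)
  moreover have "card (A \<union> (\<lambda>y. x + y) ` A) \<le> card V"
    using assms(1) x add_V by (intro card_mono finite_V) auto
  ultimately show ?thesis by simp
qed simp

lemma Re_hat:
  assumes "finite A"
  shows "2 * Re (hat A \<xi>) = 3 * real (card (A \<inter> {x. dot \<xi> x = 0})) - real (card A)"
proof -
  have "Re (hat A \<xi>) = (\<Sum>x\<in>A. (3 / 2) * (if dot \<xi> x = 0 then 1 else 0) - 1 / 2)"
    unfolding hat_def Re_sum by (intro sum.cong) (auto simp: Re_chi)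
  also have "\<dots> = (3 / 2) * card (A \<inter> {x. dot \<xi> x = 0}) - card A / 2"
    using assms unfolding sum_subtractf sum_distrib_left[symmetric] by (simp add: sum.If_cases)
  finally show ?thesis by simp
qed

text \<open>Sum-freeness makes the sum of
  \<open>(norm (hat A \<eta>))\<^sup>2 * Re (hat A \<eta>)\<close> vanish. The frequency 0
  contributes \<open>a ^ 3\<close>, and by Parseval the others have total weight
  \<open>n * a - a\<^sup>2\<close>, so the smallest real part is at most
  \<open>- a\<^sup>2 / (n - a)\<close>.\<close>

lemma ex_negative_coefficient:
  assumes A: "A \<subseteq> V" "sumfree A" "A \<noteq> {}"
  shows "\<exists>\<xi>\<in>V - {0}. Re (hat A \<xi>) * (real (card V) - card A) \<le> - (real (card A))\<^sup>2"
proof -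
  define n a where "n = real (card V)" "a = real (card A)"
  note defs = this
  have fin: "finite A" using A finite_V finite_subset by blast
  then have a: "a > 0" using A by (simp add: defs card_gt_0_iff)
  have "0 \<notin> A" using A by (force simp: sumfree_def)
  then have "V - {0} \<noteq> {}" using A by blast
  then obtain \<xi> where \<xi>: "\<xi> \<in> V - {0}" "\<And>\<eta>. \<eta> \<in> V - {0} \<Longrightarrow> Re (hat A \<xi>) \<le> Re (hat A \<eta>)"
    using ex_is_arg_min_if_finite[of "V - {0}" "\<lambda>\<xi>. Re (hat A \<xi>)"] finite_V
    by (auto simp: is_arg_min_linorder)
  define r where "r = Re (hat A \<xi>)"
  have hat0: "hat A 0 = a" by (simp add: hat_def defs)
  have "(\<Sum>\<eta>\<in>V. hat A \<eta> * hat A \<eta> * cnj (hat A \<eta>)) = 0"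
    using A by (intro sum_hat_triple) (auto simp: sumfree_def)
  moreover have "Re (hat A \<eta> * hat A \<eta> * cnj (hat A \<eta>)) = (norm (hat A \<eta>))\<^sup>2 * Re (hat A \<eta>)" for \<eta>
  proof -
    have "hat A \<eta> * hat A \<eta> * cnj (hat A \<eta>) = (hat A \<eta> * cnj (hat A \<eta>)) * hat A \<eta>"
      by (simp only: mult_ac)
    also have "\<dots> = of_real ((norm (hat A \<eta>))\<^sup>2) * hat A \<eta>"
      by (simp only: complex_norm_square)
    finally show ?thesis by (simp only: Re_complex_of_real Im_complex_of_real times_complex.simps)
  qed
  ultimately have "(\<Sum>\<eta>\<in>V. (norm (hat A \<eta>))\<^sup>2 * Re (hat A \<eta>)) = 0"
    using Re_sum[of "\<lambda>\<eta>. hat A \<eta> * hat A \<eta> * cnj (hat A \<eta>)" V] by simp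
  then have "a\<^sup>2 * a + (\<Sum>\<eta>\<in>V - {0}. (norm (hat A \<eta>))\<^sup>2 * Re (hat A \<eta>)) = 0"
    using sum.remove[OF finite_V zero_V, of "\<lambda>\<eta>. (norm (hat A \<eta>))\<^sup>2 * Re (hat A \<eta>)"] hat0 by simp
  moreover have "(\<Sum>\<eta>\<in>V - {0}. (norm (hat A \<eta>))\<^sup>2 * Re (hat A \<eta>)) \<ge> (\<Sum>\<eta>\<in>V - {0}. (norm (hat A \<eta>))\<^sup>2 * r)"
    using \<xi> by (intro sum_mono mult_left_mono) (auto simp: r_def)
  moreover have "(\<Sum>\<eta>\<in>V - {0}. (norm (hat A \<eta>))\<^sup>2) = n * a - a\<^sup>2"
    using sum.remove[OF finite_V zero_V, of "\<lambda>\<eta>. (norm (hat A \<eta>))\<^sup>2"] parseval[OF A(1)] hat0 by (simp add: defs)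
  ultimately have "a\<^sup>2 * a + (n * a - a\<^sup>2) * r \<le> 0"
    unfolding sum_distrib_right[symmetric] by simp
  then have "a * (a\<^sup>2 + r * (n - a)) \<le> a * 0"
    by (simp add: algebra_simps power2_eq_square)
  then have "r * (n - a) \<le> - a\<^sup>2"
    unfolding mult_le_cancel_left_pos[OF a] by linarith
  then show ?thesis using \<xi>(1) by (auto simp: r_def defs)
qed

text \<open>The real part of a coefficient depends only on how many elements of \<open>A\<close> lie
  in the kernel, as \<open>Re (chi a)\<close> is 1 or \<open>- 1 / 2\<close>. The negative
  coefficient thus becomes \<open>3 * b * (n - a) \<le> a * (n - 3 * a)\<close>, and
  \<open>a \<le> n - a\<close> allows the division.\<close>

lemma ex_slice_0_small:
  fixes c :: real
  assumes A: "A \<subseteq> V" "sumfree A" "A \<noteq> {}" and c: "c \<ge> 0" "real (card A) \<ge> (1 / 3 - c) * card V"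
  shows "\<exists>\<xi>\<in>V - {0}. card (A \<inter> slice \<xi> 0) \<le> c * card V"
proof -
  define n a where "n = real (card V)" "a = real (card A)"
  note defs = this
  obtain \<xi> where \<xi>: "\<xi> \<in> V - {0}" "Re (hat A \<xi>) * (n - a) \<le> - a\<^sup>2"
    using ex_negative_coefficient[OF A] by (auto simp: defs)
  define b where "b = real (card (A \<inter> slice \<xi> 0))"
  have fin: "finite A" using A finite_V finite_subset by blast
  then have "a > 0" using A by (simp add: defs card_gt_0_iff)
  have "A \<inter> {x. dot \<xi> x = 0} = A \<inter> slice \<xi> 0" using A by (auto simp: slice_def)
  then have "2 * Re (hat A \<xi>) = 3 * b - a"
    using Re_hat[OF fin, of \<xi>] by (simp add: b_def defs)
  then have "(3 * b - a) * (n - a) \<le> - 2 * a\<^sup>2"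
    using \<xi>(2) by (metis (no_types) mult.assoc mult_left_mono mult_minus_left mult_minus_right zero_le_numeral)
  then have "3 * b * (n - a) \<le> a * (n - 3 * a)"
    by (simp add: algebra_simps power2_eq_square)
  also have "\<dots> \<le> a * (3 * c * n)"
    using c \<open>a > 0\<close> by (intro mult_left_mono) (auto simp: defs algebra_simps)
  also have an: "2 * a \<le> n" using two_card_sumfree_le[OF A(1,2)] by (simp add: defs)
  then have "a * (3 * c * n) \<le> (n - a) * (3 * c * n)"
    using c by (intro mult_right_mono) (auto simp: defs)
  finally have "(3 * b) * (n - a) \<le> (3 * c * n) * (n - a)" by (simp add: mult_ac)
  then have "b \<le> c * n"
    using an \<open>a > 0\<close> by (subst (asm) mult_le_cancel_right) auto
  then show ?thesis using \<xi>(1) by (auto simp: b_def defs)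
qed

section \<open>Sets of small doubling\<close>

lemma card_translate_inter:
  fixes X :: "'v set"
  assumes "finite S" "(\<lambda>y. y + p) ` X \<subseteq> S" "(\<lambda>y. y + q) ` X \<subseteq> S"
  shows "card {y \<in> X. y + (p - q) \<in> X} + card S \<ge> 2 * card X"
proof -
  have finX: "finite X"
    using finite_imageD[of "\<lambda>y. y + p" X] finite_subset[OF assms(2,1)] by simp
  have "card ((\<lambda>y. y + p) ` X \<union> (\<lambda>y. y + q) ` X) \<le> card S"
    using assms by (intro card_mono) auto
  moreover have "card ((\<lambda>y. y + p) ` X \<union> (\<lambda>y. y + q) ` X) + card ((\<lambda>y. y + p) ` X \<inter> (\<lambda>y. y + q) ` X) = card X + card X"
    using card_Un_Int[of "(\<lambda>y. y + p) ` X" "(\<lambda>y. y + q) ` X"] finX by (simp add: card_image)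
  moreover have "card ((\<lambda>y. y + p) ` X \<inter> (\<lambda>y. y + q) ` X) \<le> card {y \<in> X. y + (p - q) \<in> X}"
  proof (rule card_inj_on_le[of "\<lambda>z. z - p"])
    have "(\<lambda>y. y + r) ` X = {z. z - r \<in> X}" for r by (force simp: image_iff)
    then show "(\<lambda>z. z - p) ` ((\<lambda>y. y + p) ` X \<inter> (\<lambda>y. y + q) ` X) \<subseteq> {y \<in> X. y + (p - q) \<in> X}"
      by auto
  qed (use finX in auto)
  ultimately show ?thesis by linarith
qed

definition sumset :: "'v set \<Rightarrow> 'v set" where
  "sumset X = (\<lambda>(x, y). x + y) ` (X \<times> X)"

lemma card_sumset_ge:
  assumes "finite X" "x \<in> X"
  shows "card X \<le> card (sumset X)"
proof -
  have "card X = card ((\<lambda>y. x + y) ` X)" by (simp add: card_image)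
  also have "\<dots> \<le> card (sumset X)"
    using assms by (intro card_mono) (auto simp: sumset_def)
  finally show ?thesis .
qed

text \<open>Every difference has at least \<open>(1 - \<kappa>) * card X\<close> representations,
  since two translates of \<open>X\<close> inside the sumset overlap that much. This is more than
  half of \<open>X\<close>, so the representation sets of \<open>- d\<close> and \<open>d'\<close>
  share a point \<open>y\<close>, and \<open>d + d'\<close> is the difference of
  \<open>y + d'\<close> and \<open>y - d\<close>. Counting all pairs of elements of \<open>X\<close>
  by their difference gives the last bound.\<close>

lemma small_doubling:
  fixes \<kappa> :: real
  assumes X: "X \<subseteq> V" "X \<noteq> {}" and \<kappa>: "card (sumset X) \<le> (1 + \<kappa>) * card X" "\<kappa> < 1 / 2"
  defines "D \<equiv> (\<lambda>(x, y). x - y) ` (X \<times> X)"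
  shows "subspace D" "card X \<le> card D" "(1 - \<kappa>) * card D \<le> card X"
proof -
  have finX: "finite X" using X finite_V finite_subset by blast
  then have a: "card X > 0" using X by (simp add: card_gt_0_iff)
  have finS: "finite (sumset X)" using finX by (simp add: sumset_def)
  define r where "r d = {y \<in> X. y + d \<in> X}" for d
  have r: "(1 - \<kappa>) * card X \<le> card (r d)" if "d \<in> D" for d
  proof -
    obtain p q where "p \<in> X" "q \<in> X" "d = p - q" using \<open>d \<in> D\<close> by (auto simp: D_def)
    then have "2 * card X \<le> card (r d) + card (sumset X)"
      using card_translate_inter[OF finS, of p X q] by (auto simp: r_def sumset_def)
    then show ?thesis using \<kappa>(1) by (simp add: algebra_simps)
  qed
  have D: "x - y \<in> D" if "x \<in> X" "y \<in> X" for x y using that by (auto simp: D_def)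
  have DV: "D \<subseteq> V" using X diff_V by (auto simp: D_def)
  have finD: "finite D" using DV finite_V finite_subset by blast
  show sub: "subspace D"
    unfolding subspace_def
  proof (intro conjI ballI DV)
    show "0 \<in> D" using X(2) D by (metis all_not_in_conv diff_self)
    fix d d' assume d: "d \<in> D" "d' \<in> D"
    have "r (- d) \<inter> r d' \<noteq> {}"
    proof
      assume "r (- d) \<inter> r d' = {}"
      then have "card (r (- d)) + card (r d') = card (r (- d) \<union> r d')"
        using finX by (subst card_Un_disjoint) (auto simp: r_def)
      also have "\<dots> \<le> card X" using finX by (intro card_mono) (auto simp: r_def)
      finally have "real (card (r (- d))) + card (r d') \<le> card X" by linarith
      moreover have "- d \<in> D" using d(1) by (force simp: D_def)
      ultimately have "(1 - \<kappa>) * card X + (1 - \<kappa>) * card X \<le> card X"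
        using r[of "- d"] r[OF d(2)] by linarith
      then have "(1 - 2 * \<kappa>) * card X \<le> 0" by (simp add: algebra_simps)
      then show False using a \<kappa>(2) by (simp add: mult_le_0_iff)
    qed
    then obtain y where "y + - d \<in> X" "y + d' \<in> X" by (auto simp: r_def)
    from D[OF this(2,1)] show "d + d' \<in> D" by (simp add: algebra_simps)
  qed
  obtain x where x: "x \<in> X" using X(2) by blast
  have "X \<subseteq> coset D x" using D[OF _ x] by (auto simp: mem_coset)
  then show "card X \<le> card D"
    using card_mono[OF finite_coset[OF sub], of X x] by simp
  have "(\<Sum>d\<in>D. card (r d)) = card (SIGMA d:D. r d)"
    using finD finX by (intro card_SigmaI[symmetric]) (auto simp: r_def)
  also have "\<dots> \<le> card (X \<times> X)"
    by (rule card_inj_on_le[of "\<lambda>(d, y). (y + d, y)"]) (use finX in \<open>auto simp: inj_on_def r_def\<close>)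
  finally have "real (\<Sum>d\<in>D. card (r d)) \<le> real (card X * card X)"
    by (simp only: card_cartesian_product of_nat_le_iff)
  moreover have "(\<Sum>d\<in>D. (1 - \<kappa>) * card X) \<le> real (\<Sum>d\<in>D. card (r d))"
    unfolding of_nat_sum by (intro sum_mono r)
  ultimately have "((1 - \<kappa>) * card D) * card X \<le> card X * card X"
    by (simp add: mult_ac)
  then show "(1 - \<kappa>) * card D \<le> card X" using a by simp
qed

text \<open>Cardinalities of subspaces are powers of 3, so there is a gap between the full kernel
  and its proper subspaces.\<close>

lemma card_subspace_of_kernel:
  assumes "subspace W" "W \<subseteq> slice \<xi> 0" "\<xi> \<in> V" "\<xi> \<noteq> 0"
  shows "3 * card W = card V \<or> 9 * card W \<le> card V"
proof -
  have "card W dvd 3 ^ k" using card_ann[OF assms(1)] card_V by (metis dvd_triv_left)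
  then obtain j where j: "j \<le> k" "card W = 3 ^ j"
    using divides_primepow_nat[of 3 "card W" k] by auto
  have "3 * card W \<le> 3 * card (slice \<xi> 0)"
    using assms(2) finite_slice by (intro mult_left_mono card_mono) auto
  then have "(3::nat) ^ (j + 1) \<le> 3 ^ k"
    using card_slice[OF assms(3,4), of 0] card_V j by simp
  then have "j + 1 \<le> k" by (rule power_le_imp_le_exp[rotated]) simp
  then consider "k = j + 1" | "j + 2 \<le> k" by linarith
  then show ?thesis
  proof cases
    case 2
    then have "(3::nat) ^ (j + 2) \<le> 3 ^ k" by (intro power_increasing) auto
    then show ?thesis using card_V j by simp
  qed (use card_V j in auto)
qed

text \<open>\<open>X + X\<close> and the part of \<open>A\<close> in \<open>slice \<xi> 2\<close>
  are disjoint subsets of that slice, which forces \<open>X\<close> to have doubling close to 1. Its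
  differences form a subspace of the kernel. If this were the whole kernel, \<open>X\<close> would
  nearly fill its slice and leave too little room in the other one; otherwise it has at most
  \<open>card V / 9\<close> elements.\<close>

lemma side_small:
  fixes \<tau> :: real
  assumes A: "A \<subseteq> V" "sumfree A" and \<tau>: "0 < \<tau>" "\<tau> \<le> 1 / 2" and \<xi>: "\<xi> \<in> V" "\<xi> \<noteq> 0"
    and big: "card (A \<inter> slice \<xi> 1) > \<tau> / 2 * card V" "card (A \<inter> slice \<xi> 2) > \<tau> / 2 * card V"
    and tot: "real (card (A \<inter> slice \<xi> 1)) + card (A \<inter> slice \<xi> 2) \<ge> (1 / 3 - \<tau>\<^sup>2 / 8) * card V"
  shows "9 * card (A \<inter> slice \<xi> 1) \<le> card V"
proof -
  define X where "X = A \<inter> slice \<xi> 1"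
  define n a b where "n = real (card V)" "a = real (card X)" "b = real (card (A \<inter> slice \<xi> 2))"
  note defs = this
  have n: "n > 0" using card_V_pos by (simp add: defs)
  have XV: "X \<subseteq> V" using A by (auto simp: X_def)
  have finX: "finite X" using XV finite_V finite_subset by blast
  have a: "a > \<tau> / 2 * n" "b > \<tau> / 2 * n" using big by (simp_all add: defs X_def)
  have "\<tau> / 2 * n > 0" using \<tau> n by simp
  then have "a > 0" using a by linarith
  then have "X \<noteq> {}" by (auto simp: defs)
  then obtain x where x: "x \<in> X" by blast
  have disj: "sumset X \<inter> (A \<inter> slice \<xi> 2) = {}"
    using A(2) by (auto simp: sumset_def sumfree_def X_def)
  have sub: "sumset X \<union> (A \<inter> slice \<xi> 2) \<subseteq> slice \<xi> 2"
    using A by (auto simp: sumset_def X_def slice_def dot_add add_V)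
  have "card (sumset X) + card (A \<inter> slice \<xi> 2) = card (sumset X \<union> (A \<inter> slice \<xi> 2))"
    using disj finX finite_slice by (subst card_Un_disjoint) (auto simp: sumset_def)
  also have "\<dots> \<le> card (slice \<xi> 2)" by (rule card_mono[OF finite_slice sub])
  finally have le: "real (card (sumset X)) + b \<le> n / 3"
    using card_slice[OF \<xi>, of 2] by (simp add: defs)
  \<comment> \<open>The deficit is quadratic in \<open>\<tau>\<close> so that the lower bound
    \<open>a > \<tau> / 2 * n\<close> turns it into a relative error
    \<open>\<tau> / 4\<close>.\<close>
  have "\<tau>\<^sup>2 / 8 * n = (\<tau> / 4) * (\<tau> / 2 * n)" by (simp add: power2_eq_square)
  also have "\<dots> \<le> (\<tau> / 4) * a" using a \<tau> by (intro mult_left_mono) auto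
  finally have "real (card (sumset X)) \<le> (1 + \<tau> / 4) * a"
    using le tot by (simp add: defs X_def algebra_simps)
  then have dbl: "real (card (sumset X)) \<le> (1 + \<tau> / 4) * real (card X)" by (simp add: defs)
  define D where "D = (\<lambda>(x, y). x - y) ` (X \<times> X)"
  have D: "subspace D" "card X \<le> card D" "(1 - \<tau> / 4) * card D \<le> card X"
    using small_doubling[OF XV \<open>X \<noteq> {}\<close> dbl] \<tau> unfolding D_def by auto
  have "D \<subseteq> slice \<xi> 0" using XV by (auto simp: D_def X_def slice_def dot_diff diff_V)
  from card_subspace_of_kernel[OF D(1) this \<xi>] show ?thesis
  proof
    assume "3 * card D = card V"
    then have "(1 - \<tau> / 4) * (n / 3) \<le> a" using D(3) by (simp add: defs flip: \<open>3 * card D = card V\<close>)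
    moreover have "a \<le> real (card (sumset X))"
      using card_sumset_ge[OF finX x] by (simp add: defs)
    ultimately have "b \<le> \<tau> / 12 * n"
      using le by (simp add: algebra_simps)
    moreover have "\<tau> / 12 * n \<le> \<tau> / 2 * n" using \<tau> n by simp
    ultimately show ?thesis using a by linarith
  next
    assume "9 * card D \<le> card V"
    then show ?thesis using D(2) by (simp add: X_def)
  qed
qed

text \<open>The deficit of \<open>A\<close> and its part in the kernel cost
  \<open>\<tau>\<^sup>2 / 16\<close> each. If both remaining slices were sizeable,
  \<open>side_small\<close> for \<open>\<xi>\<close> and for \<open>- \<xi>\<close>, which exchanges
  them, would bound each by \<open>n / 9\<close>; but
  \<open>2 / 9 < 1 / 3 - \<tau>\<^sup>2 / 8\<close>.\<close>

theorem stability: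
  fixes \<tau> :: real
  assumes A: "A \<subseteq> V" "sumfree A" and \<tau>: "0 < \<tau>" "\<tau> \<le> 1 / 2"
    and big: "card A \<ge> (1 / 3 - \<tau>\<^sup>2 / 16) * card V"
  shows "\<exists>\<xi>\<in>V - {0}. card (A - hyp \<xi>) \<le> \<tau> * card V"
proof -
  define n where "n = real (card V)"
  have n: "n > 0" using card_V_pos by (simp add: n_def)
  have t: "\<tau>\<^sup>2 \<le> \<tau> / 2" using \<tau> by (simp add: power2_eq_square)
  then have "\<tau>\<^sup>2 / 16 < 1 / 3" using \<tau> by linarith
  then have "(1 / 3 - \<tau>\<^sup>2 / 16) * n > 0" using n by simp
  then have "A \<noteq> {}" using big by (auto simp: n_def)
  obtain \<xi> where \<xi>: "\<xi> \<in> V - {0}" and small: "card (A \<inter> slice \<xi> 0) \<le> \<tau>\<^sup>2 / 16 * n"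
    using ex_slice_0_small[OF A \<open>A \<noteq> {}\<close> _ big] by (auto simp: n_def)
  define a0 a1 a2 where "a0 = card (A \<inter> slice \<xi> 0)" "a1 = card (A \<inter> slice \<xi> 1)" "a2 = card (A \<inter> slice \<xi> 2)"
  note defs = this
  have fin: "finite A" using A finite_V finite_subset by blast
  have Aeq: "A = (A \<inter> slice \<xi> 0) \<union> (A \<inter> slice \<xi> 1) \<union> (A \<inter> slice \<xi> 2)"
    using V_eq_slices[of \<xi>] A by blast
  have "card A = card ((A \<inter> slice \<xi> 0) \<union> (A \<inter> slice \<xi> 1) \<union> (A \<inter> slice \<xi> 2))"
    using Aeq by simp
  also have "\<dots> \<le> a0 + a1 + a2" by (simp add: defs) (meson add_mono card_Un_le le_refl order_trans)
  finally have tot: "real a1 + a2 \<ge> (1 / 3 - \<tau>\<^sup>2 / 8) * n"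
    using big small by (simp add: defs n_def algebra_simps)
  have neg: "- \<xi> \<in> V - {0}" "hyp (- \<xi>) = slice \<xi> 2" "slice (- \<xi>) 2 = slice \<xi> 1"
    using \<xi> neg_V by (simp_all add: slice_uminus neg_one_three)
  have sub: "A - slice \<xi> 1 \<subseteq> (A \<inter> slice \<xi> 0) \<union> (A \<inter> slice \<xi> 2)"
     "A - slice \<xi> 2 \<subseteq> (A \<inter> slice \<xi> 0) \<union> (A \<inter> slice \<xi> 1)"
    using Aeq by blast+
  have c: "card (A - slice \<xi> 1) \<le> a0 + a2" "card (A - slice \<xi> 2) \<le> a0 + a1"
    unfolding defs using card_mono[OF _ sub(1)] card_mono[OF _ sub(2)] fin card_Un_le
    by (meson finite_Int finite_Un order_trans)+
  have "\<tau>\<^sup>2 / 16 * n \<le> \<tau> / 2 * n" using t \<tau> n by (intro mult_right_mono) auto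
  then have a0: "real a0 \<le> \<tau> / 2 * n" using small unfolding defs by linarith
  consider "real a1 \<le> \<tau> / 2 * n" | "real a2 \<le> \<tau> / 2 * n" | "real a1 > \<tau> / 2 * n" "real a2 > \<tau> / 2 * n"
    by linarith
  then show ?thesis
  proof cases
    case 1
    then have "card (A - slice \<xi> 2) \<le> \<tau> * n" using a0 c(2) by simp
    then show ?thesis using neg by (metis n_def)
  next
    case 2
    then have "card (A - slice \<xi> 1) \<le> \<tau> * n" using a0 c(1) by simp
    then show ?thesis using \<xi> by (auto simp: n_def)
  next
    case 3
    have "9 * a1 \<le> card V"
      using side_small[OF A \<tau>, of \<xi>] \<xi> 3 tot by (simp add: defs n_def)
    moreover have "9 * a2 \<le> card V"
      using side_small[OF A \<tau>, of "- \<xi>"] neg 3 tot by (simp add: defs n_def add.commute)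
    ultimately have "real a1 + a2 \<le> 2 / 9 * n" by (simp add: n_def)
    moreover have "2 / 9 < 1 / 3 - \<tau>\<^sup>2 / 8" using t \<tau> by linarith
    then have "2 / 9 * n < (1 / 3 - \<tau>\<^sup>2 / 8) * n" using n by (rule mult_strict_right_mono)
    ultimately show ?thesis using tot by linarith
  qed
qed

end

section \<open>Link graphs and the upper bound\<close>

text \<open>A vertex of \<open>R\<close> has only two neighbours in \<open>R\<close>, so outside
  \<open>X\<close> one of its three distinct images under \<open>f\<close>, \<open>g\<close>,
  \<open>h\<close> leaves \<open>R\<close>. By injectivity each map sends at most
  \<open>card (H - R)\<close> vertices of \<open>R\<close> out of \<open>R\<close>, whence
  \<open>card R \<le> 3 + 3 * (card H - card R)\<close>.\<close>

lemma triangles_card_le: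
  assumes fin: "finite H" "finite X" "card X \<le> 3" and R: "R \<subseteq> H" "triangles E R"
    and f: "inj_on f H" "f ` H \<subseteq> H" and g: "inj_on g H" "g ` H \<subseteq> H" and h: "inj_on h H" "h ` H \<subseteq> H"
    and E: "\<And>x. x \<in> H - X \<Longrightarrow> E x (f x) \<and> E x (g x) \<and> E x (h x) \<and> distinct [f x, g x, h x]"
  shows "4 * card R \<le> 3 * card H + 3"
proof -
  have finR: "finite R" using R(1) fin(1) finite_subset by blast
  let ?L = "\<lambda>f. {x \<in> R. f x \<notin> R}"
  have le: "card (?L f) \<le> card (H - R)" if "inj_on f H" "f ` H \<subseteq> H" for f
  proof (rule card_inj_on_le[of f])
    show "inj_on f (?L f)" using that(1) R(1) by (auto intro: inj_on_subset)
    show "f ` ?L f \<subseteq> H - R" using that(2) R(1) by auto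
  qed (use fin in auto)
  have "R \<subseteq> X \<union> ?L f \<union> ?L g \<union> ?L h"
  proof
    fix x assume x: "x \<in> R"
    show "x \<in> X \<union> ?L f \<union> ?L g \<union> ?L h"
    proof (rule ccontr)
      assume *: "x \<notin> X \<union> ?L f \<union> ?L g \<union> ?L h"
      obtain u w where "nbrs E R x = {u, w}" using R(2) x unfolding triangles_def by blast
      moreover have "{f x, g x, h x} \<subseteq> nbrs E R x"
        using * x E[of x] R(1) by (auto simp: nbrs_def)
      ultimately have "card {f x, g x, h x} \<le> card {u, w}" by (metis card_mono finite.emptyI finite.insertI)
      also have "\<dots> \<le> 2" by (simp add: card_insert_if)
      finally show False using E[of x] * x R(1) by (auto simp: card_insert_if split: if_splits)
    qed
  qed
  then have "card R \<le> card (X \<union> ?L f \<union> ?L g \<union> ?L h)"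
    using fin finR by (intro card_mono) auto
  also have "\<dots> \<le> card X + card (?L f) + card (?L g) + card (?L h)"
    by (meson add_mono card_Un_le le_refl order_trans)
  also have "\<dots> \<le> 3 + card (H - R) + card (H - R) + card (H - R)"
    using le[OF f] le[OF g] le[OF h] fin(3) by linarith
  also have "card (H - R) = card H - card R" using R(1) finR by (rule card_Diff_subset[rotated])
  finally show ?thesis using card_mono[OF fin(1) R(1)] by linarith
qed

lemma card_UN_le_bound:
  fixes b :: real
  assumes "finite I" "\<And>i. i \<in> I \<Longrightarrow> real (card (X i)) \<le> b"
  shows "real (card (\<Union>i\<in>I. X i)) \<le> card I * b"
proof -
  have "real (card (\<Union>i\<in>I. X i)) \<le> real (\<Sum>i\<in>I. card (X i))"
    using card_UN_le[OF assms(1), of X] by (simp only: of_nat_le_iff)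
  also have "\<dots> \<le> (\<Sum>i\<in>I. b)" unfolding of_nat_sum by (intro sum_mono assms)
  finally show ?thesis by simp
qed

lemma sum_Pow_power_card:
  fixes x :: "'a::comm_semiring_1"
  assumes "finite A"
  shows "(\<Sum>T\<in>Pow A. x ^ card T) = (1 + x) ^ card A"
  using prod_add[OF assms, of "\<lambda>_. x" "\<lambda>_. 1"] by (simp add: add.commute)

text \<open>Exponential weighting: each counted \<open>T\<close> has weight
  \<open>x powr (card T - t)\<close>, which is at least 1 because \<open>x \<le> 1\<close>, and the
  weights of all subsets sum to a binomial expansion.\<close>

lemma card_small_subsets_le:
  fixes x t :: real
  assumes "finite A" "0 < x" "x \<le> 1"
  shows "card {T. T \<subseteq> A \<and> card T \<le> t} \<le> (1 + x) ^ card A * x powr (- t)"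
proof -
  have "real (card {T. T \<subseteq> A \<and> card T \<le> t}) = (\<Sum>T | T \<subseteq> A \<and> card T \<le> t. 1)" by simp
  also have "\<dots> \<le> (\<Sum>T | T \<subseteq> A \<and> card T \<le> t. x ^ card T * x powr (- t))"
  proof (rule sum_mono)
    fix T assume T: "T \<in> {T. T \<subseteq> A \<and> real (card T) \<le> t}"
    have "(1::real) = x powr 0" using assms by simp
    also have "\<dots> \<le> x powr (card T - t)"
      using assms T by (intro powr_mono') auto
    also have "\<dots> = x ^ card T * x powr (- t)"
      using assms by (simp add: powr_diff powr_minus powr_realpow divide_inverse)
    finally show "1 \<le> x ^ card T * x powr (- t)" .
  qed
  also have "\<dots> \<le> (\<Sum>T\<in>Pow A. x ^ card T * x powr (- t))"
    using assms by (intro sum_mono2) auto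
  also have "\<dots> = (1 + x) ^ card A * x powr (- t)"
    using sum_Pow_power_card[OF assms(1), of x] by (simp flip: sum_distrib_right)
  finally show ?thesis .
qed

context ternary_space
begin

text \<open>Maximality tested by adding one element; this agrees with maximality under inclusion
  because subsets of sum-free sets are sum-free.\<close>

definition msf :: "'v set \<Rightarrow> bool" where
  "msf A \<longleftrightarrow> A \<subseteq> V \<and> sumfree A \<and> (\<forall>y\<in>V - A. \<not> sumfree (insert y A))"

definition link :: "'v set \<Rightarrow> 'v \<Rightarrow> 'v \<Rightarrow> bool" where
  "link T x y \<longleftrightarrow> x \<noteq> y \<and> (\<exists>s\<in>T. x + s = y \<or> y + s = x \<or> x + y = s)"

text \<open>Points that already form a Schur triple with \<open>T\<close>, possibly with repetition,
  would carry loops in the link graph. They cannot belong to \<open>A\<close> and nothing else has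
  to block them, so they are removed from the vertex set.\<close>

definition avail :: "'v set \<Rightarrow> 'v set \<Rightarrow> 'v set" where
  "avail F T = {x \<in> F. sumfree (insert x T)}"

lemma symp_link: "symp (link T)"
  by (auto simp: symp_def link_def add.commute)

lemma irreflp_link: "irreflp (link T)"
  by (auto simp: irreflp_def link_def)

lemma sumfree_subset: "sumfree B \<Longrightarrow> A \<subseteq> B \<Longrightarrow> sumfree (A :: 'v set)"
  by (auto simp: sumfree_def)

text \<open>A Schur triple that blocks an available \<open>v\<close> contains \<open>v\<close>. It
  also contains an element of \<open>A \<inter> F\<close>, since \<open>v\<close> is compatible with
  \<open>A - F\<close>, and an element of \<open>A - F\<close>, since \<open>F\<close> is sum-free.
  It is therefore an edge of the link graph from \<open>v\<close> into
  \<open>A \<inter> F\<close>.\<close>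

lemma msf_trace_mis:
  assumes "F \<subseteq> V" "sumfree F" "msf A"
  shows "A \<inter> F \<in> mis (link (A - F)) (avail F (A - F))"
  unfolding mis_def
proof (intro CollectI conjI ballI)
  have A: "A \<subseteq> V" "sumfree A" using assms(3) by (auto simp: msf_def)
  show "A \<inter> F \<subseteq> avail F (A - F)"
    using A(2) by (auto simp: avail_def intro: sumfree_subset)
  show "\<not> link (A - F) x y" if "x \<in> A \<inter> F" "y \<in> A \<inter> F" for x y
    using that A(2) by (auto simp: link_def sumfree_def)
  fix v assume v: "v \<in> avail F (A - F) - A \<inter> F"
  then have vF: "v \<in> F" "v \<notin> A" "sumfree (insert v (A - F))" by (auto simp: avail_def)
  then have "\<not> sumfree (insert v A)" using assms by (auto simp: msf_def)
  then obtain p q where pqr: "p \<in> insert v A" "q \<in> insert v A" "p + q \<in> insert v A"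
    unfolding sumfree_def by blast
  have "p = v \<or> q = v \<or> p + q = v"
    using pqr A(2) unfolding sumfree_def by blast
  moreover have "p \<in> A \<inter> F \<or> q \<in> A \<inter> F \<or> p + q \<in> A \<inter> F"
    using pqr vF unfolding sumfree_def by blast
  moreover have "p \<in> A - F \<or> q \<in> A - F \<or> p + q \<in> A - F"
  proof (rule ccontr)
    assume "\<not> ?thesis"
    then have "p \<in> F" "q \<in> F" "p + q \<in> F" using pqr vF(1) by auto
    then show False using assms(2) by (simp add: sumfree_def)
  qed
  ultimately show "\<exists>u\<in>A \<inter> F. link (A - F) v u"
    using vF(2) unfolding link_def by (metis DiffD1 DiffD2 IntD1 IntD2 add.commute)
qed

lemma finite_msf: "finite {A. msf A \<and> P A}"
  by (rule finite_subset[of _ "Pow V"]) (auto simp: msf_def finite_V)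

lemma finite_avail: "F \<subseteq> V \<Longrightarrow> finite (avail F T)"
  using finite_V by (auto simp: avail_def intro: finite_subset)

lemma card_msf_trace_le:
  assumes "F \<subseteq> V" "sumfree F"
  shows "card {A. msf A \<and> A - F = T} \<le> card (mis (link T) (avail F T))"
proof (rule card_inj_on_le)
  show "inj_on (\<lambda>A. A \<inter> F) {A. msf A \<and> A - F = T}"
  proof (rule inj_onI)
    fix A B assume "A \<in> {A. msf A \<and> A - F = T}" "B \<in> {A. msf A \<and> A - F = T}" "A \<inter> F = B \<inter> F"
    then show "A = B" using Un_Diff_Int[of A F] Un_Diff_Int[of B F] by simp
  qed
  show "(\<lambda>A. A \<inter> F) ` {A. msf A \<and> A - F = T} \<subseteq> mis (link T) (avail F T)"
    using msf_trace_mis[OF assms] by auto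
  show "finite (mis (link T) (avail F T))"
    by (intro finite_mis finite_avail assms)
qed

lemma card_avail_le: "F \<subseteq> V \<Longrightarrow> card (avail F T) \<le> card F"
  using finite_V by (intro card_mono) (auto simp: avail_def intro: finite_subset)

lemma card_msf_trace_le_cube_root:
  assumes "F \<subseteq> V" "sumfree F"
  shows "card {A. msf A \<and> A - F = T} \<le> 3 powr (card F / 3)"
proof -
  have "real (card {A. msf A \<and> A - F = T}) \<le> card (mis (link T) (avail F T))"
    using card_msf_trace_le[OF assms] by simp
  also have "\<dots> \<le> 3 powr (card (avail F T) / 3)"
    by (intro card_mis_le_cube_root symp_link irreflp_link finite_avail assms)
  also have "\<dots> \<le> 3 powr (card F / 3)"
    using card_avail_le[OF assms(1), of T] by simp
  finally show ?thesis .
qed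

lemma card_msf_trace_le_gain:
  assumes "F \<subseteq> V" "sumfree F" "\<And>R. R \<subseteq> F \<Longrightarrow> triangles (link T) R \<Longrightarrow> card R \<le> r"
  shows "card {A. msf A \<and> A - F = T} \<le> mis_base ^ card F * mis_gain ^ r"
proof -
  have "real (card {A. msf A \<and> A - F = T}) \<le> card (mis (link T) (avail F T))"
    using card_msf_trace_le[OF assms(1,2)] by simp
  also have "\<dots> \<le> mis_base ^ card (avail F T) * mis_gain ^ r"
    using assms by (intro card_mis_le symp_link irreflp_link finite_avail) (auto simp: avail_def)
  also have "\<dots> \<le> mis_base ^ card F * mis_gain ^ r"
    using card_avail_le[OF assms(1), of T] mis_gain_gt_1
    by (intro mult_right_mono power_increasing) (auto simp: mis_base_def)
  finally show ?thesis .
qed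

section \<open>Counting maximal sum-free sets near a given sum-free set\<close>

definition small_sets :: "real \<Rightarrow> 'v set set" where
  "small_sets t = {T. T \<subseteq> V \<and> real (card T) \<le> t}"

lemma finite_small_sets: "finite (small_sets t)"
  by (rule finite_subset[of _ "Pow V"]) (auto simp: small_sets_def finite_V)

lemma card_msf_near_small:
  fixes c t :: real
  assumes "finite \<F>"
  shows "card {A. msf A \<and> (\<exists>F\<in>\<F>. F \<subseteq> V \<and> sumfree F \<and> card F \<le> c \<and> card (A - F) \<le> t)}
    \<le> card \<F> * (card (small_sets t) * 3 powr (c / 3))" (is "real (card ?M) \<le> _")
proof -
  let ?X = "\<lambda>F T. if F \<subseteq> V \<and> sumfree F \<and> card F \<le> c then {A. msf A \<and> A - F = T} else {}"
  have 1: "real (card (?X F T)) \<le> 3 powr (c / 3)" for F T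
  proof (cases "F \<subseteq> V \<and> sumfree F \<and> card F \<le> c")
    case True
    then have "real (card (?X F T)) \<le> 3 powr (card F / 3)"
      using card_msf_trace_le_cube_root[of F T] by simp
    also have "\<dots> \<le> 3 powr (c / 3)" using True by simp
    finally show ?thesis .
  next
    case False
    then show ?thesis by (simp only: if_False) simp
  qed
  have "?M \<subseteq> (\<Union>F\<in>\<F>. \<Union>T\<in>small_sets t. ?X F T)"
  proof
    fix A assume "A \<in> ?M"
    then obtain F where F: "F \<in> \<F>" "F \<subseteq> V \<and> sumfree F \<and> card F \<le> c" "card (A - F) \<le> t" "msf A"
      by blast
    then have "A - F \<in> small_sets t" "A \<in> ?X F (A - F)"
      by (auto simp: small_sets_def msf_def)
    then show "A \<in> (\<Union>F\<in>\<F>. \<Union>T\<in>small_sets t. ?X F T)"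
      using F(1) by (intro UN_I)
  qed
  then have "card ?M \<le> card (\<Union>F\<in>\<F>. \<Union>T\<in>small_sets t. ?X F T)"
    using assms finite_small_sets finite_msf by (intro card_mono) auto
  moreover have "real (card (\<Union>F\<in>\<F>. \<Union>T\<in>small_sets t. ?X F T)) \<le> card \<F> * (card (small_sets t) * 3 powr (c / 3))"
    by (intro card_UN_le_bound assms finite_small_sets 1)
  ultimately show ?thesis by linarith
qed

section \<open>Link graphs on an affine hyperplane\<close>

lemma double_eq_iff: "x + x = y \<longleftrightarrow> x = - (y :: 'v)"
  by (metis double_eq minus_minus)

text \<open>An element \<open>s\<close> of the kernel links \<open>x\<close> to \<open>x + s\<close>
  and \<open>x - s\<close>, an element \<open>t\<close> of \<open>slice \<xi> 2\<close> links it to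
  \<open>t - x\<close>. In each configuration allowed here three of these maps give distinct
  neighbours, with at most three exceptional \<open>x\<close>. The hypotheses exclude exactly a
  single kernel element and at most two elements, possibly none, of
  \<open>slice \<xi> 2\<close>.\<close>

lemma triangles_link_hyp_le:
  assumes \<xi>: "\<xi> \<in> V" and T: "T \<subseteq> V" "sumfree T" "T \<inter> hyp \<xi> = {}"
    and n1: "\<And>s. T = {s} \<Longrightarrow> s \<notin> slice \<xi> 0" and n2: "T \<subseteq> slice \<xi> 2 \<Longrightarrow> card T \<ge> 3"
    and R: "R \<subseteq> hyp \<xi>" "triangles (link T) R"
  shows "4 * card R \<le> 3 * card (hyp \<xi>) + 3"
proof -
  have z: "0 \<notin> T" using T(2) by (force simp: sumfree_def)
  have finT: "finite T" using T(1) finite_V finite_subset by blast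
  have T02: "s \<in> slice \<xi> 0 \<or> s \<in> slice \<xi> 2" if "s \<in> T" for s
    using that T V_eq_slices[of \<xi>] by blast
  have plus: "inj_on (\<lambda>x. x + s) (hyp \<xi>)" "(\<lambda>x. x + s) ` hyp \<xi> \<subseteq> hyp \<xi>"
    and minus: "inj_on (\<lambda>x. x - s) (hyp \<xi>)" "(\<lambda>x. x - s) ` hyp \<xi> \<subseteq> hyp \<xi>" if "s \<in> slice \<xi> 0" for s
    using that by (auto simp: inj_on_def slice_def dot_add dot_diff add_V diff_V)
  have refl: "inj_on (\<lambda>x. s - x) (hyp \<xi>)" "(\<lambda>x. s - x) ` hyp \<xi> \<subseteq> hyp \<xi>" if "s \<in> slice \<xi> 2" for s
    using that by (auto simp: inj_on_def slice_def dot_add dot_diff add_V diff_V)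
  note bound = triangles_card_le[OF finite_slice _ _ R]
  consider s t where "s \<in> T" "t \<in> T" "s \<noteq> t" "s \<in> slice \<xi> 0" "t \<in> slice \<xi> 0"
    | s t where "s \<in> T" "t \<in> T" "s \<in> slice \<xi> 0" "t \<in> slice \<xi> 2"
    | "T \<subseteq> slice \<xi> 2"
  proof (cases "\<exists>s\<in>T. s \<in> slice \<xi> 0")
    case True
    then obtain s where s: "s \<in> T" "s \<in> slice \<xi> 0" by blast
    then obtain t where "t \<in> T" "t \<noteq> s" using n1[of s] by blast
    then show thesis using s T02[of t] that(1,2) by blast
  next
    case False
    then show thesis using T02 that(3) by blast
  qed
  then show ?thesis
  proof cases
    case (1 s t)
    have "s \<noteq> 0" "t \<noteq> 0" using 1 z by auto
    \<comment> \<open>In exponent 3 the element \<open>s + s\<close> is \<open>- s\<close>, so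
      sum-freeness of \<open>T\<close> keeps \<open>t\<close> away from \<open>- s\<close>, where
      \<open>x + t\<close> would coincide with \<open>x - s\<close>.\<close>
    have "s + s \<notin> T" using T(2) 1 by (auto simp: sumfree_def)
    then have "t \<noteq> - s" using 1 double_eq by metis
    moreover have "s \<noteq> - s" using \<open>s + s \<notin> T\<close> 1 double_eq by metis
    ultimately have "x + s \<noteq> x - s" "x + t \<noteq> x - s" for x
      by (metis add_left_imp_eq uminus_add_conv_diff add.commute)+
    then have "link T x (x + s) \<and> link T x (x - s) \<and> link T x (x + t) \<and> distinct [x + s, x - s, x + t]" for x
      using 1 \<open>s \<noteq> 0\<close> \<open>t \<noteq> 0\<close> by (auto simp: link_def)
    then show ?thesis
      using bound[of "{}" "\<lambda>x. x + s" "\<lambda>x. x - s" "\<lambda>x. x + t"] plus minus 1 by simp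
  next
    case (2 s t)
    have "s \<noteq> 0" using 2 z by auto
    have "s + s \<notin> T" using T(2) 2 by (auto simp: sumfree_def)
    then have "s \<noteq> - s" using 2 double_eq by metis
    then have "x + s \<noteq> x - s" for x
      by (metis add_left_imp_eq uminus_add_conv_diff add.commute)
    \<comment> \<open>The three exceptions solve \<open>t - x = x\<close>,
      \<open>t - x = x + s\<close> and \<open>t - x = x - s\<close>, using that doubling is
      negation.\<close>
    moreover have "t - x \<noteq> x" "t - x \<noteq> x + s" "t - x \<noteq> x - s" if "x \<notin> {- t, s - t, - s - t}" for x
      using that double_eq_iff[of x t] double_eq_iff[of x "t - s"] double_eq_iff[of x "t + s"]
      by (auto simp: algebra_simps)
    ultimately have "link T x (x + s) \<and> link T x (x - s) \<and> link T x (t - x) \<and> distinct [x + s, x - s, t - x]"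
      if "x \<notin> {- t, s - t, - s - t}" for x
      using 2 \<open>s \<noteq> 0\<close> that by (fastforce simp: link_def)
    moreover have "card {- t, s - t, - s - t} \<le> 3" by (simp add: card_insert_if)
    ultimately show ?thesis
      by (intro bound[of "{- t, s - t, - s - t}" "\<lambda>x. x + s" "\<lambda>x. x - s" "\<lambda>x. t - x"]
          plus[OF 2(3)] minus[OF 2(3)] refl[OF 2(4)]) (blast intro: finite.intros | simp)+
  next
    case 3
    obtain B where "B \<subseteq> T" "card B = 3" using n2[OF 3] by (metis obtain_subset_with_card_n)
    then obtain t u v where tuv: "t \<in> T" "u \<in> T" "v \<in> T" "t \<noteq> u" "t \<noteq> v" "u \<noteq> v"
      by (auto simp: card_3_iff)
    have "s - x \<noteq> x" if "x \<noteq> - s" for x s :: 'v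
      using that double_eq_iff[of x s] by (auto simp: algebra_simps)
    then have "link T x (t - x) \<and> link T x (u - x) \<and> link T x (v - x) \<and> distinct [t - x, u - x, v - x]"
      if "x \<notin> {- t, - u, - v}" for x
      using tuv that by (fastforce simp: link_def)
    moreover have "card {- t, - u, - v} \<le> 3" by (simp add: card_insert_if)
    moreover have "t \<in> slice \<xi> 2" "u \<in> slice \<xi> 2" "v \<in> slice \<xi> 2" using 3 tuv by auto
    ultimately show ?thesis
      by (intro bound[of "{- t, - u, - v}" "\<lambda>x. t - x" "\<lambda>x. u - x" "\<lambda>x. v - x"] refl)
         (assumption | blast intro: finite.intros | simp)+
  qed
qed

text \<open>The pair sums of a triangle are three distinct elements of \<open>T\<close>.\<close>

lemma no_triangles_link_hyp:
  assumes T: "T \<subseteq> slice \<xi> 2" "card T \<le> 2" and R: "R \<subseteq> hyp \<xi>" "triangles (link T) R"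
  shows "R = {}"
proof (rule ccontr)
  assume "R \<noteq> {}"
  then obtain x where x: "x \<in> R" by blast
  obtain y z where yz: "y \<noteq> z" "nbrs (link T) R x = {y, z}" "link T y z"
    using R(2) x unfolding triangles_def by blast
  have mem: "y \<in> R" "z \<in> R" "link T x y" "link T x z" using yz(2) by (auto simp: nbrs_def)
  have sums: "p + q \<in> T" "p \<noteq> q" if "link T p q" "p \<in> R" "q \<in> R" for p q
  proof -
    have "dot \<xi> p = 1" "dot \<xi> q = 1" using that R(1) by (auto simp: slice_def)
    moreover have "dot \<xi> s = 2" if "s \<in> T" for s using that T(1) by (auto simp: slice_def)
    ultimately show "p + q \<in> T" "p \<noteq> q"
      using that(1) unfolding link_def by (auto simp: dot_add)
  qed
  have "x + y \<in> T" "x + z \<in> T" "y + z \<in> T" "x \<noteq> y" "x \<noteq> z"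
    using sums mem x yz(3) by auto
  then have "card {x + y, x + z, y + z} \<le> card T"
    using finite_subset[OF T(1) finite_slice] by (intro card_mono) auto
  moreover have "card {x + y, x + z, y + z} = 3"
    using \<open>x \<noteq> y\<close> \<open>x \<noteq> z\<close> yz(1) by (simp add: card_insert_if)
  ultimately show False using T(2) by simp
qed

lemma card_pairs_le: "card {T. T \<subseteq> slice \<xi> 2 \<and> card T \<le> 2} \<le> card V ^ 2 + 1"
proof -
  have "{T. T \<subseteq> slice \<xi> 2 \<and> card T \<le> 2} \<subseteq> insert {} ((\<lambda>(x, y). {x, y}) ` (V \<times> V))"
  proof
    fix T assume "T \<in> {T. T \<subseteq> slice \<xi> 2 \<and> card T \<le> 2}"
    then have T: "T \<subseteq> V" "finite T" "card T \<le> 2"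
      using subset_trans[OF _ slice_subset] finite_subset[OF _ finite_slice] by auto
    have "card T = 0 \<or> card T = 1 \<or> card T = 2" using T(3) by linarith
    then consider "T = {}" | "card T = 1" | "card T = 2" using T(2) by auto
    then show "T \<in> insert {} ((\<lambda>(x, y). {x, y}) ` (V \<times> V))"
    proof cases
      case 2
      then obtain x where "T = {x}" by (auto simp: card_1_singleton_iff)
      then show ?thesis using T(1) by (auto intro!: image_eqI[of _ _ "(x, x)"])
    next
      case 3
      then obtain x y where "T = {x, y}" by (auto simp: card_2_iff)
      then show ?thesis using T(1) by (auto intro!: image_eqI[of _ _ "(x, y)"])
    qed simp
  qed
  then have "card {T. T \<subseteq> slice \<xi> 2 \<and> card T \<le> 2} \<le> card (insert {} ((\<lambda>(x, y). {x, y}) ` (V \<times> V)))"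
    using finite_V by (intro card_mono) auto
  also have "\<dots> \<le> card (V \<times> V) + 1"
    using finite_V card_image_le[of "V \<times> V" "\<lambda>(x, y). {x, y}"] by (simp add: card_insert_if)
  finally show ?thesis by (simp add: card_cartesian_product power2_eq_square)
qed

text \<open>The summands correspond to the possible \<open>T = A - hyp \<xi>\<close>: a single
  nonzero kernel element, with the full bound \<open>3 powr (m / 3)\<close>; at most two elements of
  \<open>slice \<xi> 2\<close>, polynomially many choices with no triangles at all; and all others,
  where triangles cover little more than three quarters of the hyperplane at best.\<close>

lemma card_msf_near_hyp:
  fixes t :: real
  assumes \<xi>: "\<xi> \<in> V" "\<xi> \<noteq> 0"
  defines "m \<equiv> card (hyp \<xi>)"
  shows "card {A. msf A \<and> card (A - hyp \<xi>) \<le> t}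
    \<le> (real m - 1) * 3 powr (m / 3) + ((real (card V))\<^sup>2 + 1) * mis_base ^ m
      + card (small_sets t) * (mis_base ^ m * mis_gain ^ ((3 * m + 3) div 4))" (is "real (card ?M) \<le> _")
proof -
  let ?H = "hyp \<xi>"
  let ?X = "\<lambda>T. {A. msf A \<and> A - ?H = T}"
  let ?S1 = "(\<lambda>s. {s}) ` (slice \<xi> 0 - {0})"
  let ?S2 = "{T. T \<subseteq> slice \<xi> 2 \<and> card T \<le> 2}"
  let ?S3 = "{T \<in> small_sets t. sumfree T \<and> T \<inter> ?H = {} \<and> T \<notin> ?S1 \<and> T \<notin> ?S2}"
  have fin: "finite ?S1" "finite ?S2" "finite ?S3"
    using finite_slice finite_small_sets by auto
  have sub: "?M \<subseteq> (\<Union>T\<in>?S1. ?X T) \<union> (\<Union>T\<in>?S2. ?X T) \<union> (\<Union>T\<in>?S3. ?X T)"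
  proof
    fix A assume A: "A \<in> ?M"
    then have "A - ?H \<in> small_sets t" "sumfree (A - ?H)" "(A - ?H) \<inter> ?H = {}" "A \<in> ?X (A - ?H)"
      by (auto simp: small_sets_def msf_def intro: sumfree_subset)
    moreover have "A - ?H \<in> ?S1 \<or> A - ?H \<in> ?S2 \<or> A - ?H \<in> ?S3"
      using calculation by (simp only: mem_Collect_eq) argo
    ultimately show "A \<in> (\<Union>T\<in>?S1. ?X T) \<union> (\<Union>T\<in>?S2. ?X T) \<union> (\<Union>T\<in>?S3. ?X T)"
      by (meson UN_I UnI1 UnI2)
  qed
  have "card ?M \<le> card ((\<Union>T\<in>?S1. ?X T) \<union> (\<Union>T\<in>?S2. ?X T) \<union> (\<Union>T\<in>?S3. ?X T))"
    by (intro card_mono[OF _ sub] finite_UnI finite_UN_I fin finite_msf)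
  also have "\<dots> \<le> card (\<Union>T\<in>?S1. ?X T) + card (\<Union>T\<in>?S2. ?X T) + card (\<Union>T\<in>?S3. ?X T)"
    by (meson add_mono card_Un_le le_refl order_trans)
  finally have le: "real (card ?M) \<le> real (card (\<Union>T\<in>?S1. ?X T)) + card (\<Union>T\<in>?S2. ?X T) + card (\<Union>T\<in>?S3. ?X T)"
    by linarith
  have "real (card (\<Union>T\<in>?S1. ?X T)) \<le> card ?S1 * 3 powr (m / 3)"
    unfolding m_def by (intro card_UN_le_bound fin card_msf_trace_le_cube_root slice_subset sumfree_hyp)
  moreover have "real (card ?S1) = real m - 1"
  proof -
    have "card ?S1 = card (slice \<xi> 0 - {0})" by (rule card_image) simp
    also have "\<dots> = card (slice \<xi> 0) - 1"
      using finite_slice zero_V by (simp add: slice_def)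
    finally have "card ?S1 = m - 1" using card_slice[OF \<xi>, of 0] card_slice[OF \<xi>, of 1] by (simp add: m_def)
    moreover have "m \<ge> 1" using card_slice[OF \<xi>, of 1] card_V_pos by (simp add: m_def)
    ultimately show ?thesis by simp
  qed
  moreover have "real (card (\<Union>T\<in>?S2. ?X T)) \<le> card ?S2 * mis_base ^ m"
  proof (intro card_UN_le_bound fin)
    fix T assume "T \<in> ?S2"
    then have T: "T \<subseteq> slice \<xi> 2" "card T \<le> 2" by auto
    have "card R \<le> 0" if "R \<subseteq> ?H" "triangles (link T) R" for R
      using no_triangles_link_hyp[OF T that] by simp
    then have "real (card (?X T)) \<le> mis_base ^ card ?H * mis_gain ^ 0"
      by (intro card_msf_trace_le_gain slice_subset sumfree_hyp)
    then show "real (card (?X T)) \<le> mis_base ^ m" by (simp add: m_def)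
  qed
  moreover have "card ?S2 * mis_base ^ m \<le> ((real (card V))\<^sup>2 + 1) * mis_base ^ m"
  proof (rule mult_right_mono)
    have "real (card ?S2) \<le> real (card V ^ 2 + 1)"
      using card_pairs_le[of \<xi>] by (simp only: of_nat_le_iff)
    then show "real (card ?S2) \<le> (real (card V))\<^sup>2 + 1" by simp
  qed (simp add: mis_base_def)
  moreover have "real (card (\<Union>T\<in>?S3. ?X T)) \<le> card ?S3 * (mis_base ^ m * mis_gain ^ ((3 * m + 3) div 4))"
  proof (intro card_UN_le_bound fin)
    fix T assume T: "T \<in> ?S3"
    \<comment> \<open>\<open>?S1\<close> leaves out \<open>{0}\<close>, so that singleton has to be
      ruled out by sum-freeness.\<close>
    then have "0 \<notin> T" by (force simp: sumfree_def)
    have "card R \<le> (3 * m + 3) div 4" if "R \<subseteq> ?H" "triangles (link T) R" for R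
    proof -
      have "4 * card R \<le> 3 * card ?H + 3"
        using T \<open>0 \<notin> T\<close> that by (intro triangles_link_hyp_le[OF \<xi>(1)]) (auto simp: small_sets_def)
      then show ?thesis by (simp add: m_def)
    qed
    then show "real (card (?X T)) \<le> mis_base ^ m * mis_gain ^ ((3 * m + 3) div 4)"
      unfolding m_def by (intro card_msf_trace_le_gain slice_subset sumfree_hyp) auto
  qed
  moreover have "card ?S3 * (mis_base ^ m * mis_gain ^ ((3 * m + 3) div 4)) \<le> card (small_sets t) * (mis_base ^ m * mis_gain ^ ((3 * m + 3) div 4))"
    using finite_small_sets mis_gain_gt_1 by (intro mult_right_mono) (auto simp: mis_base_def intro!: card_mono)
  moreover note le
  ultimately show ?thesis by (smt (verit))
qed

text \<open>The dichotomy is on the size of the regular approximation \<open>F\<close>. When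
  \<open>F\<close> is near a hyperplane, the errors \<open>card (A - F)\<close> and
  \<open>card (F - hyp \<xi>)\<close> add up to the threshold
  \<open>(\<tau> + 2 * \<delta>) * n\<close>.\<close>

theorem card_msf_upper:
  fixes \<delta> \<tau> :: real
  assumes \<delta>: "\<delta> > 0" "real j * \<delta> ^ 5 > 1" and \<tau>: "0 < \<tau>" "\<tau> \<le> 1 / 2" and m: "card V = 3 * m"
  defines "n \<equiv> real (card V)"
  shows "card {A. msf A} \<le>
    (n - 1) * ((real m - 1) * 3 powr (m / 3) + (n\<^sup>2 + 1) * mis_base ^ m
        + card (small_sets ((\<tau> + 2 * \<delta>) * n)) * (mis_base ^ m * mis_gain ^ ((3 * m + 3) div 4)))
    + n ^ tower j * 2 ^ 3 ^ tower j * (card (small_sets (2 * \<delta> * n)) * 3 powr ((1 / 3 - \<tau>\<^sup>2 / 16) * n / 3))"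
proof -
  let ?c = "(1 / 3 - \<tau>\<^sup>2 / 16) * n"
  let ?I = "invariant_sets (tower j)"
  let ?N = "{A. msf A \<and> (\<exists>F\<in>?I. F \<subseteq> V \<and> sumfree F \<and> card F \<le> ?c \<and> card (A - F) \<le> 2 * \<delta> * n)}"
  let ?M = "\<lambda>\<xi>. {A. msf A \<and> card (A - hyp \<xi>) \<le> (\<tau> + 2 * \<delta>) * n}"
  let ?b = "(real m - 1) * 3 powr (m / 3) + (n\<^sup>2 + 1) * mis_base ^ m
        + card (small_sets ((\<tau> + 2 * \<delta>) * n)) * (mis_base ^ m * mis_gain ^ ((3 * m + 3) div 4))"
  have finI: "finite ?I"
    by (rule finite_subset[of _ "Pow V"]) (auto simp: invariant_sets_def finite_V)
  have sub: "{A. msf A} \<subseteq> (\<Union>\<xi>\<in>V - {0}. ?M \<xi>) \<union> ?N"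
  proof
    fix A assume "A \<in> {A. msf A}"
    then have A: "msf A" "A \<subseteq> V" "sumfree A" by (auto simp: msf_def)
    obtain F where F: "F \<in> ?I" "sumfree F" "card (A - F) \<le> 2 * \<delta> * n"
      using regularity[OF A(2,3) \<delta>] by (auto simp: n_def)
    have FV: "F \<subseteq> V" using F(1) by (auto simp: invariant_sets_def)
    show "A \<in> (\<Union>\<xi>\<in>V - {0}. ?M \<xi>) \<union> ?N"
    proof (cases "card F \<le> ?c")
      case True
      then show ?thesis using A F FV by blast
    next
      case False
      then obtain \<xi> where \<xi>: "\<xi> \<in> V - {0}" "card (F - hyp \<xi>) \<le> \<tau> * n"
        using stability[OF FV F(2) \<tau>] by (auto simp: n_def)
      have "card (A - hyp \<xi>) \<le> card ((A - F) \<union> (F - hyp \<xi>))"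
        using A(2) FV finite_V by (intro card_mono) (auto intro: finite_subset)
      also have "\<dots> \<le> card (A - F) + card (F - hyp \<xi>)" by (rule card_Un_le)
      finally have "card (A - hyp \<xi>) \<le> (\<tau> + 2 * \<delta>) * n"
        using F(3) \<xi>(2) by (simp add: algebra_simps)
      then show ?thesis using A(1) \<xi>(1) by blast
    qed
  qed
  have "card {A. msf A} \<le> card ((\<Union>\<xi>\<in>V - {0}. ?M \<xi>) \<union> ?N)"
    using finite_V finite_msf by (intro card_mono[OF _ sub]) auto
  also have "\<dots> \<le> card (\<Union>\<xi>\<in>V - {0}. ?M \<xi>) + card ?N" by (rule card_Un_le)
  finally have le: "real (card {A. msf A}) \<le> real (card (\<Union>\<xi>\<in>V - {0}. ?M \<xi>)) + card ?N" by linarith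
  have "real (card (\<Union>\<xi>\<in>V - {0}. ?M \<xi>)) \<le> card (V - {0}) * ?b"
  proof (rule card_UN_le_bound)
    fix \<xi> assume \<xi>: "\<xi> \<in> V - {0}"
    then have "card (hyp \<xi>) = m" using card_slice[of \<xi> 1] m by simp
    moreover have "m \<ge> 1" using m card_V_pos by simp
    ultimately show "real (card (?M \<xi>)) \<le> ?b"
      using card_msf_near_hyp[of \<xi> "(\<tau> + 2 * \<delta>) * n"] \<xi> by (simp add: n_def add.commute)
  qed (use finite_V in simp)
  moreover have "real (card (V - {0})) = n - 1"
    using finite_V zero_V card_V_pos by (simp add: n_def of_nat_diff)
  moreover have "real (card ?N) \<le> card ?I * (card (small_sets (2 * \<delta> * n)) * 3 powr (?c / 3))"
    by (rule card_msf_near_small[OF finI])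
  moreover have "card ?I * (card (small_sets (2 * \<delta> * n)) * 3 powr (?c / 3))
      \<le> n ^ tower j * 2 ^ 3 ^ tower j * (card (small_sets (2 * \<delta> * n)) * 3 powr (?c / 3))"
  proof (rule mult_right_mono)
    have "real (card ?I) \<le> real (card V ^ tower j * 2 ^ 3 ^ tower j)"
      using card_invariant_sets[of "tower j"] by (simp only: of_nat_le_iff)
    then show "real (card ?I) \<le> n ^ tower j * 2 ^ 3 ^ tower j" by (simp add: n_def)
  qed simp
  ultimately show ?thesis using le by simp
qed

end

section \<open>The lower bound\<close>

text \<open>Choice functions on \<open>P\<close> are mapped to their images; disjointness of the
  blocks recovers the function from the image.\<close>

lemma card_transversals_ge:
  assumes fin: "finite P" and disj: "pairwise disjnt P" and card: "\<And>B. B \<in> P \<Longrightarrow> card B = c" and c: "c > 0"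
  shows "c ^ card P \<le> card {I. I \<subseteq> \<Union>P \<and> (\<forall>B\<in>P. \<exists>!y. y \<in> B \<and> y \<in> I)}"
proof -
  have finB: "finite B" if "B \<in> P" for B using card[OF that] c by (metis card.infinite less_irrefl)
  have uniq: "B = C" if "B \<in> P" "C \<in> P" "y \<in> B" "y \<in> C" for B C y
    using disj that unfolding pairwise_def disjnt_def by blast
  have img: "f ` P \<inter> B = {f B}" if "f \<in> (\<Pi>\<^sub>E B\<in>P. B)" "B \<in> P" for f B
  proof -
    have "f C \<in> C" if "C \<in> P" for C using \<open>f \<in> _\<close> that by (auto simp: PiE_iff)
    then show ?thesis using uniq that(2) by blast
  qed
  have "c ^ card P = card (\<Pi>\<^sub>E B\<in>P. B)"
    using fin card by (simp add: card_PiE)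
  also have "\<dots> \<le> card {I. I \<subseteq> \<Union>P \<and> (\<forall>B\<in>P. \<exists>!y. y \<in> B \<and> y \<in> I)}"
  proof (rule card_inj_on_le[of "\<lambda>f. f ` P"])
    show "inj_on (\<lambda>f. f ` P) (\<Pi>\<^sub>E B\<in>P. B)"
    proof (rule inj_onI)
      fix f g assume fg: "f \<in> (\<Pi>\<^sub>E B\<in>P. B)" "g \<in> (\<Pi>\<^sub>E B\<in>P. B)" "f ` P = g ` P"
      have "f B = g B" if "B \<in> P" for B
        using img[OF fg(1) that] img[OF fg(2) that] fg(3) by simp
      then show "f = g" using fg(1,2) by (intro PiE_ext) auto
    qed
    show "(\<lambda>f. f ` P) ` (\<Pi>\<^sub>E B\<in>P. B) \<subseteq> {I. I \<subseteq> \<Union>P \<and> (\<forall>B\<in>P. \<exists>!y. y \<in> B \<and> y \<in> I)}"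
    proof (rule image_subsetI)
      fix f assume f: "f \<in> (\<Pi>\<^sub>E B\<in>P. B)"
      have "f ` P \<subseteq> \<Union>P" using f by (auto simp: PiE_iff)
      moreover have "\<exists>!y. y \<in> B \<and> y \<in> f ` P" if "B \<in> P" for B
      proof -
        have "y \<in> B \<and> y \<in> f ` P \<longleftrightarrow> y = f B" for y
          using img[OF f that] by (metis IntD1 IntD2 IntI singletonD singletonI)
        then show ?thesis by simp
      qed
      ultimately show "f ` P \<in> {I. I \<subseteq> \<Union>P \<and> (\<forall>B\<in>P. \<exists>!y. y \<in> B \<and> y \<in> I)}" by blast
    qed
    show "finite {I. I \<subseteq> \<Union>P \<and> (\<forall>B\<in>P. \<exists>!y. y \<in> B \<and> y \<in> I)}"
      by (rule finite_subset[of _ "Pow (\<Union>P)"]) (use fin finB in auto)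
  qed
  finally show ?thesis .
qed

context ternary_space
begin

section \<open>Transversals of the cosets of a line\<close>

lemma subspace_line:
  assumes "s \<in> V"
  shows "subspace {0, s, - s}"
proof -
  have "s + s = - s" "- s - s = s" using double_eq[of s] double_eq[of "- s"] by simp_all
  then show ?thesis using assms by (auto simp: subspace_def zero_V neg_V)
qed

lemma neq_neg: "s \<noteq> 0 \<Longrightarrow> s \<noteq> - (s :: 'v)"
  using add_thrice[of s] double_eq[of s] by auto

lemma card_line_transversals:
  assumes \<xi>: "\<xi> \<in> V" and s: "s \<in> slice \<xi> 0" "s \<noteq> 0"
  defines "W \<equiv> {0, s, - s}"
  shows "3 powr (card (hyp \<xi>) / 3) \<le> card {I. I \<subseteq> hyp \<xi> \<and> (\<forall>x\<in>hyp \<xi>. \<exists>!y. y \<in> coset W x \<and> y \<in> I)}"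
proof -
  have sV: "s \<in> V" using s by (simp add: slice_def)
  note W = subspace_line[OF sV, folded W_def]
  have cW: "card W = 3" using s(2) neq_neg[OF s(2)] by (simp add: W_def)
  let ?P = "coset W ` hyp \<xi>"
  have WK: "W \<subseteq> slice \<xi> 0" using s(1) subspace_neg[OF subspace_slice_0 s(1)] by (auto simp: W_def slice_def zero_V)
  have cH: "coset W x \<subseteq> hyp \<xi>" if "x \<in> hyp \<xi>" for x
    using that WK by (auto simp: coset_def slice_def dot_add add_V)
  have U: "\<Union>?P = hyp \<xi>" using cH self_mem_coset[OF W] by blast
  have disj: "pairwise disjnt ?P"
    unfolding pairwise_def disjnt_def using coset_eq[OF W] by blast
  have fin: "finite ?P" using finite_slice by simp
  have "card (hyp \<xi>) = (\<Sum>B\<in>?P. card B)"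
    using card_Union_disjoint[OF disj] finite_coset[OF W] unfolding U by auto
  also have "\<dots> = 3 * card ?P"
    using cW by (subst sum.cong[OF refl, of _ _ "\<lambda>_. 3"]) auto
  finally have "3 powr (card (hyp \<xi>) / 3) = real (3 ^ card ?P)"
    by (simp add: powr_realpow)
  also have "3 ^ card ?P \<le> card {I. I \<subseteq> \<Union>?P \<and> (\<forall>B\<in>?P. \<exists>!y. y \<in> B \<and> y \<in> I)}"
    by (rule card_transversals_ge[OF fin disj]) (auto simp: cW)
  finally show ?thesis unfolding U by simp
qed

lemma sumfree_insert_transversal:
  assumes s: "s \<in> slice \<xi> 0" "s \<noteq> 0" and I: "I \<subseteq> hyp \<xi>"
    "\<And>x. x \<in> hyp \<xi> \<Longrightarrow> \<exists>!y. y \<in> coset {0, s, - s} x \<and> y \<in> I"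
  shows "sumfree (insert s I)"
proof -
  have I1: "dot \<xi> x = 1" if "x \<in> I" for x using I(1) that by (auto simp: slice_def)
  have s0: "dot \<xi> s = 0" using s(1) by (simp add: slice_def)
  have sI: "x + s \<notin> I" if "x \<in> I" for x
  proof
    assume "x + s \<in> I"
    moreover have "x + s \<in> coset {0, s, - s} x" "x \<in> coset {0, s, - s} x" by (auto simp: mem_coset)
    moreover have "x \<in> hyp \<xi>" using that I(1) by blast
    ultimately have "x + s = x" using I(2)[of x] that by blast
    then show False using s(2) by simp
  qed
  have "x + y \<notin> insert s I" if "x \<in> insert s I" "y \<in> insert s I" for x y
  proof
    assume xy: "x + y \<in> insert s I"
    consider "x = s" "y = s" | "x = s" "y \<in> I" | "x \<in> I" "y = s" | "x \<in> I" "y \<in> I"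
      using \<open>x \<in> insert s I\<close> \<open>y \<in> insert s I\<close> by blast
    then show False
    proof cases
      case 1
      then show ?thesis using xy s(2) I1[of "s + s"] by (auto simp: dot_add s0)
    next
      case 2
      then show ?thesis using xy sI[of y] I1[of y] by (auto simp: add.commute)
    next
      case 3
      then show ?thesis using xy sI[of x] I1[of x] by auto
    next
      case 4
      then have "dot \<xi> (x + y) = 2" using I1 by (simp add: dot_add)
      then show ?thesis using xy s0 I1[of "x + y"] by auto
    qed
  qed
  then show ?thesis by (auto simp: sumfree_def)
qed

text \<open>The independent-set bound on \<open>m\<close> vertices when induced triangles cover at
  most \<open>(3 * m + 3) / 4\<close> of them.\<close>

definition err :: "nat \<Rightarrow> real" where
  "err m = mis_base ^ m * mis_gain ^ ((3 * m + 3) div 4)"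

lemma card_mis_two_le:
  assumes \<xi>: "\<xi> \<in> V" and s: "s \<in> slice \<xi> 0" and y: "y \<in> V" "y \<notin> hyp \<xi>" "y \<noteq> s" "sumfree {s, y}"
  shows "card (mis (link {s, y}) (hyp \<xi>)) \<le> err (card (hyp \<xi>))"
  unfolding err_def
proof (intro card_mis_le symp_link irreflp_link finite_slice)
  fix R assume R: "R \<subseteq> hyp \<xi>" "triangles (link {s, y}) R"
  have "4 * card R \<le> 3 * card (hyp \<xi>) + 3"
    by (rule triangles_link_hyp_le[OF \<xi> _ y(4) _ _ _ R]) (use s y in \<open>auto simp: slice_def\<close>)
  then show "card R \<le> (3 * card (hyp \<xi>) + 3) div 4" by simp
qed

text \<open>If \<open>insert s I\<close> is not maximal, it extends by some \<open>y\<close>. This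
  \<open>y\<close> is outside the hyperplane, where \<open>s\<close> already links every point not
  in \<open>I\<close> to \<open>I\<close>. Hence \<open>I\<close> stays maximal independent in the
  larger graph \<open>link {s, y}\<close>, and for each of the at most \<open>card V\<close> choices
  of \<open>y\<close> there are at most \<open>err\<close> such sets.\<close>

lemma card_msf_single_ge:
  assumes \<xi>: "\<xi> \<in> V" and s: "s \<in> slice \<xi> 0" "s \<noteq> 0"
  shows "card {A. msf A \<and> A - hyp \<xi> = {s}} \<ge> 3 powr (card (hyp \<xi>) / 3) - card V * err (card (hyp \<xi>))"
proof -
  let ?W = "{0, s, - s}"
  let ?T = "{I. I \<subseteq> hyp \<xi> \<and> (\<forall>x\<in>hyp \<xi>. \<exists>!y. y \<in> coset ?W x \<and> y \<in> I)}"
  let ?Y = "{y \<in> V. y \<notin> hyp \<xi> \<and> y \<noteq> s \<and> sumfree {s, y}}"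
  have sV: "s \<in> V" "s \<notin> hyp \<xi>" using s by (auto simp: slice_def)
  have finT: "finite ?T" by (rule finite_subset[of _ "Pow (hyp \<xi>)"]) (auto simp: finite_slice)
  have bad: "\<exists>y\<in>?Y. I \<in> mis (link {s, y}) (hyp \<xi>)" if I: "I \<in> ?T" "\<not> msf (insert s I)" for I
  proof -
    have sf: "sumfree (insert s I)"
      using I(1) by (intro sumfree_insert_transversal[OF s]) auto
    moreover have "insert s I \<subseteq> V" using I(1) sV slice_subset[of \<xi> 1] by auto
    ultimately obtain y where y: "y \<in> V" "y \<notin> insert s I" "sumfree (insert y (insert s I))"
      using I(2) by (auto simp: msf_def)
    have near: "\<exists>u\<in>I. u = x + s \<or> u + s = x" if x: "x \<in> hyp \<xi>" "x \<notin> I" for x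
    proof -
      obtain u where u: "u \<in> coset ?W x" "u \<in> I" using I(1) x(1) by blast
      then have "u - x = 0 \<or> u - x = s \<or> u - x = - s" by (simp add: mem_coset)
      then have "u = x + s \<or> u + s = x" using u(2) x(2) by (auto simp: algebra_simps)
      then show ?thesis using u(2) by blast
    qed
    have yH: "y \<notin> hyp \<xi>"
    proof
      assume "y \<in> hyp \<xi>"
      then obtain u where "u \<in> I" "u = y + s \<or> u + s = y" using near y(2) by blast
      then show False using y(3) unfolding sumfree_def by blast
    qed
    have "I \<in> mis (link {s, y}) (hyp \<xi>)"
      unfolding mis_def
    proof (intro CollectI conjI ballI)
      show "I \<subseteq> hyp \<xi>" using I(1) by blast
      show "\<not> link {s, y} p q" if "p \<in> I" "q \<in> I" for p q
        using that y(3) unfolding link_def sumfree_def by blast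
      fix v assume v: "v \<in> hyp \<xi> - I"
      then obtain u where u: "u \<in> I" "u = v + s \<or> u + s = v" using near by blast
      then have "link {s, y} v u" using v by (auto simp: link_def)
      then show "\<exists>u\<in>I. link {s, y} v u" using u(1) by blast
    qed
    moreover have "sumfree {s, y}" using y(3) by (rule sumfree_subset) auto
    ultimately show ?thesis using y(1,2) yH by auto
  qed
  have "real (card {I \<in> ?T. \<not> msf (insert s I)}) \<le> card (\<Union>y\<in>?Y. mis (link {s, y}) (hyp \<xi>))"
    unfolding of_nat_le_iff
    by (intro card_mono finite_UN_I finite_mis finite_slice) (use finite_V bad in auto)
  also have "\<dots> \<le> card ?Y * err (card (hyp \<xi>))"
    using finite_V card_mis_two_le[OF \<xi> s(1)] by (intro card_UN_le_bound) auto
  also have "\<dots> \<le> card V * err (card (hyp \<xi>))"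
    using finite_V mis_gain_gt_1 by (intro mult_right_mono) (auto simp: err_def mis_base_def intro: card_mono)
  finally have badc: "real (card {I \<in> ?T. \<not> msf (insert s I)}) \<le> card V * err (card (hyp \<xi>))" .
  have "card {I \<in> ?T. msf (insert s I)} \<le> card {A. msf A \<and> A - hyp \<xi> = {s}}"
  proof (rule card_inj_on_le[of "insert s"])
    show "inj_on (insert s) {I \<in> ?T. msf (insert s I)}"
    proof (rule inj_onI)
      fix I K assume "I \<in> {I \<in> ?T. msf (insert s I)}" "K \<in> {I \<in> ?T. msf (insert s I)}" "insert s I = insert s K"
      then show "I = K" using sV(2) by (subst (asm) insert_ident) auto
    qed
    show "insert s ` {I \<in> ?T. msf (insert s I)} \<subseteq> {A. msf A \<and> A - hyp \<xi> = {s}}"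
      using sV(2) by auto
  qed (rule finite_msf)
  moreover have "card ?T = card {I \<in> ?T. msf (insert s I)} + card {I \<in> ?T. \<not> msf (insert s I)}"
  proof -
    have "card ?T = card ({I \<in> ?T. msf (insert s I)} \<union> {I \<in> ?T. \<not> msf (insert s I)})"
      by (rule arg_cong[where f = card]) blast
    also have "card ({I \<in> ?T. msf (insert s I)} \<union> {I \<in> ?T. \<not> msf (insert s I)})
        = card {I \<in> ?T. msf (insert s I)} + card {I \<in> ?T. \<not> msf (insert s I)}"
      by (intro card_Un_disjoint finite_subset[OF _ finT]) blast+
    finally show ?thesis .
  qed
  ultimately show ?thesis
    using badc card_line_transversals[OF \<xi> s] by simp
qed

text \<open>For independent \<open>\<xi>\<close> and \<open>\<eta>\<close> the four slices in the
  proof come from the four lines through \<open>(1, 1)\<close> in the affine plane of pairs of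
  values. These lines cover that point four times and every other point once, so
  \<open>4 * n / 3 = n + 3 * card (hyp \<xi> \<inter> hyp \<eta>)\<close>.\<close>

lemma card_hyp_inter:
  assumes "\<xi> \<in> V - {0}" "\<eta> \<in> V - {0}" "\<xi> \<noteq> \<eta>"
  shows "9 * card (hyp \<xi> \<inter> hyp \<eta>) \<le> card V"
proof (cases "\<eta> = - \<xi>")
  case True
  then have "hyp \<xi> \<inter> hyp \<eta> = {}" by (auto simp: slice_def dot_neg)
  then show ?thesis by simp
next
  case False
  then have nz: "\<xi> - \<eta> \<noteq> 0" "\<xi> + \<eta> \<noteq> 0" "\<xi> - \<eta> \<in> V" "\<xi> + \<eta> \<in> V"
    using assms add_V diff_V by (simp_all add: add_eq_0_iff)
  let ?i = "\<lambda>S x. if x \<in> S then 1 else 0 :: nat"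
  have c: "card S = (\<Sum>x\<in>V. ?i S x)" if "S \<subseteq> V" for S
    using that finite_V by (simp add: sum.If_cases Int_absorb1)
  have pt: "?i (slice \<xi> 1) x + ?i (slice \<eta> 1) x + ?i (slice (\<xi> - \<eta>) 0) x + ?i (slice (\<xi> + \<eta>) 2) x
    = 1 + 3 * ?i (hyp \<xi> \<inter> hyp \<eta>) x" if "x \<in> V" for x
    using that three_cases[of "dot \<xi> x"] three_cases[of "dot \<eta> x"]
    by (auto simp: slice_def dot_add_left dot_diff)
  have "card (slice \<xi> 1) + card (slice \<eta> 1) + card (slice (\<xi> - \<eta>) 0) + card (slice (\<xi> + \<eta>) 2)
    = (\<Sum>x\<in>V. 1 + 3 * ?i (hyp \<xi> \<inter> hyp \<eta>) x)"
    unfolding c[OF slice_subset] sum.distrib[symmetric] by (rule sum.cong[OF refl pt])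
  also have "\<dots> = card V + 3 * card (hyp \<xi> \<inter> hyp \<eta>)"
  proof -
    have "hyp \<xi> \<inter> hyp \<eta> \<subseteq> V" using slice_subset by blast
    from c[OF this] show ?thesis by (simp only: sum.distrib sum_distrib_left) simp
  qed
  finally show ?thesis
    using card_slice[of \<xi> 1] card_slice[of \<eta> 1] card_slice[OF nz(3,1), of 0] card_slice[OF nz(4,2), of 2] assms
    by simp
qed

text \<open>Removing all overlaps makes the families disjoint. A set arising from two different
  hyperplanes lies in their intersection plus two points, so an overlap has at most
  \<open>2 powr (m / 3 + 2)\<close> members, and there are at most \<open>n ^ 4\<close> pairs of
  indices. For one hyperplane, different \<open>s\<close> never produce the same set.\<close>

theorem card_msf_lower:
  assumes m: "card V = 3 * m"
  defines "n \<equiv> real (card V)"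
  shows "card {A. msf A} \<ge> (n - 1) * (real m - 1) * (3 powr (m / 3) - n * err m - n ^ 4 * 2 powr (m / 3 + 2))"
proof -
  let ?J = "SIGMA \<xi>:V - {0}. slice \<xi> 0 - {0}"
  let ?M = "\<lambda>(\<xi>, s). {A. msf A \<and> A - hyp \<xi> = {s}}"
  let ?O = "\<Union>(i, j)\<in>{(i, j) \<in> ?J \<times> ?J. i \<noteq> j}. ?M i \<inter> ?M j"
  have hm: "card (slice \<xi> i) = m" if "\<xi> \<in> V - {0}" for \<xi> i
    using card_slice[of \<xi> i] that m by simp
  have m1: "m \<ge> 1" using m card_V_pos by simp
  have n1: "n \<ge> 1" using card_V_pos by (simp add: n_def)
  have finJ: "finite ?J" using finite_V finite_slice by auto
  have "card ?J = (\<Sum>\<xi>\<in>V - {0}. card (slice \<xi> 0 - {0}))"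
    using finite_V finite_slice by (intro card_SigmaI) auto
  also have "\<dots> = (\<Sum>\<xi>\<in>V - {0}. m - 1)"
  proof (rule sum.cong[OF refl])
    fix \<xi> assume "\<xi> \<in> V - {0}"
    moreover have "0 \<in> slice \<xi> 0" by (simp add: slice_def zero_V)
    ultimately show "card (slice \<xi> 0 - {0}) = m - 1" using hm finite_slice by simp
  qed
  finally have cJ: "real (card ?J) = (n - 1) * (real m - 1)"
    using finite_V zero_V card_V_pos m1 by (simp add: n_def of_nat_diff)
  have finM: "finite (?M i)" for i by (cases i) (simp add: finite_msf)
  have finI: "finite {(i, j) \<in> ?J \<times> ?J. i \<noteq> j}"
    by (rule finite_subset[of _ "?J \<times> ?J"]) (use finJ in auto)
  have ov: "real (card (?M i \<inter> ?M j)) \<le> 2 powr (m / 3 + 2)" if ij: "i \<in> ?J" "j \<in> ?J" "i \<noteq> j" for i j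
  proof -
    obtain \<xi> s \<eta> t where eq: "i = (\<xi>, s)" "j = (\<eta>, t)" by (cases i, cases j) auto
    show ?thesis
    proof (cases "\<xi> = \<eta>")
      case True
      then have "?M i \<inter> ?M j = {}" using ij eq by auto
      then show ?thesis by simp
    next
      case False
      let ?S = "(hyp \<xi> \<inter> hyp \<eta>) \<union> {s, t}"
      have "?M i \<inter> ?M j \<subseteq> Pow ?S" unfolding eq by auto
      then have "card (?M i \<inter> ?M j) \<le> card (Pow ?S)"
        by (intro card_mono) (auto simp: finite_slice)
      also have "\<dots> = 2 ^ card ?S" by (rule card_Pow) (simp add: finite_slice)
      finally have "real (card (?M i \<inter> ?M j)) \<le> real (2 ^ card ?S)"
        by (simp only: of_nat_le_iff)
      also have "\<dots> = 2 ^ card ?S" by simp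
      also have "\<dots> = 2 powr (card ?S)" by (simp add: powr_realpow)
      also have "\<dots> \<le> 2 powr (m / 3 + 2)"
      proof (rule powr_mono)
        have "card ?S \<le> card (hyp \<xi> \<inter> hyp \<eta>) + card {s, t}" by (rule card_Un_le)
        also have "card {s, t} \<le> 2" by (simp add: card_insert_if)
        finally have "card ?S \<le> card (hyp \<xi> \<inter> hyp \<eta>) + 2" by simp
        moreover have "3 * card (hyp \<xi> \<inter> hyp \<eta>) \<le> m"
          using card_hyp_inter[of \<xi> \<eta>] ij eq False m by auto
        ultimately show "real (card ?S) \<le> m / 3 + 2" by linarith
      qed simp
      finally show ?thesis .
    qed
  qed
  have "real (card ?O) \<le> card {(i, j) \<in> ?J \<times> ?J. i \<noteq> j} * 2 powr (m / 3 + 2)"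
    using ov by (intro card_UN_le_bound finI) auto
  also have "\<dots> \<le> n ^ 4 * 2 powr (m / 3 + 2)"
  proof (rule mult_right_mono)
    have "card {(i, j) \<in> ?J \<times> ?J. i \<noteq> j} \<le> card (?J \<times> ?J)"
      using finJ by (intro card_mono) auto
    also have "\<dots> = card ?J * card ?J" by (rule card_cartesian_product)
    finally have 1: "real (card {(i, j) \<in> ?J \<times> ?J. i \<noteq> j}) \<le> real (card ?J) * real (card ?J)"
      by (simp only: of_nat_le_iff flip: of_nat_mult)
    have "card ?J \<le> card (V \<times> V)"
      using finite_V slice_subset by (intro card_mono) auto
    then have "real (card ?J) \<le> n * n"
      unfolding card_cartesian_product n_def by (simp only: of_nat_le_iff flip: of_nat_mult)
    then have "real (card ?J) * real (card ?J) \<le> (n * n) * (n * n)"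
      by (intro mult_mono) auto
    then show "real (card {(i, j) \<in> ?J \<times> ?J. i \<noteq> j}) \<le> n ^ 4"
      using 1 by (simp add: eval_nat_numeral mult.assoc)
  qed simp
  finally have cO: "real (card ?O) \<le> n ^ 4 * 2 powr (m / 3 + 2)" .
  have finO: "finite ?O" using finI finM by (intro finite_UN_I) auto
  have each: "3 powr (m / 3) - n * err m - n ^ 4 * 2 powr (m / 3 + 2) \<le> real (card (?M i - ?O))" if "i \<in> ?J" for i
  proof -
    obtain \<xi> s where eq: "i = (\<xi>, s)" by (cases i)
    have "real (card (?M i)) \<ge> 3 powr (m / 3) - n * err m"
      using card_msf_single_ge[of \<xi> s] hm[of \<xi> 1] that eq by (simp add: n_def)
    moreover have "card (?M i) - card ?O \<le> card (?M i - ?O)"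
      using finO by (rule diff_card_le_card_Diff)
    ultimately show ?thesis using cO by linarith
  qed
  have "(n - 1) * (real m - 1) * (3 powr (m / 3) - n * err m - n ^ 4 * 2 powr (m / 3 + 2))
      = (\<Sum>i\<in>?J. 3 powr (m / 3) - n * err m - n ^ 4 * 2 powr (m / 3 + 2))"
    by (simp add: cJ)
  also have "\<dots> \<le> (\<Sum>i\<in>?J. real (card (?M i - ?O)))"
    by (rule sum_mono[OF each])
  also have "\<dots> = real (card (\<Union>i\<in>?J. ?M i - ?O))"
  proof -
    have "(?M i - ?O) \<inter> (?M j - ?O) = {}" if "i \<in> ?J" "j \<in> ?J" "i \<noteq> j" for i j
      using that by blast
    then have "card (\<Union>i\<in>?J. ?M i - ?O) = (\<Sum>i\<in>?J. card (?M i - ?O))"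
      using finJ finM by (intro card_UN_disjoint) auto
    then show ?thesis by simp
  qed
  also have "\<dots> \<le> real (card {A. msf A})"
    unfolding of_nat_le_iff using finite_msf[of "\<lambda>_. True"] by (intro card_mono) auto
  finally show ?thesis .
qed

end

section \<open>Asymptotics\<close>

lemma ex_card_small_subsets_le_exp:
  fixes \<eta> :: real
  assumes "\<eta> > 0"
  shows "\<exists>\<beta>::real. \<beta> > 0 \<and> (\<forall>A :: 'a set. \<forall>t :: real. finite A \<longrightarrow> t \<le> \<beta> * card A \<longrightarrow>
    card {T. T \<subseteq> A \<and> card T \<le> t} \<le> exp (\<eta> * card A))"
proof -
  define x where "x = min (\<eta> / 2) 1"
  \<comment> \<open>Half of \<open>\<eta>\<close> pays for \<open>(1 + x) ^ card A\<close>, the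
    other half for \<open>x powr (- t)\<close>. The summand 1 keeps the denominator positive when
    \<open>x = 1\<close>.\<close>
  define \<beta> where "\<beta> = \<eta> / 2 / (1 - ln x)"
  have x: "0 < x" "x \<le> 1" "x \<le> \<eta> / 2" using assms by (auto simp: x_def)
  then have lnx: "ln x \<le> 0" by simp
  have \<beta>: "\<beta> > 0" using assms lnx by (simp add: \<beta>_def)
  have "\<beta> * (1 - ln x) = \<eta> / 2" proof -
    have "1 - ln x \<noteq> 0" using lnx by simp
    then show ?thesis using \<beta>_def nonzero_eq_divide_eq by blast
  qed
  then have \<beta>x: "- \<beta> * ln x \<le> \<eta> / 2" using \<beta> by (simp add: algebra_simps)
  show ?thesis
  proof (intro exI[of _ \<beta>] conjI \<beta> allI impI)
    fix A :: "'a set" and t :: real assume A: "finite A" "t \<le> \<beta> * card A"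
    have "real (card {T. T \<subseteq> A \<and> card T \<le> t}) \<le> (1 + x) ^ card A * x powr (- t)"
      by (rule card_small_subsets_le[OF A(1) x(1,2)])
    also have "\<dots> \<le> exp x ^ card A * x powr (- (\<beta> * card A))"
      using x A(2) by (intro mult_mono power_mono powr_mono') auto
    also have "\<dots> = exp ((x - \<beta> * ln x) * card A)"
      using x unfolding powr_def exp_of_nat_mult[symmetric] by (simp add: algebra_simps flip: exp_add)
    also have "\<dots> \<le> exp (\<eta> * card A)"
      using x \<beta>x by (intro iffD2[OF exp_le_cancel_iff] mult_right_mono) auto
    finally show "real (card {T. T \<subseteq> A \<and> card T \<le> t}) \<le> exp (\<eta> * card A)" .
  qed
qed

definition gain :: real where "gain = ln mis_gain"

lemma gain_pos: "gain > 0"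
  using mis_gain_gt_1 by (simp add: gain_def)

lemma mis_base_eq: "mis_base = exp (ln 3 / 3 - gain)"
proof -
  have pos: "mis_base > 0" "mis_gain > 0" using mis_gain_gt_1 by (auto simp: mis_base_def)
  then have "3 * (ln mis_base + gain) = ln ((mis_base * mis_gain) ^ 3)"
    by (simp add: ln_realpow ln_mult gain_def)
  also have "\<dots> = ln 3" by (simp only: mis_base_gain)
  finally have "ln mis_base = ln 3 / 3 - gain" by simp
  then show ?thesis using pos by (metis exp_ln)
qed

lemma mis_gain_eq: "mis_gain = exp gain"
  using mis_gain_gt_1 by (simp add: gain_def)

lemma mis_base_power_eq: "mis_base ^ m = 3 powr (m / 3) * exp (- gain * m)"
  by (simp add: mis_base_eq powr_def algebra_simps flip: exp_of_nat_mult exp_add)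

text \<open>Relative to \<open>3 powr (m / 3)\<close> a factor \<open>mis_gain\<close> is lost for
  each of the roughly \<open>m / 4\<close> vertices that triangles cannot cover; rounding costs the
  constant \<open>exp (3 * gain / 4)\<close>.\<close>

lemma err_le: "mis_base ^ m * mis_gain ^ ((3 * m + 3) div 4) \<le> 3 powr (m / 3) * exp (gain * (3 - real m) / 4)"
proof -
  have "real ((3 * m + 3) div 4) \<le> (3 * real m + 3) / 4"
  proof -
    have "4 * ((3 * m + 3) div 4) \<le> 3 * m + 3" by simp
    then have "real (4 * ((3 * m + 3) div 4)) \<le> real (3 * m + 3)" by (simp only: of_nat_le_iff)
    then show ?thesis by simp
  qed
  then have "gain * real ((3 * m + 3) div 4) \<le> gain * ((3 * real m + 3) / 4)"
    using gain_pos by (intro mult_left_mono) auto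
  then have "mis_gain ^ ((3 * m + 3) div 4) \<le> exp (gain * ((3 * real m + 3) / 4))"
    by (simp add: mis_gain_eq mult.commute flip: exp_of_nat_mult)
  then have "mis_base ^ m * mis_gain ^ ((3 * m + 3) div 4) \<le> mis_base ^ m * exp (gain * ((3 * real m + 3) / 4))"
    by (intro mult_left_mono) (simp_all add: mis_base_def)
  also have "\<dots> = 3 powr (m / 3) * exp (gain * (3 - real m) / 4)"
    unfolding mis_base_power_eq mult.assoc exp_add[symmetric] by (simp add: field_simps)
  finally show ?thesis .
qed

context ternary_space
begin

text \<open>Half of each saving is spent on choosing \<open>T\<close>. Near a hyperplane the saving
  is \<open>gain * m / 4 = gain * n / 12\<close>, hence the rate \<open>gain / 24\<close>; away from
  hyperplanes it is \<open>\<tau>\<^sup>2 / 16 * ln 3 / 3 * n\<close>, hence the 6 in the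
  denominator. The rate \<open>gain / 3\<close> is that of link graphs without triangles.\<close>

lemma card_msf_upper_exp:
  fixes \<delta> \<tau> n :: real
  assumes \<delta>: "\<delta> > 0" "real j * \<delta> ^ 5 > 1" and \<tau>: "0 < \<tau>" "\<tau> \<le> 1 / 2" and m: "card V = 3 * m"
    and n: "n = card V"
    and s1: "card (small_sets ((\<tau> + 2 * \<delta>) * n)) \<le> exp (gain / 24 * n)"
    and s2: "card (small_sets (2 * \<delta> * n)) \<le> exp (\<tau>\<^sup>2 / 16 * ln 3 / 6 * n)"
  shows "card {A. msf A} \<le> ((n - 3) * (n - 1) / 3 + (n ^ 3 * exp (- (gain / 3) * n) + n * exp (- (gain / 3) * n)
    + exp (3 * gain / 4) * (n * exp (- (gain / 24) * n))
    + 2 ^ 3 ^ tower j * (n ^ tower j * exp (- (\<tau>\<^sup>2 / 16 * ln 3 / 6) * n)))) * 3 powr (n / 9)"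
proof -
  define P where "P = (3::real) powr (n / 9)"
  have P: "P > 0" "3 powr (real m / 3) = P" using m n by (auto simp: P_def)
  have n1: "n \<ge> 1" using card_V_pos n by simp
  have nm: "real m = n / 3" using m n by simp
  define E where "E = exp (- (gain / 3) * n)"
  define S where "S = real (card (small_sets ((\<tau> + 2 * \<delta>) * n)))"
  have b: "mis_base ^ m = P * E" unfolding mis_base_power_eq P(2) by (simp add: E_def nm)
  have e: "S * (mis_base ^ m * mis_gain ^ ((3 * m + 3) div 4)) \<le> P * (exp (3 * gain / 4) * exp (- (gain / 24) * n))"
  proof -
    have "S * (mis_base ^ m * mis_gain ^ ((3 * m + 3) div 4)) \<le> exp (gain / 24 * n) * (P * exp (gain * (3 - real m) / 4))"
      by (rule mult_mono[OF s1[folded S_def] err_le[of m, unfolded P(2)]])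
         (use mis_gain_gt_1 in \<open>auto simp: mis_base_def\<close>)
    also have "\<dots> = P * (exp (gain / 24 * n) * exp (gain * (3 - real m) / 4))" by simp
    also have "exp (gain / 24 * n) * exp (gain * (3 - real m) / 4) = exp (3 * gain / 4) * exp (- (gain / 24) * n)"
      unfolding exp_add[symmetric] by (simp add: nm field_simps)
    finally show ?thesis .
  qed
  have f: "card (small_sets (2 * \<delta> * n)) * 3 powr ((1 / 3 - \<tau>\<^sup>2 / 16) * n / 3) \<le> P * exp (- (\<tau>\<^sup>2 / 16 * ln 3 / 6) * n)"
  proof -
    have "card (small_sets (2 * \<delta> * n)) * 3 powr ((1 / 3 - \<tau>\<^sup>2 / 16) * n / 3)
      \<le> exp (\<tau>\<^sup>2 / 16 * ln 3 / 6 * n) * 3 powr ((1 / 3 - \<tau>\<^sup>2 / 16) * n / 3)"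
      using s2 by (intro mult_right_mono) auto
    also have "\<dots> = P * exp (- (\<tau>\<^sup>2 / 16 * ln 3 / 6) * n)"
      unfolding P_def powr_def by (simp add: field_simps flip: exp_add)
    finally show ?thesis .
  qed
  have "real (card {A. msf A}) \<le> (n - 1) * ((real m - 1) * P + (n\<^sup>2 + 1) * (P * E) + S * (mis_base ^ m * mis_gain ^ ((3 * m + 3) div 4)))
    + n ^ tower j * 2 ^ 3 ^ tower j * (card (small_sets (2 * \<delta> * n)) * 3 powr ((1 / 3 - \<tau>\<^sup>2 / 16) * n / 3))"
    using card_msf_upper[OF \<delta> \<tau> m] unfolding n[symmetric] P(2) S_def b .
  also have "\<dots> \<le> (n - 1) * ((real m - 1) * P + (n\<^sup>2 + 1) * (P * E) + P * (exp (3 * gain / 4) * exp (- (gain / 24) * n)))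
    + n ^ tower j * 2 ^ 3 ^ tower j * (P * exp (- (\<tau>\<^sup>2 / 16 * ln 3 / 6) * n))"
    using n1 by (intro add_mono[OF mult_left_mono[OF add_left_mono[OF e]] mult_left_mono[OF f]]) auto
  also have "\<dots> = (n - 3) * (n - 1) / 3 * P + (n - 1) * ((n\<^sup>2 + 1) * (P * E) + P * (exp (3 * gain / 4) * exp (- (gain / 24) * n)))
    + n ^ tower j * 2 ^ 3 ^ tower j * (P * exp (- (\<tau>\<^sup>2 / 16 * ln 3 / 6) * n))"
    by (simp add: nm field_simps)
  also have "\<dots> \<le> (n - 3) * (n - 1) / 3 * P + n * ((n\<^sup>2 + 1) * (P * E) + P * (exp (3 * gain / 4) * exp (- (gain / 24) * n)))
    + n ^ tower j * 2 ^ 3 ^ tower j * (P * exp (- (\<tau>\<^sup>2 / 16 * ln 3 / 6) * n))"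
    using P(1) by (intro add_mono mult_right_mono order_refl add_nonneg_nonneg mult_nonneg_nonneg) (auto simp: E_def)
  also have "\<dots> = ((n - 3) * (n - 1) / 3 + (n ^ 3 * E + n * E
    + exp (3 * gain / 4) * (n * exp (- (gain / 24) * n))
    + 2 ^ 3 ^ tower j * (n ^ tower j * exp (- (\<tau>\<^sup>2 / 16 * ln 3 / 6) * n)))) * P"
    by (simp add: algebra_simps power2_eq_square power3_eq_cube)
  finally show ?thesis by (simp only: P_def E_def)
qed

text \<open>The rate \<open>gain / 12\<close> comes from transversals that are not maximal, the rate
  \<open>(ln 3 - ln 2) / 9\<close> from comparing overlaps of size about
  \<open>2 powr (n / 9)\<close> with the main term.\<close>

lemma card_msf_lower_exp:
  fixes n :: real
  assumes m: "card V = 3 * m" and n: "n = card V"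
  shows "card {A. msf A} \<ge> ((n - 3) * (n - 1) / 3 - (exp (3 * gain / 4) * (n ^ 3 * exp (- (gain / 12) * n))
    + 4 * (n ^ 6 * exp (- ((ln 3 - ln 2) / 9) * n)))) * 3 powr (n / 9)"
proof -
  define P where "P = (3::real) powr (n / 9)"
  have P: "P > 0" "3 powr (real m / 3) = P" using m n by (auto simp: P_def)
  have n1: "n \<ge> 1" using card_V_pos n by simp
  have nm: "real m = n / 3" using m n by simp
  have "m \<ge> 1" using m card_V_pos by simp
  define X where "X = n * (exp (3 * gain / 4) * exp (- (gain / 12) * n)) + n ^ 4 * (4 * exp (- ((ln 3 - ln 2) / 9) * n))"
  have "X \<ge> 0" using n1 by (simp add: X_def)
  have 1: "err m \<le> P * (exp (3 * gain / 4) * exp (- (gain / 12) * n))"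
    using err_le[of m] unfolding err_def P(2) exp_add[symmetric] by (simp add: nm field_simps)
  have 2: "2 powr (real m / 3 + 2) = P * (4 * exp (- ((ln 3 - ln 2) / 9) * n))"
  proof -
    have "2 powr (real m / 3 + 2) = 4 * 2 powr (n / 9)" by (simp add: powr_add nm)
    also have "2 powr (n / 9) = P * exp (- ((ln 3 - ln 2) / 9) * n)"
      by (simp add: P_def powr_def field_simps flip: exp_add)
    finally show ?thesis by simp
  qed
  have "n * err m + n ^ 4 * 2 powr (real m / 3 + 2) \<le> P * X"
    using mult_left_mono[OF 1, of n] n1 unfolding 2 X_def by (simp add: algebra_simps)
  then have 3: "P - P * X \<le> 3 powr (real m / 3) - n * err m - n ^ 4 * 2 powr (real m / 3 + 2)"
    unfolding P(2) by linarith
  have "((n - 3) * (n - 1) / 3 - n\<^sup>2 * X) * P \<le> ((n - 1) * (real m - 1) - (n - 1) * (real m - 1) * X) * P"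
  proof -
    have "(n - 1) * (real m - 1) \<le> n * n"
      using n1 \<open>m \<ge> 1\<close> nm by (intro mult_mono) auto
    then have "(n - 1) * (real m - 1) * X \<le> n\<^sup>2 * X"
      using \<open>X \<ge> 0\<close> by (intro mult_right_mono) (auto simp: power2_eq_square)
    moreover have "(n - 3) * (n - 1) / 3 = (n - 1) * (real m - 1)" by (simp add: nm field_simps)
    ultimately show ?thesis using P(1) by (intro mult_right_mono) linarith+
  qed
  also have "\<dots> = (n - 1) * (real m - 1) * (P - P * X)" by (simp add: algebra_simps)
  also have "\<dots> \<le> (n - 1) * (real m - 1) * (3 powr (real m / 3) - n * err m - n ^ 4 * 2 powr (real m / 3 + 2))"
    using n1 \<open>m \<ge> 1\<close> by (intro mult_left_mono[OF 3]) auto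
  also have "\<dots> \<le> card {A. msf A}"
    using card_msf_lower[OF m] by (simp add: n)
  finally have "((n - 3) * (n - 1) / 3 - n\<^sup>2 * X) * P \<le> card {A. msf A}" .
  moreover have "n\<^sup>2 * X = exp (3 * gain / 4) * (n ^ 3 * exp (- (gain / 12) * n)) + 4 * (n ^ 6 * exp (- ((ln 3 - ln 2) / 9) * n))"
    by (simp add: X_def eval_nat_numeral algebra_simps)
  ultimately show ?thesis by (simp add: P_def)
qed

end

section \<open>The concrete model and the transfer to \<open>Z3_pow\<close>\<close>

definition cube :: "nat \<Rightarrow> (nat \<Rightarrow> 3) set" where
  "cube k = {x. \<forall>i\<ge>k. x i = 0}"

definition cube_dot :: "nat \<Rightarrow> (nat \<Rightarrow> 3) \<Rightarrow> (nat \<Rightarrow> 3) \<Rightarrow> 3" where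
  "cube_dot k x y = (\<Sum>i<k. x i * y i)"

lemma card_cube: "finite (cube k)" "card (cube k) = 3 ^ k"
proof -
  have "bij_betw (\<lambda>f i. if i < k then f i else 0) ({..<k} \<rightarrow>\<^sub>E (UNIV :: 3 set)) (cube k)"
  proof (rule bij_betw_byWitness[of _ "\<lambda>x. restrict x {..<k}"])
    show "\<forall>f\<in>{..<k} \<rightarrow>\<^sub>E UNIV. (\<lambda>i\<in>{..<k}. if i < k then f i else 0) = (f :: nat \<Rightarrow> 3)"
    proof
      fix f :: "nat \<Rightarrow> 3" assume f: "f \<in> {..<k} \<rightarrow>\<^sub>E UNIV"
      have "(\<lambda>i\<in>{..<k}. if i < k then f i else 0) = restrict f {..<k}"
        by (rule restrict_ext) simp
      also have "\<dots> = f" using f by (rule PiE_restrict)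
      finally show "(\<lambda>i\<in>{..<k}. if i < k then f i else 0) = f" .
    qed
    show "\<forall>x\<in>cube k. (\<lambda>i. if i < k then restrict x {..<k} i else 0) = x"
      by (intro ballI ext) (simp add: cube_def)
    show "(\<lambda>f i. if i < k then f i else 0) ` ({..<k} \<rightarrow>\<^sub>E UNIV) \<subseteq> cube k"
      by (intro image_subsetI) (simp add: cube_def)
    show "(\<lambda>x. restrict x {..<k}) ` cube k \<subseteq> {..<k} \<rightarrow>\<^sub>E UNIV"
      by (intro image_subsetI) (simp add: restrict_PiE_iff)
  qed
  from bij_betw_finite[OF this] bij_betw_same_card[OF this]
  show "finite (cube k)" "card (cube k) = 3 ^ k"
    by (simp_all add: finite_PiE card_funcsetE)
qed

text \<open>Vectors are functions on all of \<open>nat\<close> vanishing from \<open>k\<close> on,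
  so that one type with pointwise addition serves every \<open>k\<close>. Unit vectors witness
  nondegeneracy.\<close>

lemma ternary_space_cube: "ternary_space (cube k) (cube_dot k) k"
proof
  show "x + x + x = 0" for x :: "nat \<Rightarrow> 3"
  proof
    fix i
    show "(x + x + x) i = 0 i" using three_cases[of "x i"] by auto
  qed
  show "\<exists>y\<in>cube k. cube_dot k x y \<noteq> 0" if x: "x \<in> cube k" "x \<noteq> 0" for x
  proof -
    obtain i where "x i \<noteq> 0" using x(2) by (auto simp: fun_eq_iff)
    then have "i < k" using x(1) by (auto simp: cube_def not_less[symmetric])
    let ?y = "\<lambda>j. if j = i then 1 else 0 :: 3"
    have "cube_dot k x ?y = x i"
      using \<open>i < k\<close> by (simp add: cube_dot_def if_distrib cong: if_cong)
    moreover have "?y \<in> cube k" using \<open>i < k\<close> by (auto simp: cube_def)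
    ultimately show ?thesis using \<open>x i \<noteq> 0\<close> by metis
  qed
qed (auto simp: cube_def cube_dot_def card_cube[unfolded cube_def] distrib_left sum.distrib mult.commute)

lemma (in ternary_space) f_max_eq_card_msf:
  assumes h: "bij_betw h (carrier G) V"
    and hom: "\<And>x y. x \<in> carrier G \<Longrightarrow> y \<in> carrier G \<Longrightarrow> x \<otimes>\<^bsub>G\<^esub> y \<in> carrier G \<and> h (x \<otimes>\<^bsub>G\<^esub> y) = h x + h y"
  shows "f_max G = card {A. msf A}"
proof -
  have inj: "inj_on h (carrier G)" and img: "h ` carrier G = V"
    using h by (auto simp: bij_betw_def)
  have mem: "h x \<in> h ` A \<longleftrightarrow> x \<in> A" if "x \<in> carrier G" "A \<subseteq> carrier G" for x A
    using inj that by (rule inj_on_image_mem_iff)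
  have sf: "sum_free G A \<longleftrightarrow> sumfree (h ` A)" if A: "A \<subseteq> carrier G" for A
  proof -
    have "h x + h y \<in> h ` A \<longleftrightarrow> x \<otimes>\<^bsub>G\<^esub> y \<in> A" if "x \<in> A" "y \<in> A" for x y
    proof -
      have "x \<otimes>\<^bsub>G\<^esub> y \<in> carrier G" "h (x \<otimes>\<^bsub>G\<^esub> y) = h x + h y" using hom[of x y] that A by auto
      then show ?thesis using mem[OF _ A, of "x \<otimes>\<^bsub>G\<^esub> y"] by simp
    qed
    then have "sumfree (h ` A) \<longleftrightarrow> (\<forall>x\<in>A. \<forall>y\<in>A. x \<otimes>\<^bsub>G\<^esub> y \<notin> A)"
      by (simp add: sumfree_def)
    moreover have "sum_free G A \<longleftrightarrow> (\<forall>x\<in>A. \<forall>y\<in>A. x \<otimes>\<^bsub>G\<^esub> y \<notin> A)"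
      using A by (auto simp: sum_free_def schur_triple_def subset_iff)
    ultimately show ?thesis by simp
  qed
  have max: "maximal_sum_free G A \<longleftrightarrow> msf (h ` A)" if A: "A \<subseteq> carrier G" for A
  proof
    assume L: "maximal_sum_free G A"
    show "msf (h ` A)"
      unfolding msf_def
    proof (intro conjI ballI)
      show "h ` A \<subseteq> V" using A img by blast
      show "sumfree (h ` A)" using L sf[OF A] by (simp add: maximal_sum_free_def)
      fix y assume y: "y \<in> V - h ` A"
      then obtain b where b: "b \<in> carrier G" "y = h b" "b \<notin> A" using img by blast
      have "\<not> sum_free G (insert b A)" using L b(3) unfolding maximal_sum_free_def by blast
      then show "\<not> sumfree (insert y (h ` A))" using sf[of "insert b A"] A b by simp
    qed
  next
    assume R: "msf (h ` A)"
    show "maximal_sum_free G A"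
      unfolding maximal_sum_free_def
    proof (intro conjI notI)
      show "sum_free G A" using R sf[OF A] by (simp add: msf_def)
      assume "\<exists>B. sum_free G B \<and> A \<subset> B"
      then obtain B b where B: "sum_free G B" "A \<subseteq> B" "b \<in> B" "b \<notin> A" by blast
      then have BG: "B \<subseteq> carrier G" by (simp add: sum_free_def)
      have "sumfree (insert (h b) (h ` A))"
        by (rule sumfree_subset[of "h ` B"]) (use sf[OF BG] B in auto)
      moreover have "h b \<in> V - h ` A" using mem[OF _ A, of b] B BG img by blast
      ultimately show False using R by (simp add: msf_def)
    qed
  qed
  have sub: "{A. maximal_sum_free G A} \<subseteq> Pow (carrier G)"
    by (auto simp: maximal_sum_free_def sum_free_def)
  have "{A. msf A} = (`) h ` {A. maximal_sum_free G A}"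
  proof (intro equalityI subsetI)
    fix B assume "B \<in> {A. msf A}"
    then have "msf B" "B \<subseteq> h ` carrier G" using img by (auto simp: msf_def)
    then obtain A where "A \<subseteq> carrier G" "B = h ` A" by (auto simp: subset_image_iff)
    then show "B \<in> (`) h ` {A. maximal_sum_free G A}" using max[of A] \<open>msf B\<close> by simp
  next
    fix B assume "B \<in> (`) h ` {A. maximal_sum_free G A}"
    then obtain A where "A \<in> {A. maximal_sum_free G A}" "B = h ` A" by (rule imageE)
    then show "B \<in> {A. msf A}" using sub max[of A] by blast
  qed
  moreover have "inj_on ((`) h) {A. maximal_sum_free G A}"
    using inj_on_image_Pow[OF inj] sub by (rule inj_on_subset)
  ultimately show ?thesis
    by (simp add: f_max_def card_image)
qed

lemma of_int_three_inj: "inj_on (of_int :: int \<Rightarrow> 3) {0..<3}"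
proof -
  have "{0..<3} = {0, 1, 2 :: int}" by auto
  then show ?thesis by simp
qed

lemma of_int_mod_three: "of_int (a mod 3) = (of_int a :: 3)"
proof -
  have "(of_int a :: 3) = of_int (3 * (a div 3) + a mod 3)" by simp
  also have "\<dots> = 3 * of_int (a div 3) + of_int (a mod 3)" by (simp only: of_int_add of_int_mult of_int_numeral)
  also have "(3 :: 3) = 0" by simp
  finally show ?thesis by simp
qed

text \<open>Residues embed injectively in each coordinate, and surjectivity follows because both
  sides have \<open>3 ^ k\<close> elements.\<close>

lemma bij_betw_Z3_pow_cube:
  "bij_betw (\<lambda>f i. if i < k then of_int (f i) else 0) (carrier (Z3_pow k)) (cube k)"
proof -
  let ?h = "\<lambda>f i. if i < k then of_int (f i) else 0 :: 3"
  have car: "carrier (Z3_pow k) = {..<k} \<rightarrow>\<^sub>E {0..<3}"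
    by (simp add: Z3_pow_def carrier_integer_mod_group)
  have "inj_on ?h (carrier (Z3_pow k))"
  proof (rule inj_onI)
    fix f g assume fg: "f \<in> carrier (Z3_pow k)" "g \<in> carrier (Z3_pow k)" "?h f = ?h g"
    have "f i = g i" if "i \<in> {..<k}" for i
    proof -
      have "(of_int (f i) :: 3) = of_int (g i)" using fun_cong[OF fg(3), of i] that by simp
      moreover have "f i \<in> {0..<3}" "g i \<in> {0..<3}" using fg(1,2) that unfolding car by (auto simp: PiE_iff)
      ultimately show ?thesis using inj_onD[OF of_int_three_inj] by blast
    qed
    then show "f = g" using fg(1,2) unfolding car by (intro PiE_ext) auto
  qed
  moreover have "?h ` carrier (Z3_pow k) \<subseteq> cube k"
    by (intro image_subsetI) (simp add: cube_def)
  moreover have "card (?h ` carrier (Z3_pow k)) = card (cube k)"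
    using card_image[OF \<open>inj_on ?h _\<close>] order_Z3_pow[of k] by (simp add: order_def card_cube)
  ultimately show ?thesis
    using card_subset_eq[OF card_cube(1)] by (auto simp: bij_betw_def)
qed

lemma f_max_Z3_pow: "f_max (Z3_pow k) = card {A. ternary_space.msf (cube k) A}"
proof (rule ternary_space.f_max_eq_card_msf[OF ternary_space_cube bij_betw_Z3_pow_cube])
  fix x y assume xy: "x \<in> carrier (Z3_pow k)" "y \<in> carrier (Z3_pow k)"
  then have "x \<otimes>\<^bsub>Z3_pow k\<^esub> y \<in> carrier (Z3_pow k)"
    by (intro monoid.m_closed group.is_monoid comm_group.axioms(2)[OF comm_group_Z3_pow])
  moreover have "(x \<otimes>\<^bsub>Z3_pow k\<^esub> y) i = (x i + y i) mod 3" if "i < k" for i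
    using that by (simp add: Z3_pow_def mult_integer_mod_group)
  ultimately show "x \<otimes>\<^bsub>Z3_pow k\<^esub> y \<in> carrier (Z3_pow k) \<and>
      (\<lambda>i. if i < k then of_int ((x \<otimes>\<^bsub>Z3_pow k\<^esub> y) i) else 0 :: 3)
      = (\<lambda>i. if i < k then of_int (x i) else 0) + (\<lambda>i. if i < k then of_int (y i) else 0)"
    by (auto simp: fun_eq_iff of_int_mod_three)
qed

section \<open>Passage to the limit\<close>

lemma power_times_exp_tendsto_0:
  fixes b :: real
  assumes "b > 0"
  shows "(\<lambda>k. (3 ^ k) ^ p * exp (- b * 3 ^ k)) \<longlonglongrightarrow> 0"
proof -
  have "filterlim (\<lambda>k. 3 ^ k :: real) at_top sequentially"
    by (rule filterlim_at_infinity_imp_filterlim_at_top[OF filterlim_realpow_sequentially_gt1]) simp_all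
  then have "filterlim (\<lambda>k. b * 3 ^ k) at_top sequentially"
    by (rule filterlim_tendsto_pos_mult_at_top[OF tendsto_const assms])
  from filterlim_compose[OF tendsto_power_div_exp_0 this]
  have "(\<lambda>k. (b * 3 ^ k) ^ p / exp (b * 3 ^ k)) \<longlonglongrightarrow> 0" .
  from tendsto_mult_right[OF this, of "inverse (b ^ p)"] show ?thesis
    using assms by (simp add: power_mult_distrib exp_minus field_simps)
qed

theorem theorem1p3:
  shows "\<exists>\<epsilon> :: nat \<Rightarrow> real. \<epsilon> \<longlonglongrightarrow> 0 \<and>
    (\<forall>k::nat. let n = (3::real) ^ k in
       real (f_max (Z3_pow k)) = ((n - 3) * (n - 1) / 3 + \<epsilon> k) * 3 powr (n / 9))"
proof -
  \<comment> \<open>Solving the claimed identity for the error term makes it hold for every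
    \<open>k\<close>; only convergence remains to be proved.\<close>
  define \<epsilon> where "\<epsilon> k = real (f_max (Z3_pow k)) / 3 powr (3 ^ k / 9) - (3 ^ k - 3) * (3 ^ k - 1) / 3" for k :: nat
  have "gain / 24 > 0" using gain_pos by simp
  from ex_card_small_subsets_le_exp[OF this, where 'a = "nat \<Rightarrow> 3"]
  obtain \<beta>1 :: real where \<beta>1: "\<beta>1 > 0"
    and \<beta>1': "\<forall>(A :: (nat \<Rightarrow> 3) set) (t :: real). finite A \<longrightarrow> t \<le> \<beta>1 * card A \<longrightarrow>
      card {T. T \<subseteq> A \<and> card T \<le> t} \<le> exp (gain / 24 * card A)"
    by (elim exE conjE)
  \<comment> \<open>The budget \<open>\<beta>1\<close> for the size of \<open>T\<close> near a
    hyperplane is shared between \<open>\<tau>\<close> and \<open>2 * \<delta>\<close>, half each.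
    The second budget \<open>\<beta>2\<close> depends on \<open>\<tau>\<close> through
    \<open>\<theta>\<close>, so \<open>\<delta>\<close> can only be chosen after both.\<close>
  define \<tau> where "\<tau> = min (\<beta>1 / 2) (1 / 2)"
  have \<tau>: "0 < \<tau>" "\<tau> \<le> 1 / 2" using \<beta>1 by (auto simp: \<tau>_def)
  define \<theta> where "\<theta> = \<tau>\<^sup>2 / 16 * ln 3 / 6"
  have \<theta>: "\<theta> > 0" using \<tau> by (simp add: \<theta>_def)
  from ex_card_small_subsets_le_exp[OF \<theta>, where 'a = "nat \<Rightarrow> 3"]
  obtain \<beta>2 :: real where \<beta>2: "\<beta>2 > 0"
    and \<beta>2': "\<forall>(A :: (nat \<Rightarrow> 3) set) (t :: real). finite A \<longrightarrow> t \<le> \<beta>2 * card A \<longrightarrow>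
      card {T. T \<subseteq> A \<and> card T \<le> t} \<le> exp (\<theta> * card A)"
    by (elim exE conjE)
  define \<delta> where "\<delta> = min (\<beta>2 / 2) (\<beta>1 / 4)"
  have \<delta>: "\<delta> > 0" "2 * \<delta> \<le> \<beta>2" "\<tau> + 2 * \<delta> \<le> \<beta>1" using \<beta>1 \<beta>2 by (auto simp: \<delta>_def \<tau>_def)
  obtain j where j: "real j * \<delta> ^ 5 > 1"
    using reals_Archimedean3[of "\<delta> ^ 5"] \<delta>(1) by auto
  define U where "U k = (3 ^ k) ^ 3 * exp (- (gain / 3) * 3 ^ k) + (3 ^ k) ^ 1 * exp (- (gain / 3) * 3 ^ k)
    + exp (3 * gain / 4) * ((3 ^ k) ^ 1 * exp (- (gain / 24) * 3 ^ k))
    + 2 ^ 3 ^ tower j * ((3 ^ k) ^ tower j * exp (- \<theta> * 3 ^ k))" for k :: nat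
  define L where "L k = exp (3 * gain / 4) * ((3 ^ k) ^ 3 * exp (- (gain / 12) * 3 ^ k))
    + 4 * ((3 ^ k) ^ 6 * exp (- ((ln 3 - ln 2) / 9) * 3 ^ k))" for k :: nat
  have U: "U \<longlonglongrightarrow> 0" unfolding U_def
    by (intro tendsto_add_zero tendsto_mult_right_zero power_times_exp_tendsto_0) (use gain_pos \<theta> in auto)
  have L: "L \<longlonglongrightarrow> 0" unfolding L_def
    by (intro tendsto_add_zero tendsto_mult_right_zero power_times_exp_tendsto_0) (use gain_pos in auto)
  \<comment> \<open>For \<open>k \<ge> 1\<close> the cardinality is three times an integer, as the
    counting bounds require; the limit ignores \<open>k = 0\<close>.\<close>
  have bounds: "- L k \<le> \<epsilon> k \<and> \<epsilon> k \<le> U k" if "k \<ge> 1" for k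
  proof -
    interpret ternary_space "cube k" "cube_dot k" k by (rule ternary_space_cube)
    have m: "card (cube k) = 3 * 3 ^ (k - 1)" using that by (simp add: card_cube flip: power_Suc)
    have n: "(3::real) ^ k = card (cube k)" by (simp add: card_cube)
    define P where "P = (3::real) powr (3 ^ k / 9)"
    have P: "P > 0" by (simp add: P_def)
    have f: "real (f_max (Z3_pow k)) = card {A. msf A}" by (simp add: f_max_Z3_pow)
    have s1: "card (small_sets ((\<tau> + 2 * \<delta>) * 3 ^ k)) \<le> exp (gain / 24 * 3 ^ k)"
      using \<beta>1'[rule_format, OF finite_V, of "(\<tau> + 2 * \<delta>) * 3 ^ k"] \<delta>(3) unfolding small_sets_def n[symmetric]
      by (simp add: mult_right_mono)
    have s2: "card (small_sets (2 * \<delta> * 3 ^ k)) \<le> exp (\<theta> * 3 ^ k)"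
      using \<beta>2'[rule_format, OF finite_V, of "2 * \<delta> * 3 ^ k"] \<delta>(2) unfolding small_sets_def n[symmetric]
      by (simp add: mult_right_mono)
    have "real (f_max (Z3_pow k)) \<le> ((3 ^ k - 3) * (3 ^ k - 1) / 3 + U k) * P"
      using card_msf_upper_exp[OF \<delta>(1) j \<tau> m n s1] s2 unfolding f U_def P_def \<theta>_def by simp
    then have "real (f_max (Z3_pow k)) / P \<le> (3 ^ k - 3) * (3 ^ k - 1) / 3 + U k"
      by (simp only: pos_divide_le_eq[OF P])
    then have "\<epsilon> k \<le> U k" unfolding \<epsilon>_def P_def by linarith
    moreover have "((3 ^ k - 3) * (3 ^ k - 1) / 3 - L k) * P \<le> real (f_max (Z3_pow k))"
      using card_msf_lower_exp[OF m n] unfolding f L_def P_def by simp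
    then have "(3 ^ k - 3) * (3 ^ k - 1) / 3 - L k \<le> real (f_max (Z3_pow k)) / P"
      by (simp only: pos_le_divide_eq[OF P])
    then have "- L k \<le> \<epsilon> k" unfolding \<epsilon>_def P_def by linarith
    ultimately show ?thesis by blast
  qed
  have "\<epsilon> \<longlonglongrightarrow> 0"
  proof (rule tendsto_sandwich)
    show "\<forall>\<^sub>F k in sequentially. - L k \<le> \<epsilon> k" "\<forall>\<^sub>F k in sequentially. \<epsilon> k \<le> U k"
      using bounds by (auto intro: eventually_sequentiallyI[of 1])
    show "(\<lambda>k. - L k) \<longlonglongrightarrow> 0" using tendsto_minus[OF L] by simp
  qed (rule U)
  moreover have "real (f_max (Z3_pow k)) = ((3 ^ k - 3) * (3 ^ k - 1) / 3 + \<epsilon> k) * 3 powr (3 ^ k / 9)" for k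
    by (simp add: \<epsilon>_def)
  ultimately show ?thesis by (auto simp: Let_def)
qed

end
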